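(* Let $d\ge1$, $n\ge2$ be integers with $d+n\le5$. Let $\mathbf{Q}=(Q_1,\dots,Q_n)$ be an $n$-tuple of real quadratic forms in $d$ variables with $\mathfrak{d}_{d,n}(\mathbf{Q})=d$ and $\mathfrak{d}_{d,1}(\mathbf{Q})>0$. (a) Suppose $d=n=2$. (a1) If $\mathfrak{d}_{2,1}(\mathbf{Q})=1$ and $\mathfrak{d}_{1,2}(\mathbf{Q})=0$, then $\mathbf{Q}\equiv(\xi_1^2,\xi_1\xi_2)$. (a2) If $\mathfrak{d}_{2,1}(\mathbf{Q})=1$ and $\mathfrak{d}_{1,2}(\mathbf{Q})=1$, then $\mathbf{Q}\equiv(\xi_1^2,\xi_2^2)$. (a3) If $\mathfrak{d}_{2,1}(\mathbf{Q})=2$, then $\mathbf{Q}\equiv(\xi_1\xi_2,\xi_1^2-\xi_2^2)$. (b) Suppose $d=2$ and $n=3$. Then $\mathbf{Q}\equiv(\xi_1^2,\xi_1\xi_2,\xi_2^2)$. (c) Suppose $d=3$ and $n=2$. (c1) If $\mathfrak{d}_{3,1}(\mathbf{Q})=1$ and $\mathfrak{d}_{2,2}(\mathbf{Q})=1$, then $\mathbf{Q}\equiv(\xi_1^2,\xi_2^2+\xi_1\xi_3)$ or $\mathbf{Q}\equiv(\xi_1^2,\xi_2\xi_3)$. (c2) If $\mathfrak{d}_{3,1}(\mathbf{Q})=1$ and $\mathfrak{d}_{2,2}(\mathbf{Q})=2$, then $\mathbf{Q}\equiv(\xi_1^2,\xi_2^2+\xi_3^2)$. (c3) If $\mathfrak{d}_{3,1}(\mathbf{Q})=2$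 and $\mathfrak{d}_{2,2}(\mathbf{Q})=0$, then $\mathbf{Q}\equiv(\xi_1\xi_2,\xi_1\xi_3)$. (c4) If $\mathfrak{d}_{3,1}(\mathbf{Q})=2$ and $\mathfrak{d}_{2,2}(\mathbf{Q})=1$, then $\mathbf{Q}\equiv(\xi_1\xi_2,\xi_2^2+\xi_1\xi_3)$ or $\mathbf{Q}\equiv(\xi_1\xi_2,\xi_1^2+\xi_3^2)$ or $\mathbf{Q}\equiv(\xi_1\xi_2,\xi_1^2-\xi_3^2)$. (c5) If $\mathfrak{d}_{3,1}(\mathbf{Q})=2$ and $\mathfrak{d}_{2,2}(\mathbf{Q})=2$, then $\mathbf{Q}\equiv(\xi_1^2+\xi_2^2,\xi_2^2+\xi_3^2)$ or $\mathbf{Q}\equiv(\xi_1^2-\xi_2^2,\xi_2^2-\xi_3^2)$ or $\mathbf{Q}\equiv(\xi_1^2-\xi_2^2,\xi_1\xi_2+\xi_3^2)$. Moreover, this is a complete classification: every such $\mathbf{Q}$ (with $n\ge2$, $d+n\le5$, $\mathfrak{d}_{d,n}(\mathbf{Q})=d$, $\mathfrak{d}_{d,1}(\mathbf{Q})>0$) falls into one of the cases listed, and the listed quadratic forms are pairwise not equivalent.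
   Context: For $M\in\mathbb{R}^{d\times d}$, $N\in\mathbb{R}^{n\times n'}$ let $R_{N,M}\mathbf{Q}=(\mathbf{Q}\circ M)\cdot N$ (an $n'$-tuple of quadratic forms; $(0)$ if $n'=0$). Two $n$-tuples in $d$ variables are equivalent, $\mathbf{Q}\equiv\mathbf{Q}'$, if $\mathbf{Q}'=R_{N,M}\mathbf{Q}$ for some $(N,M)\in\mathrm{GL}(n,\mathbb{R})\times\mathrm{GL}(d,\mathbb{R})$. $\mathrm{NV}$ of a tuple of quadratic forms is the number of indices $i\in\{1,\dots,d\}$ such that $\partial_{\xi_i}$ of some component is not identically zero. For $0\le d'\le d$, $0\le n'\le n$, $$\mathfrak{d}_{d',n'}(\mathbf{Q})=\inf_{M\in\mathbb{R}^{d\times d},\,\mathrm{rank}(M)=d'}\ \inf_{N\in\mathbb{R}^{n\times n'},\,\mathrm{rank}(N)=n'}\mathrm{NV}(R_{N,M}\mathbf{Q}).$$ *)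

theory Defs
  imports "HOL-Analysis.Derivative" "Jordan_Normal_Form.DL_Rank"
begin

no_notation Finite_Cartesian_Product.vec_nth (infixl "$" 90)

text \<open>
  An \<open>n\<close>-tuple of quadratic forms in \<open>d\<close> variables is a map from \<open>carrier_vec d\<close> to
  \<open>carrier_vec n\<close>; its values outside \<open>carrier_vec d\<close> are irrelevant. Variables and components
  are indexed from \<open>0\<close>, so that \<open>\<xi> $ 0\<close> stands for $\xi_1$.
\<close>

definition quadratic_form :: "nat \<Rightarrow> (real vec \<Rightarrow> real) \<Rightarrow> bool" where
  "quadratic_form d q \<longleftrightarrow>
     (\<exists>a :: nat \<Rightarrow> nat \<Rightarrow> real. \<forall>\<xi> \<in> carrier_vec d.
        q \<xi> = (\<Sum>i<d. \<Sum>j<d. a i j * (\<xi> $ i * \<xi> $ j)))"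

definition quadratic_tuple :: "nat \<Rightarrow> nat \<Rightarrow> (real vec \<Rightarrow> real vec) \<Rightarrow> bool" where
  "quadratic_tuple d n Q \<longleftrightarrow>
     Q \<in> carrier_vec d \<rightarrow> carrier_vec n \<and> (\<forall>j<n. quadratic_form d (\<lambda>\<xi>. Q \<xi> $ j))"

text \<open>$R_{N,M}\mathbf{Q} = (\mathbf{Q} \circ M) \cdot N$; the row vector times matrix product is
  written as the transpose of \<open>N\<close> acting on a column vector.\<close>

definition R :: "real mat \<Rightarrow> real mat \<Rightarrow> (real vec \<Rightarrow> real vec) \<Rightarrow> real vec \<Rightarrow> real vec" where
  "R N M Q = (\<lambda>\<xi>. transpose_mat N *\<^sub>v Q (M *\<^sub>v \<xi>))"

definition equivalent ::
    "nat \<Rightarrow> nat \<Rightarrow> (real vec \<Rightarrow> real vec) \<Rightarrow> (real vec \<Rightarrow> real vec) \<Rightarrow> bool" where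
  "equivalent d n Q Q' \<longleftrightarrow>
     (\<exists>N \<in> carrier_mat n n. \<exists>M \<in> carrier_mat d d. invertible_mat N \<and> invertible_mat M \<and>
        (\<forall>\<xi> \<in> carrier_vec d. Q' \<xi> = R N M Q \<xi>))"

definition partial_derivative :: "nat \<Rightarrow> nat \<Rightarrow> (real vec \<Rightarrow> real) \<Rightarrow> real vec \<Rightarrow> real" where
  "partial_derivative d i f \<xi> = deriv (\<lambda>t. f (\<xi> + t \<cdot>\<^sub>v unit_vec d i)) 0"

text \<open>The number of variables on which an \<open>m\<close>-tuple in \<open>d\<close> variables depends. It is \<open>0\<close> for
  \<open>m = 0\<close>, in accordance with the convention that \<open>R N M Q\<close> is then the zero form.\<close>

definition NV :: "nat \<Rightarrow> nat \<Rightarrow> (real vec \<Rightarrow> real vec) \<Rightarrow> nat" where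
  "NV d m F =
     card {i. i < d \<and> (\<exists>j<m. \<exists>\<xi> \<in> carrier_vec d. partial_derivative d i (\<lambda>\<eta>. F \<eta> $ j) \<xi> \<noteq> 0)}"

text \<open>\<open>vec_space.rank k\<close> is the column rank of a matrix with \<open>k\<close> rows. In
  \<open>dd d n Q d' n'\<close>, the arguments \<open>d\<close> and \<open>n\<close> are the dimensions of \<open>Q\<close>.\<close>

definition dd :: "nat \<Rightarrow> nat \<Rightarrow> (real vec \<Rightarrow> real vec) \<Rightarrow> nat \<Rightarrow> nat \<Rightarrow> nat" where
  "dd d n Q d' n' =
     (INF M \<in> {M \<in> carrier_mat d d. vec_space.rank d M = d'}.
      INF N \<in> {N \<in> carrier_mat n n'. vec_space.rank n N = n'}. NV d n' (R N M Q))"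

definition form_a1 :: "real vec \<Rightarrow> real vec" where
  "form_a1 = (\<lambda>\<xi>. vec_of_list [(\<xi> $ 0)\<^sup>2, \<xi> $ 0 * \<xi> $ 1])"
definition form_a2 :: "real vec \<Rightarrow> real vec" where
  "form_a2 = (\<lambda>\<xi>. vec_of_list [(\<xi> $ 0)\<^sup>2, (\<xi> $ 1)\<^sup>2])"
definition form_a3 :: "real vec \<Rightarrow> real vec" where
  "form_a3 = (\<lambda>\<xi>. vec_of_list [\<xi> $ 0 * \<xi> $ 1, (\<xi> $ 0)\<^sup>2 - (\<xi> $ 1)\<^sup>2])"

definition form_b :: "real vec \<Rightarrow> real vec" where
  "form_b = (\<lambda>\<xi>. vec_of_list [(\<xi> $ 0)\<^sup>2, \<xi> $ 0 * \<xi> $ 1, (\<xi> $ 1)\<^sup>2])"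

definition form_c1_1 :: "real vec \<Rightarrow> real vec" where
  "form_c1_1 = (\<lambda>\<xi>. vec_of_list [(\<xi> $ 0)\<^sup>2, (\<xi> $ 1)\<^sup>2 + \<xi> $ 0 * \<xi> $ 2])"
definition form_c1_2 :: "real vec \<Rightarrow> real vec" where
  "form_c1_2 = (\<lambda>\<xi>. vec_of_list [(\<xi> $ 0)\<^sup>2, \<xi> $ 1 * \<xi> $ 2])"
definition form_c2 :: "real vec \<Rightarrow> real vec" where
  "form_c2 = (\<lambda>\<xi>. vec_of_list [(\<xi> $ 0)\<^sup>2, (\<xi> $ 1)\<^sup>2 + (\<xi> $ 2)\<^sup>2])"
definition form_c3 :: "real vec \<Rightarrow> real vec" where
  "form_c3 = (\<lambda>\<xi>. vec_of_list [\<xi> $ 0 * \<xi> $ 1, \<xi> $ 0 * \<xi> $ 2])"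
definition form_c4_1 :: "real vec \<Rightarrow> real vec" where
  "form_c4_1 = (\<lambda>\<xi>. vec_of_list [\<xi> $ 0 * \<xi> $ 1, (\<xi> $ 1)\<^sup>2 + \<xi> $ 0 * \<xi> $ 2])"
definition form_c4_2 :: "real vec \<Rightarrow> real vec" where
  "form_c4_2 = (\<lambda>\<xi>. vec_of_list [\<xi> $ 0 * \<xi> $ 1, (\<xi> $ 0)\<^sup>2 + (\<xi> $ 2)\<^sup>2])"
definition form_c4_3 :: "real vec \<Rightarrow> real vec" where
  "form_c4_3 = (\<lambda>\<xi>. vec_of_list [\<xi> $ 0 * \<xi> $ 1, (\<xi> $ 0)\<^sup>2 - (\<xi> $ 2)\<^sup>2])"
definition form_c5_1 :: "real vec \<Rightarrow> real vec" where
  "form_c5_1 = (\<lambda>\<xi>. vec_of_list [(\<xi> $ 0)\<^sup>2 + (\<xi> $ 1)\<^sup>2, (\<xi> $ 1)\<^sup>2 + (\<xi> $ 2)\<^sup>2])"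
definition form_c5_2 :: "real vec \<Rightarrow> real vec" where
  "form_c5_2 = (\<lambda>\<xi>. vec_of_list [(\<xi> $ 0)\<^sup>2 - (\<xi> $ 1)\<^sup>2, (\<xi> $ 1)\<^sup>2 - (\<xi> $ 2)\<^sup>2])"
definition form_c5_3 :: "real vec \<Rightarrow> real vec" where
  "form_c5_3 = (\<lambda>\<xi>. vec_of_list [(\<xi> $ 0)\<^sup>2 - (\<xi> $ 1)\<^sup>2, \<xi> $ 0 * \<xi> $ 1 + (\<xi> $ 2)\<^sup>2])"

definition pairwise_inequivalent :: "nat \<Rightarrow> nat \<Rightarrow> (real vec \<Rightarrow> real vec) list \<Rightarrow> bool" where
  "pairwise_inequivalent d n Qs \<longleftrightarrow>
     (\<forall>i < length Qs. \<forall>j < length Qs. i \<noteq> j \<longrightarrow> \<not> equivalent d n (Qs ! i) (Qs ! j))"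

end

theory Submission
  imports Defs
begin

text \<open>
  Everything is expressed through the span of the components of \<open>Q\<close>: the matrix \<open>N\<close> changes the basis
  of this span and \<open>M\<close> the coordinates. \<open>NV\<close> counts the coordinate directions along which a tuple is not
  invariant under translation, which gives the numbers \<open>dd\<close> a geometric meaning. \<open>dd d n Q d n = d\<close>
  means that no nonzero vector lies in the radical of all components, \<open>dd d n Q d 1 > 0\<close> that the
  components are linearly independent (\<open>dd_pos_iff\<close>), and \<open>dd d n Q d 1 \<le> 1\<close> that some nontrivial
  combination of them is a multiple of the square of a linear form (\<open>dd_full_one_imp_square\<close>). \<open>dd d n Q 2 n\<close> is \<open>0\<close> if there is
  a plane on which all components vanish (\<open>dd_two_zero_iff\<close>), and at most \<open>1\<close> if there is a plane on which
  they are all multiples of the same square (\<open>dd_two_le_one_iff\<close>). All of these numbers are invariant under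
  equivalence (\<open>dd_equivalent\<close>).

  For \<open>d = 3\<close> and \<open>n = 2\<close> the span is a pencil. The discriminant is a cubic form, so along the half circle
  from $Q_1$ to $-Q_1$ in the pencil it changes sign, and some member of the pencil is singular
  (\<open>pencil_has_singular_member\<close>). With a null vector of that member as the third basis vector it becomes a
  binary form, that is, up to scaling, $x^2$, $xy$ or $x^2+y^2$. Completing squares in a second member
  and subtracting multiples of the first then leads to one of the ten normal forms, to a pair with a
  common radical vector or to a dependent pair (\<open>classified3_square\<close>, \<open>classified3_hyperbolic\<close>,
  \<open>classified3_elliptic\<close>); the last two possibilities are excluded by the hypotheses.
  For \<open>d = n = 2\<close> every member of the pencil is already binary and the same steps apply
  (\<open>classified2_all\<close>). For \<open>d = 2\<close> and \<open>n = 3\<close> three independent forms span the space of all binary forms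
  (\<open>equivalent_form_b\<close>), and for \<open>d = 1\<close> two forms are always dependent (\<open>dd_one_variable\<close>).

  It remains to evaluate \<open>dd\<close> on the normal forms: the values show to which case each normal form belongs,
  hence that a tuple with given values is equivalent to a form of that case, and that forms of different
  cases are not equivalent. Inside a case for \<open>d = 3\<close> the number of lines of real common zeros separates
  the forms: it is 1 and 2 for \<open>form_c1_1\<close> and \<open>form_c1_2\<close>, it is 2, 1 and 3 for \<open>form_c4_1\<close>,
  \<open>form_c4_2\<close> and \<open>form_c4_3\<close>, and it is 0, 4 and 2 for \<open>form_c5_1\<close>, \<open>form_c5_2\<close> and \<open>form_c5_3\<close>.
  To tell these apart it suffices to know whether there are at least two and at least three such lines
  (\<open>has_zero_lines\<close>).
\<close>

section \<open>Quadratic functions along lines and the number of variables\<close>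

text \<open>The two properties of a quadratic form that determine \<open>NV\<close>. Unlike the coefficient description
  they pass to \<open>R N M Q\<close> at once, because matrices map lines to lines.\<close>

definition line_quadratic :: "nat \<Rightarrow> (real vec \<Rightarrow> real) \<Rightarrow> bool" where
  "line_quadratic d q \<longleftrightarrow>
     (\<forall>\<xi> \<in> carrier_vec d. \<forall>v \<in> carrier_vec d. \<exists>\<beta> \<gamma>. \<forall>t. q (\<xi> + t \<cdot>\<^sub>v v) = q \<xi> + t * \<beta> + t\<^sup>2 * \<gamma>) \<and>
     (\<forall>v \<in> carrier_vec d. \<forall>t. q (t \<cdot>\<^sub>v v) = t\<^sup>2 * q v)"

lemma line_quadratic_of_form:
  assumes "quadratic_form d q"
  shows "line_quadratic d q"
proof -
  obtain a :: "nat \<Rightarrow> nat \<Rightarrow> real"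
    where q: "\<And>\<xi>. \<xi> \<in> carrier_vec d \<Longrightarrow> q \<xi> = (\<Sum>i<d. \<Sum>j<d. a i j * (\<xi> $ i * \<xi> $ j))"
    using assms unfolding quadratic_form_def by blast
  show ?thesis unfolding line_quadratic_def
  proof (intro conjI ballI allI)
    fix \<xi> v :: "real vec" assume car: "\<xi> \<in> carrier_vec d" "v \<in> carrier_vec d"
    let ?\<beta> = "\<Sum>i<d. \<Sum>j<d. a i j * (\<xi> $ i * v $ j + v $ i * \<xi> $ j)"
    let ?\<gamma> = "\<Sum>i<d. \<Sum>j<d. a i j * (v $ i * v $ j)"
    have "q (\<xi> + t \<cdot>\<^sub>v v) = q \<xi> + t * ?\<beta> + t\<^sup>2 * ?\<gamma>" for t
    proof -
      have "q (\<xi> + t \<cdot>\<^sub>v v) = (\<Sum>i<d. \<Sum>j<d. a i j * (\<xi> $ i * \<xi> $ j)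
          + t * (a i j * (\<xi> $ i * v $ j + v $ i * \<xi> $ j)) + t\<^sup>2 * (a i j * (v $ i * v $ j)))"
        using car by (subst q) (auto intro!: sum.cong simp: algebra_simps power2_eq_square)
      also have "\<dots> = q \<xi> + t * ?\<beta> + t\<^sup>2 * ?\<gamma>"
        unfolding q[OF car(1)] sum.distrib sum_distrib_left ..
      finally show ?thesis .
    qed
    then show "\<exists>\<beta> \<gamma>. \<forall>t. q (\<xi> + t \<cdot>\<^sub>v v) = q \<xi> + t * \<beta> + t\<^sup>2 * \<gamma>" by blast
  next
    fix v :: "real vec" and t :: real assume car: "v \<in> carrier_vec d"
    then have "q (t \<cdot>\<^sub>v v) = (\<Sum>i<d. \<Sum>j<d. t\<^sup>2 * (a i j * (v $ i * v $ j)))"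
      by (subst q) (auto intro!: sum.cong simp: algebra_simps power2_eq_square)
    also have "\<dots> = t\<^sup>2 * q v" unfolding q[OF car] sum_distrib_left ..
    finally show "q (t \<cdot>\<^sub>v v) = t\<^sup>2 * q v" .
  qed
qed

lemma line_quadratic_comp:
  assumes q: "\<And>k. k < n \<Longrightarrow> line_quadratic d (q k)" and M: "M \<in> carrier_mat d d"
  shows "line_quadratic d (\<lambda>\<xi>. \<Sum>k<n. c k * q k (M *\<^sub>v \<xi>))"
  unfolding line_quadratic_def
proof (intro conjI ballI allI)
  fix \<xi> v :: "real vec" assume car: "\<xi> \<in> carrier_vec d" "v \<in> carrier_vec d"
  have "\<forall>k. \<exists>\<beta> \<gamma>. k < n \<longrightarrow> (\<forall>t. q k (M *\<^sub>v \<xi> + t \<cdot>\<^sub>v (M *\<^sub>v v)) = q k (M *\<^sub>v \<xi>) + t * \<beta> + t\<^sup>2 * \<gamma>)"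
    using q M car unfolding line_quadratic_def by (meson mult_mat_vec_carrier)
  then obtain \<beta> \<gamma> where *: "\<And>k t. k < n \<Longrightarrow>
      q k (M *\<^sub>v \<xi> + t \<cdot>\<^sub>v (M *\<^sub>v v)) = q k (M *\<^sub>v \<xi>) + t * \<beta> k + t\<^sup>2 * \<gamma> k"
    by metis
  have line: "M *\<^sub>v (\<xi> + t \<cdot>\<^sub>v v) = M *\<^sub>v \<xi> + t \<cdot>\<^sub>v (M *\<^sub>v v)" for t
    using M car by (simp add: mult_add_distrib_mat_vec mult_mat_vec)
  have "(\<Sum>k<n. c k * q k (M *\<^sub>v (\<xi> + t \<cdot>\<^sub>v v)))
      = (\<Sum>k<n. c k * q k (M *\<^sub>v \<xi>)) + t * (\<Sum>k<n. c k * \<beta> k) + t\<^sup>2 * (\<Sum>k<n. c k * \<gamma> k)" for t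
    unfolding line sum_distrib_left sum.distrib[symmetric]
    by (intro sum.cong refl) (simp add: * algebra_simps)
  then show "\<exists>\<beta> \<gamma>. \<forall>t. (\<Sum>k<n. c k * q k (M *\<^sub>v (\<xi> + t \<cdot>\<^sub>v v)))
      = (\<Sum>k<n. c k * q k (M *\<^sub>v \<xi>)) + t * \<beta> + t\<^sup>2 * \<gamma>" by blast
next
  fix v :: "real vec" and t :: real assume car: "v \<in> carrier_vec d"
  have "q k (t \<cdot>\<^sub>v (M *\<^sub>v v)) = t\<^sup>2 * q k (M *\<^sub>v v)" if "k < n" for k
    using q[OF that] M car unfolding line_quadratic_def by (meson mult_mat_vec_carrier)
  then show "(\<Sum>k<n. c k * q k (M *\<^sub>v (t \<cdot>\<^sub>v v))) = t\<^sup>2 * (\<Sum>k<n. c k * q k (M *\<^sub>v v))"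
    using M car unfolding sum_distrib_left by (intro sum.cong refl) (simp add: mult_mat_vec)
qed

definition line_quadratic_tuple :: "nat \<Rightarrow> nat \<Rightarrow> (real vec \<Rightarrow> real vec) \<Rightarrow> bool" where
  "line_quadratic_tuple d n F \<longleftrightarrow> (\<forall>j<n. line_quadratic d (\<lambda>\<xi>. F \<xi> $ j))"

lemma R_component:
  assumes "Q \<in> carrier_vec d \<rightarrow> carrier_vec n" "N \<in> carrier_mat n m" "M \<in> carrier_mat d d"
    and "\<xi> \<in> carrier_vec d" "j < m"
  shows "R N M Q \<xi> $ j = (\<Sum>k<n. N $$ (k, j) * Q (M *\<^sub>v \<xi>) $ k)"
proof -
  have "Q (M *\<^sub>v \<xi>) \<in> carrier_vec n" using assms by auto
  then show ?thesis using assms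
    by (simp add: R_def scalar_prod_def lessThan_atLeast0)
qed

lemma line_quadratic_cong:
  assumes "\<And>\<xi>. \<xi> \<in> carrier_vec d \<Longrightarrow> p \<xi> = q \<xi>"
  shows "line_quadratic d p = line_quadratic d q"
  using assms unfolding line_quadratic_def by simp

lemma line_quadratic_tuple_R:
  assumes "quadratic_tuple d n Q" "N \<in> carrier_mat n m" "M \<in> carrier_mat d d"
  shows "line_quadratic_tuple d m (R N M Q)"
  unfolding line_quadratic_tuple_def
proof (intro allI impI)
  fix j assume "j < m"
  have "line_quadratic d (\<lambda>\<xi>. \<Sum>k<n. N $$ (k, j) * Q (M *\<^sub>v \<xi>) $ k)"
    using assms by (intro line_quadratic_comp[where q = "\<lambda>k \<eta>. Q \<eta> $ k"])
      (auto simp: quadratic_tuple_def intro: line_quadratic_of_form)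
  then show "line_quadratic d (\<lambda>\<xi>. R N M Q \<xi> $ j)"
    using R_component[OF _ assms(2,3) _ \<open>j < m\<close>] assms(1)
    by (subst line_quadratic_cong[where q = "\<lambda>\<xi>. \<Sum>k<n. N $$ (k, j) * Q (M *\<^sub>v \<xi>) $ k"])
      (auto simp: quadratic_tuple_def)
qed

text \<open>Along the line in direction \<open>i\<close> the function is \<open>q \<xi> + t * \<beta> + t\<^sup>2 * \<gamma>\<close>, with derivative
  \<open>\<beta> + 2 * t * \<gamma>\<close>; vanishing at two points of the line forces \<open>\<beta> = \<gamma> = 0\<close>.\<close>

lemma partial_derivative_zero_iff:
  assumes q: "line_quadratic d q" and i: "i < d"
  shows "(\<forall>\<xi> \<in> carrier_vec d. partial_derivative d i q \<xi> = 0) \<longleftrightarrow>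
         (\<forall>\<xi> \<in> carrier_vec d. \<forall>t. q (\<xi> + t \<cdot>\<^sub>v unit_vec d i) = q \<xi>)"
    (is "?L \<longleftrightarrow> ?R")
proof
  assume L: ?L
  show ?R
  proof (intro ballI allI)
    fix \<xi> :: "real vec" and t :: real assume car: "\<xi> \<in> carrier_vec d"
    let ?e = "unit_vec d i :: real vec"
    have e: "?e \<in> carrier_vec d" by simp
    obtain \<beta> \<gamma> where \<beta>\<gamma>: "\<And>t. q (\<xi> + t \<cdot>\<^sub>v ?e) = q \<xi> + t * \<beta> + t\<^sup>2 * \<gamma>"
      using q car e unfolding line_quadratic_def by meson
    have shift: "\<xi> + s \<cdot>\<^sub>v ?e + t \<cdot>\<^sub>v ?e = \<xi> + (s + t) \<cdot>\<^sub>v ?e" for s t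
      using car by (simp add: add_smult_distrib_vec assoc_add_vec[of _ d])
    have "partial_derivative d i q (\<xi> + s \<cdot>\<^sub>v ?e) = \<beta> + 2 * s * \<gamma>" for s
      unfolding partial_derivative_def shift \<beta>\<gamma>
      by (rule DERIV_imp_deriv) (auto intro!: derivative_eq_intros)
    then have "\<beta> + 2 * s * \<gamma> = 0" for s using L car by (metis add_carrier_vec e smult_carrier_vec)
    \<comment> \<open>The derivative at the points \<open>\<xi>\<close> and \<open>\<xi>\<close> plus the unit vector.\<close>
    from this[of 0] this[of 1] have "\<beta> = 0" "\<gamma> = 0" by auto
    then show "q (\<xi> + t \<cdot>\<^sub>v ?e) = q \<xi>" by (simp add: \<beta>\<gamma>)
  qed
next
  assume ?R then show ?L by (simp add: partial_derivative_def)
qed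

definition independent_of :: "nat \<Rightarrow> nat \<Rightarrow> (real vec \<Rightarrow> real vec) \<Rightarrow> nat \<Rightarrow> bool" where
  "independent_of d m F i \<longleftrightarrow>
     (\<forall>j<m. \<forall>\<xi> \<in> carrier_vec d. \<forall>t. F (\<xi> + t \<cdot>\<^sub>v unit_vec d i) $ j = F \<xi> $ j)"

lemma NV_eq_card:
  assumes "line_quadratic_tuple d m F"
  shows "NV d m F = card {i. i < d \<and> \<not> independent_of d m F i}"
proof -
  have "(\<exists>j<m. \<exists>\<xi> \<in> carrier_vec d. partial_derivative d i (\<lambda>\<eta>. F \<eta> $ j) \<xi> \<noteq> 0)
      \<longleftrightarrow> \<not> independent_of d m F i" if "i < d" for i
    using partial_derivative_zero_iff[OF _ that] assms
    unfolding line_quadratic_tuple_def independent_of_def by blast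
  then have "{i. i < d \<and> (\<exists>j<m. \<exists>\<xi> \<in> carrier_vec d. partial_derivative d i (\<lambda>\<eta>. F \<eta> $ j) \<xi> \<noteq> 0)}
      = {i. i < d \<and> \<not> independent_of d m F i}"
    by blast
  then show ?thesis unfolding NV_def by simp
qed

lemma NV_le:
  assumes "line_quadratic_tuple d m F" "\<And>i. i < d \<Longrightarrow> i \<notin> S \<Longrightarrow> independent_of d m F i" "finite S"
  shows "NV d m F \<le> card S"
  unfolding NV_eq_card[OF assms(1)] using assms(2,3) by (intro card_mono) auto

text \<open>Change \<open>\<xi>\<close> into \<open>\<eta>\<close> one coordinate at a time; each change is either empty or a translation under
  which \<open>F\<close> is invariant.\<close>

lemma determined_by_dependent_coordinates:
  assumes ind: "\<And>i. i < d \<Longrightarrow> i \<notin> S \<Longrightarrow> independent_of d m F i" and j: "j < m"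
    and car: "\<xi> \<in> carrier_vec d" "\<eta> \<in> carrier_vec d" and eq: "\<And>i. i \<in> S \<Longrightarrow> i < d \<Longrightarrow> \<xi> $ i = \<eta> $ i"
  shows "F \<xi> $ j = F \<eta> $ j"
proof -
  define \<zeta> where "\<zeta> k = vec d (\<lambda>i. if i < k then \<eta> $ i else \<xi> $ i)" for k
  have "k \<le> d \<Longrightarrow> F (\<zeta> k) $ j = F \<xi> $ j" for k
  proof (induction k)
    case 0
    have "\<zeta> 0 = \<xi>" using car by (auto simp: \<zeta>_def)
    then show ?case by simp
  next
    case (Suc k)
    have step: "\<zeta> (Suc k) = \<zeta> k + (\<eta> $ k - \<xi> $ k) \<cdot>\<^sub>v unit_vec d k"
      using Suc.prems by (auto simp: \<zeta>_def less_Suc_eq)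
    have "F (\<zeta> (Suc k)) $ j = F (\<zeta> k) $ j"
    proof (cases "k \<in> S")
      case True
      then have "\<zeta> (Suc k) = \<zeta> k" using eq[of k] Suc.prems by (auto simp: \<zeta>_def less_Suc_eq)
      then show ?thesis by simp
    next
      case False
      then have "independent_of d m F k" using ind Suc.prems by simp
      moreover have "\<zeta> k \<in> carrier_vec d" by (simp add: \<zeta>_def)
      ultimately show ?thesis unfolding step independent_of_def using j by blast
    qed
    then show ?case using Suc by simp
  qed
  moreover have "\<zeta> d = \<eta>" using car by (auto simp: \<zeta>_def)
  ultimately show ?thesis by (metis order_refl)
qed

lemma NV_zero_imp_zero:
  assumes F: "line_quadratic_tuple d m F" and NV: "NV d m F = 0" and "j < m" "\<xi> \<in> carrier_vec d"
  shows "F \<xi> $ j = 0"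
proof -
  have "{i. i < d \<and> \<not> independent_of d m F i} = {}"
    using NV unfolding NV_eq_card[OF F] by simp
  then have "\<And>i. i < d \<Longrightarrow> i \<notin> {} \<Longrightarrow> independent_of d m F i" by blast
  then have "F \<xi> $ j = F (0 \<cdot>\<^sub>v \<xi>) $ j"
    by (rule determined_by_dependent_coordinates[OF _ \<open>j < m\<close>]) (use assms(4) in auto)
  also have "\<dots> = 0\<^sup>2 * F \<xi> $ j" using F assms(3,4) unfolding line_quadratic_tuple_def line_quadratic_def by blast
  finally show ?thesis by simp
qed

text \<open>By homogeneity, a tuple that depends on the single coordinate \<open>k\<close> is its value at the \<open>k\<close>-th unit
  vector times the square of that coordinate.\<close>

lemma NV_one_imp_square:
  assumes F: "line_quadratic_tuple d m F" and NV: "NV d m F \<le> 1" and "0 < d"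
  obtains k where "k < d" "\<And>\<xi> j. \<xi> \<in> carrier_vec d \<Longrightarrow> j < m \<Longrightarrow> F \<xi> $ j = (\<xi> $ k)\<^sup>2 * F (unit_vec d k) $ j"
proof -
  let ?S = "{i. i < d \<and> \<not> independent_of d m F i}"
  have "finite ?S" "card ?S \<le> 1" using NV unfolding NV_eq_card[OF F] by auto
  then have "\<exists>k<d. ?S \<subseteq> {k}"
    using \<open>0 < d\<close> by (cases "?S = {}") (force simp: card_le_Suc0_iff_eq)+
  then obtain k where k: "k < d" "?S \<subseteq> {k}" by blast
  have ind: "\<And>i. i < d \<Longrightarrow> i \<notin> {k} \<Longrightarrow> independent_of d m F i" using k by blast
  have "F \<xi> $ j = (\<xi> $ k)\<^sup>2 * F (unit_vec d k) $ j" if "\<xi> \<in> carrier_vec d" "j < m" for \<xi> j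
  proof -
    have "F \<xi> $ j = F ((\<xi> $ k) \<cdot>\<^sub>v unit_vec d k) $ j"
      by (rule determined_by_dependent_coordinates[OF ind \<open>j < m\<close>]) (use that k in auto)
    then show ?thesis using F that(2) unfolding line_quadratic_tuple_def line_quadratic_def
      by (metis unit_vec_carrier)
  qed
  then show ?thesis using that k by blast
qed

lemma NV_cong:
  assumes "\<And>\<xi>. \<xi> \<in> carrier_vec d \<Longrightarrow> F \<xi> = G \<xi>"
  shows "NV d m F = NV d m G"
proof -
  have "partial_derivative d i (\<lambda>\<eta>. F \<eta> $ j) \<xi> = partial_derivative d i (\<lambda>\<eta>. G \<eta> $ j) \<xi>"
    if "\<xi> \<in> carrier_vec d" for i j \<xi>
    using that by (simp add: partial_derivative_def assms)
  then show ?thesis by (simp add: NV_def)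
qed

section \<open>Invertible matrices and rank\<close>

lemma invertible_mat_obtain_inverse:
  assumes "A \<in> carrier_mat n n" "invertible_mat A"
  obtains B where "B \<in> carrier_mat n n" "A * B = 1\<^sub>m n" "B * A = 1\<^sub>m n"
proof -
  obtain B where B: "A * B = 1\<^sub>m (dim_row A)" "B * A = 1\<^sub>m (dim_row B)"
    using assms unfolding invertible_mat_def inverts_mat_def by blast
  have "dim_row B = n" "dim_col B = n"
    using arg_cong[OF B(1), of dim_col] arg_cong[OF B(2), of dim_col] assms(1) by auto
  then show ?thesis using that[of B] B assms by auto
qed

lemma invertible_matI:
  assumes "A \<in> carrier_mat n n" "B \<in> carrier_mat n n" "A * B = 1\<^sub>m n" "B * A = 1\<^sub>m n"
  shows "invertible_mat A"
  using assms unfolding invertible_mat_def inverts_mat_def by auto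

lemma invertible_mat_iff_det:
  fixes A :: "real mat"
  assumes A: "A \<in> carrier_mat n n"
  shows "invertible_mat A \<longleftrightarrow> det A \<noteq> 0"
proof
  assume "invertible_mat A"
  then obtain B where "B \<in> carrier_mat n n" "A * B = 1\<^sub>m n"
    using invertible_mat_obtain_inverse[OF A] by blast
  then show "det A \<noteq> 0" using det_mult[OF A, of B] by auto
next
  assume "det A \<noteq> 0"
  from det_non_zero_imp_unit[OF A this, of "()"]
  obtain B where "B \<in> carrier_mat n n" "B * A = 1\<^sub>m n" "A * B = 1\<^sub>m n"
    unfolding Units_def by (auto simp: ring_mat_def)
  then show "invertible_mat A" using invertible_matI[OF A] by blast
qed

lemma invertible_mat_mult:
  fixes A B :: "real mat"
  assumes "A \<in> carrier_mat n n" "B \<in> carrier_mat n n" "invertible_mat A" "invertible_mat B"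
  shows "invertible_mat (A * B)"
  using assms by (simp add: invertible_mat_iff_det[of _ n] det_mult)

lemma invertible_mat_transpose:
  fixes A :: "real mat"
  assumes "A \<in> carrier_mat n n" "invertible_mat A"
  shows "invertible_mat (transpose_mat A)"
  using assms by (simp add: invertible_mat_iff_det[of _ n] det_transpose)

lemma cols_mult:
  assumes "A \<in> carrier_mat m n" "B \<in> carrier_mat n k"
  shows "cols (A * B) = map ((*\<^sub>v) A) (cols B)"
  using assms by (intro nth_equalityI) (auto simp: col_mult2[of A m n B k])

text \<open>A linear relation between the images \<open>A v\<close> is mapped by the left inverse \<open>B\<close> to the same relation
  between the vectors \<open>v\<close>.\<close>

lemma (in vec_space) lin_indpt_image_mult:
  assumes A: "A \<in> carrier_mat n n" and B: "B \<in> carrier_mat n n" "B * A = 1\<^sub>m n"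
    and S: "finite S" "S \<subseteq> carrier_vec n" "lin_indpt S"
  shows "lin_indpt ((*\<^sub>v) A ` S)" "card ((*\<^sub>v) A ` S) = card S"
proof -
  have inv: "B *\<^sub>v (A *\<^sub>v v) = v" if "v \<in> carrier_vec n" for v
    using that by (simp add: assoc_mult_mat_vec[OF B(1) A that, symmetric] B(2))
  then have inj: "inj_on ((*\<^sub>v) A) S" using S(2) by (intro inj_on_inverseI[of _ "(*\<^sub>v) B"]) auto
  then show "card ((*\<^sub>v) A ` S) = card S" by (rule card_image)
  obtain vs where vs: "set vs = S" "distinct vs" using finite_distinct_list[OF S(1)] by blast
  define V where "V = mat_of_cols n vs"
  have V: "V \<in> carrier_mat n (length vs)" "cols V = vs"
    using vs S(2) by (auto simp: V_def cols_mat_of_cols)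
  have AV: "A * V \<in> carrier_mat n (length vs)" "cols (A * V) = map ((*\<^sub>v) A) vs"
    using cols_mult[OF A V(1)] A V by auto
  have dist: "distinct (cols (A * V))" using AV vs inj by (simp add: distinct_map)
  show "lin_indpt ((*\<^sub>v) A ` S)"
  proof
    assume "lin_dep ((*\<^sub>v) A ` S)"
    then have "lin_dep (set (cols (A * V)))" using AV vs by simp
    then obtain v where v: "v \<in> carrier_vec (length vs)" "v \<noteq> 0\<^sub>v (length vs)" "A * V *\<^sub>v v = 0\<^sub>v n"
      using lin_depE[OF AV(1) _ dist] by blast
    have "V *\<^sub>v v = B *\<^sub>v (A * V *\<^sub>v v)"
      using A V v inv[of "V *\<^sub>v v"] by (simp add: assoc_mult_mat_vec[OF A V(1)])
    also have "\<dots> = 0\<^sub>v n" using B v by auto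
    finally have "lin_dep (set (cols V))" using lin_depI[OF V(1) v(1,2)] V vs by simp
    then show False using S V vs by simp
  qed
qed

lemma (in vec_space) rank_obtain_basis:
  assumes A: "A \<in> carrier_mat n k"
  obtains S where "S \<subseteq> set (cols A)" "lin_indpt S" "card S = rank A" "finite S"
proof -
  obtain S where "finite S" and S: "maximal S (\<lambda>T. T \<subseteq> set (cols A) \<and> lin_indpt T)"
    using maximal_exists_superset[of "set (cols A)" "\<lambda>T. T \<subseteq> set (cols A) \<and> lin_indpt T" "{}"]
    by (auto simp: lin_dep_def)
  then show ?thesis using that[of S] rank_card_indpt[OF A S] by (auto simp: maximal_def)
qed

text \<open>The columns of \<open>A * C\<close> are the images of those of \<open>C\<close>, so a maximal independent set of columns
  of \<open>C\<close> is carried to an independent set of columns of \<open>A * C\<close>.\<close>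

lemma (in vec_space) rank_le_rank_mult:
  assumes A: "A \<in> carrier_mat n n" and B: "B \<in> carrier_mat n n" "B * A = 1\<^sub>m n"
    and C: "C \<in> carrier_mat n k"
  shows "rank C \<le> rank (A * C)"
proof -
  obtain S where S: "S \<subseteq> set (cols C)" "lin_indpt S" "card S = rank C" "finite S"
    using rank_obtain_basis[OF C] by blast
  have car: "S \<subseteq> carrier_vec n" using S(1) C cols_dim by blast
  note ind = lin_indpt_image_mult[OF A B S(4) car S(2)]
  have "(*\<^sub>v) A ` S \<subseteq> set (cols (A * C))" using S(1) by (auto simp: cols_mult[OF A C])
  from rank_ge_card_indpt[OF mult_carrier_mat[OF A C] this ind(1)] show ?thesis
    using ind(2) S(3) by simp
qed

lemma (in vec_space) rank_mult_invertible:
  assumes A: "A \<in> carrier_mat n n" "invertible_mat A" and C: "C \<in> carrier_mat n k"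
  shows "rank (A * C) = rank C"
proof -
  obtain B where B: "B \<in> carrier_mat n n" "A * B = 1\<^sub>m n" "B * A = 1\<^sub>m n"
    using invertible_mat_obtain_inverse[OF A] by blast
  have "B * (A * C) = C" using B C by (simp add: assoc_mult_mat[OF B(1) A(1) C, symmetric])
  then show ?thesis
    using rank_le_rank_mult[OF A(1) B(1,3) C] rank_le_rank_mult[OF B(1) A(1) B(2), of "A * C" k] A C
    by simp
qed

definition independent_pair :: "nat \<Rightarrow> real vec \<Rightarrow> real vec \<Rightarrow> bool" where
  "independent_pair d u w \<longleftrightarrow> u \<in> carrier_vec d \<and> w \<in> carrier_vec d \<and>
     (\<forall>a b. a \<cdot>\<^sub>v u + b \<cdot>\<^sub>v w = 0\<^sub>v d \<longrightarrow> a = 0 \<and> b = 0)"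

lemma mat_of_cols_2_mult:
  assumes "u \<in> carrier_vec d" "w \<in> carrier_vec d" "v \<in> carrier_vec 2"
  shows "mat_of_cols d [u, w] *\<^sub>v v = (v $ 0) \<cdot>\<^sub>v u + (v $ 1) \<cdot>\<^sub>v (w :: real vec)"
  using assms by (intro eq_vecI)
    (auto simp: scalar_prod_def mat_of_cols_def numeral_2_eq_2 atLeast0_lessThan_Suc)

lemma independent_pair_iff:
  assumes "u \<in> carrier_vec d" "w \<in> carrier_vec d"
  shows "independent_pair d u w \<longleftrightarrow> u \<noteq> w \<and> \<not> module.lin_dep class_ring (module_vec TYPE(real) d) {u, w}"
proof -
  interpret vec_space "TYPE(real)" d .
  let ?V = "mat_of_cols d [u, w]"
  have V: "?V \<in> carrier_mat d 2" "cols ?V = [u, w]"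
    using assms by (auto simp: cols_mat_of_cols)
  have inj: "(\<forall>v \<in> carrier_vec 2. ?V *\<^sub>v v = 0\<^sub>v d \<longrightarrow> v = 0\<^sub>v 2) \<longleftrightarrow> independent_pair d u w"
  proof
    assume L: "\<forall>v \<in> carrier_vec 2. ?V *\<^sub>v v = 0\<^sub>v d \<longrightarrow> v = 0\<^sub>v 2"
    have "a = 0 \<and> b = 0" if "a \<cdot>\<^sub>v u + b \<cdot>\<^sub>v w = 0\<^sub>v d" for a b
    proof -
      let ?v = "vec 2 (\<lambda>i. if i = 0 then a else b)"
      have "?V *\<^sub>v ?v = 0\<^sub>v d" by (subst mat_of_cols_2_mult[OF assms]) (use that in simp_all)
      then have "?v = 0\<^sub>v 2" using L[rule_format, of ?v] by simp
      then have "?v $ 0 = 0\<^sub>v 2 $ 0" "?v $ 1 = 0\<^sub>v 2 $ 1" by simp_all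
      then show ?thesis by simp
    qed
    then show "independent_pair d u w" using assms by (simp add: independent_pair_def)
  next
    assume ip: "independent_pair d u w"
    show "\<forall>v \<in> carrier_vec 2. ?V *\<^sub>v v = 0\<^sub>v d \<longrightarrow> v = 0\<^sub>v 2"
    proof (intro ballI impI)
      fix v :: "real vec" assume v: "v \<in> carrier_vec 2" "?V *\<^sub>v v = 0\<^sub>v d"
      then have "v $ 0 = 0 \<and> v $ 1 = 0"
        using ip mat_of_cols_2_mult[OF assms v(1)] unfolding independent_pair_def by simp
      then show "v = 0\<^sub>v 2" using v(1) by (intro eq_vecI) (auto simp: less_2_cases_iff)
    qed
  qed
  have "\<not> independent_pair d u u"
  proof
    assume "independent_pair d u u"
    moreover have "1 \<cdot>\<^sub>v u + (-1) \<cdot>\<^sub>v u = 0\<^sub>v d" using assms(1) by (intro eq_vecI) auto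
    ultimately show False unfolding independent_pair_def by (metis zero_neq_one)
  qed
  moreover have "lin_indpt {u, w} \<longleftrightarrow> independent_pair d u w" if "u \<noteq> w"
  proof -
    have dist: "distinct (cols ?V)" "set (cols ?V) = {u, w}" using V that by auto
    show ?thesis
    proof
      assume "lin_indpt {u, w}"
      then show "independent_pair d u w"
        unfolding inj[symmetric] using lin_depI[OF V(1) _ _ _ dist(1)] dist(2) by auto
    next
      assume ip: "independent_pair d u w"
      show "lin_indpt {u, w}"
      proof
        assume "lin_dep {u, w}"
        then obtain v where "v \<in> carrier_vec 2" "v \<noteq> 0\<^sub>v 2" "?V *\<^sub>v v = 0\<^sub>v d"
          using lin_depE[OF V(1) _ dist(1)] dist(2) by auto
        then show False using ip unfolding inj[symmetric] by blast
      qed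
    qed
  qed
  ultimately show ?thesis by blast
qed

lemma rank_ge_two_imp_independent_cols:
  assumes M: "M \<in> carrier_mat d k" and rank: "vec_space.rank d M \<ge> 2"
  obtains p q where "p < k" "q < k" "p \<noteq> q" "independent_pair d (col M p) (col M q)"
proof -
  interpret vec_space "TYPE(real)" d .
  obtain S where S: "S \<subseteq> set (cols M)" "lin_indpt S" "card S = rank M" "finite S"
    using rank_obtain_basis[OF M] by blast
  then obtain T where T: "T \<subseteq> S" "card T = 2" using rank obtain_subset_with_card_n by metis
  then obtain u w where uw: "T = {u, w}" "u \<noteq> w" by (auto simp: card_2_iff)
  have "u \<in> set (cols M)" "w \<in> set (cols M)" using S T uw by auto
  then obtain p q where pq: "p < k" "col M p = u" "q < k" "col M q = w"
    using M by (auto simp: cols_def)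
  have "lin_indpt {u, w}" using S T uw subset_li_is_li by blast
  then have "independent_pair d u w" using uw pq M by (subst independent_pair_iff) auto
  then show ?thesis using that[of p q] pq uw by blast
qed

lemma nonzero_iff_lin_indpt:
  assumes "u \<in> carrier_vec d"
  shows "u \<noteq> 0\<^sub>v d \<longleftrightarrow> \<not> module.lin_dep class_ring (module_vec TYPE(real) d) {u}"
proof -
  interpret vec_space "TYPE(real)" d .
  let ?V = "mat_of_cols d [u]"
  have V: "?V \<in> carrier_mat d 1" "cols ?V = [u]"
    using assms by (auto simp: cols_mat_of_cols)
  have mult: "?V *\<^sub>v v = (v $ 0) \<cdot>\<^sub>v u" if "v \<in> carrier_vec 1" for v
    using assms that by (intro eq_vecI) (auto simp: scalar_prod_def mat_of_cols_def)
  show ?thesis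
  proof
    assume u: "u \<noteq> 0\<^sub>v d"
    show "lin_indpt {u}"
    proof
      assume "lin_dep {u}"
      then obtain v where v: "v \<in> carrier_vec 1" "v \<noteq> 0\<^sub>v 1" "?V *\<^sub>v v = 0\<^sub>v d"
        using lin_depE[OF V(1)] V(2) by auto
      have "v $ 0 \<noteq> 0" using v(1,2) by auto
      have vu: "(v $ 0) \<cdot>\<^sub>v u = 0\<^sub>v d" using mult v by simp
      have "u $ i = 0" if "i < d" for i
      proof -
        have "v $ 0 * u $ i = ((v $ 0) \<cdot>\<^sub>v u) $ i" using assms that by simp
        also have "\<dots> = 0" unfolding vu using that by simp
        finally show ?thesis using \<open>v $ 0 \<noteq> 0\<close> by simp
      qed
      then have "u = 0\<^sub>v d" using assms by (intro eq_vecI) auto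
      then show False using u by simp
    qed
  next
    assume "lin_indpt {u}" then show "u \<noteq> 0\<^sub>v d" using zero_nin_lin_indpt[of "{u}"] assms by auto
  qed
qed

lemma rank_ge_one_imp_nonzero_col:
  fixes M :: "real mat"
  assumes M: "M \<in> carrier_mat d k" and rank: "vec_space.rank d M \<ge> 1"
  obtains p where "p < k" "col M p \<noteq> 0\<^sub>v d"
proof -
  interpret vec_space "TYPE(real)" d .
  obtain S where S: "S \<subseteq> set (cols M)" "lin_indpt S" "card S = rank M" "finite S"
    using rank_obtain_basis[OF M] by blast
  then obtain u where "u \<in> S" using rank by fastforce
  then have "lin_indpt {u}" using subset_li_is_li[OF S(2), of "{u}"] by simp
  moreover have "u \<in> carrier_vec d" using \<open>u \<in> S\<close> S(1) cols_dim[of M] M by blast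
  ultimately have "u \<noteq> 0\<^sub>v d" by (simp add: nonzero_iff_lin_indpt)
  moreover obtain p where "p < k" "col M p = u"
    using M \<open>u \<in> S\<close> S(1) by (auto simp: cols_def)
  ultimately show ?thesis using that by blast
qed

lemma rank_eq_card_indpt:
  fixes M :: "real mat"
  assumes M: "M \<in> carrier_mat d k" and U: "U \<subseteq> set (cols M)" "set (cols M) \<subseteq> insert (0\<^sub>v d) U"
    and ind: "\<not> module.lin_dep class_ring (module_vec TYPE(real) d) U"
  shows "vec_space.rank d M = card U"
proof -
  interpret vec_space "TYPE(real)" d .
  have "maximal U (\<lambda>T. T \<subseteq> set (cols M) \<and> lin_indpt T)"
    unfolding maximal_def
  proof (intro conjI allI impI)
    fix T assume T: "U \<subseteq> T \<and> T \<subseteq> set (cols M) \<and> lin_indpt T"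
    then have "T \<subseteq> carrier_vec d" using M cols_dim by blast
    then have "0\<^sub>v d \<notin> T" using T zero_nin_lin_indpt[of T] by auto
    then show "T = U" using T U by blast
  qed (use U ind in auto)
  then show ?thesis by (rule rank_card_indpt[OF M])
qed

text \<open>A pair of independent vectors, padded by zero columns, gives a square matrix whose range is the plane
  that they span. With it a plane can be used as a witness in the infimum that defines \<open>dd\<close>.\<close>

lemma rank_two_padded:
  assumes "independent_pair d u w"
  defines "M \<equiv> mat d d (\<lambda>(i, j). if j = 0 then u $ i else if j = 1 then w $ i else 0)"
  assumes "2 \<le> d"
  shows "M \<in> carrier_mat d d" "vec_space.rank d M = 2"
    "\<And>\<xi>. \<xi> \<in> carrier_vec d \<Longrightarrow> M *\<^sub>v \<xi> = (\<xi> $ 0) \<cdot>\<^sub>v u + (\<xi> $ 1) \<cdot>\<^sub>v w"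
proof -
  have car: "u \<in> carrier_vec d" "w \<in> carrier_vec d" using assms by (auto simp: independent_pair_def)
  show M: "M \<in> carrier_mat d d" by (simp add: M_def)
  have c: "col M 0 = u" "col M 1 = w" "\<And>j. 2 \<le> j \<Longrightarrow> j < d \<Longrightarrow> col M j = 0\<^sub>v d"
    using car assms(3) by (auto simp: M_def)
  have "set (cols M) = (col M) ` {..<d}" using M by (auto simp: cols_def)
  moreover have "{..<d} = insert 0 (insert 1 {2..<d})" using assms(3) by auto
  ultimately have "set (cols M) = insert u (insert w (col M ` {2..<d}))" using c by simp
  moreover have "col M ` {2..<d} \<subseteq> {0\<^sub>v d}" using c by auto
  ultimately have "{u, w} \<subseteq> set (cols M)" "set (cols M) \<subseteq> insert (0\<^sub>v d) {u, w}" by auto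
  moreover have "card {u, w} = 2" using assms(1) independent_pair_iff[OF car] by simp
  ultimately show "vec_space.rank d M = 2"
    using rank_eq_card_indpt[OF M, of "{u, w}"] assms(1) independent_pair_iff[OF car] by metis
  show "M *\<^sub>v \<xi> = (\<xi> $ 0) \<cdot>\<^sub>v u + (\<xi> $ 1) \<cdot>\<^sub>v w" if "\<xi> \<in> carrier_vec d" for \<xi>
  proof (intro eq_vecI)
    fix i assume "i < dim_vec ((\<xi> $ 0) \<cdot>\<^sub>v u + (\<xi> $ 1) \<cdot>\<^sub>v w)"
    then have i: "i < d" using car by simp
    have "(M *\<^sub>v \<xi>) $ i = (\<Sum>j<d. M $$ (i, j) * \<xi> $ j)"
      using i M that by (simp add: scalar_prod_def lessThan_atLeast0)
    also have "\<dots> = (\<Sum>j\<in>{0,1}. M $$ (i, j) * \<xi> $ j)"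
      using assms(3) i by (intro sum.mono_neutral_right) (auto simp: M_def)
    finally show "(M *\<^sub>v \<xi>) $ i = ((\<xi> $ 0) \<cdot>\<^sub>v u + (\<xi> $ 1) \<cdot>\<^sub>v w) $ i"
      using i car assms(3) by (simp add: M_def)
  qed (use car M in auto)
qed

lemma rank_one_padded:
  fixes u :: "real vec"
  assumes u: "u \<in> carrier_vec d" "u \<noteq> 0\<^sub>v d" and d: "1 \<le> d"
  defines "M \<equiv> mat d d (\<lambda>(i, j). if j = 0 then u $ i else 0)"
  shows "M \<in> carrier_mat d d" "vec_space.rank d M = 1"
    "\<And>\<xi>. \<xi> \<in> carrier_vec d \<Longrightarrow> M *\<^sub>v \<xi> = (\<xi> $ 0) \<cdot>\<^sub>v u"
proof -
  show M: "M \<in> carrier_mat d d" by (simp add: M_def)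
  have c: "col M 0 = u" "\<And>j. 1 \<le> j \<Longrightarrow> j < d \<Longrightarrow> col M j = 0\<^sub>v d"
    using u d by (auto simp: M_def)
  have "set (cols M) = (col M) ` {..<d}" using M by (auto simp: cols_def)
  moreover have "{..<d} = insert 0 {1..<d}" using d by auto
  ultimately have "set (cols M) = insert u (col M ` {1..<d})" using c by simp
  moreover have "col M ` {1..<d} \<subseteq> {0\<^sub>v d}" using c by auto
  ultimately show "vec_space.rank d M = 1"
    using rank_eq_card_indpt[OF M, of "{u}"] u nonzero_iff_lin_indpt[OF u(1)] by auto
  show "M *\<^sub>v \<xi> = (\<xi> $ 0) \<cdot>\<^sub>v u" if "\<xi> \<in> carrier_vec d" for \<xi>
  proof (intro eq_vecI)
    fix i assume "i < dim_vec ((\<xi> $ 0) \<cdot>\<^sub>v u)"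
    then have i: "i < d" using u by simp
    have "(M *\<^sub>v \<xi>) $ i = (\<Sum>j<d. M $$ (i, j) * \<xi> $ j)"
      using i M that by (simp add: scalar_prod_def lessThan_atLeast0)
    also have "\<dots> = (\<Sum>j\<in>{0}. M $$ (i, j) * \<xi> $ j)"
      using d i by (intro sum.mono_neutral_right) (auto simp: M_def)
    finally show "(M *\<^sub>v \<xi>) $ i = ((\<xi> $ 0) \<cdot>\<^sub>v u) $ i"
      using i u d by (simp add: M_def)
  qed (use u M in auto)
qed

lemma rank_column:
  fixes c :: "real vec"
  assumes c: "c \<in> carrier_vec n" "c \<noteq> 0\<^sub>v n"
  shows "vec_space.rank n (mat_of_cols n [c] :: real mat) = 1"
proof -
  have "mat_of_cols n [c] \<in> carrier_mat n 1" "cols (mat_of_cols n [c]) = [c]"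
    using c by (auto simp: cols_mat_of_cols)
  then show ?thesis
    using rank_eq_card_indpt[of "mat_of_cols n [c]" n 1 "{c}"] nonzero_iff_lin_indpt[OF c(1)] c(2) by auto
qed

lemma rank_full_iff_invertible:
  fixes A :: "real mat"
  assumes "A \<in> carrier_mat n n"
  shows "vec_space.rank n A = n \<longleftrightarrow> invertible_mat A"
  using vec_space.det_rank_iff[OF assms] invertible_mat_iff_det[OF assms] by blast

section \<open>Equivalence and the numbers \<open>dd\<close>\<close>

lemma dd_le:
  assumes "M \<in> carrier_mat d d" "vec_space.rank d M = d'" "N \<in> carrier_mat n n'" "vec_space.rank n N = n'"
  shows "dd d n Q d' n' \<le> NV d n' (R N M Q)"
proof -
  have "dd d n Q d' n' \<le> (INF N \<in> {N \<in> carrier_mat n n'. vec_space.rank n N = n'}. NV d n' (R N M Q))"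
    unfolding dd_def using assms by (intro cINF_lower) auto
  also have "\<dots> \<le> NV d n' (R N M Q)" using assms by (intro cINF_lower) auto
  finally show ?thesis .
qed

text \<open>The infimum of a nonempty set of naturals is a minimum. The given matrices only serve to make both
  index sets nonempty; the infimum of the empty set of naturals would be \<open>0\<close>.\<close>

lemma dd_attained:
  fixes M0 N0 :: "real mat"
  assumes "M0 \<in> carrier_mat d d" "vec_space.rank d M0 = d'" "N0 \<in> carrier_mat n n'" "vec_space.rank n N0 = n'"
  obtains M N where "M \<in> carrier_mat d d" "vec_space.rank d M = d'"
    "N \<in> carrier_mat n n'" "vec_space.rank n N = n'" "NV d n' (R N M Q) = dd d n Q d' n'"
proof -
  let ?SM = "{M \<in> carrier_mat d d. vec_space.rank d (M :: real mat) = d'}"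
  let ?SN = "{N \<in> carrier_mat n n'. vec_space.rank n (N :: real mat) = n'}"
  have ne: "?SM \<noteq> {}" "?SN \<noteq> {}" using assms by blast+
  have "dd d n Q d' n' \<in> (\<lambda>M. INF N \<in> ?SN. NV d n' (R N M Q)) ` ?SM"
    unfolding dd_def by (rule Inf_nat_def1) (simp only: image_is_empty ne not_False_eq_True)
  then obtain M where M: "M \<in> ?SM" "dd d n Q d' n' = (INF N \<in> ?SN. NV d n' (R N M Q))" by blast
  have "(INF N \<in> ?SN. NV d n' (R N M Q)) \<in> (\<lambda>N. NV d n' (R N M Q)) ` ?SN"
    by (rule Inf_nat_def1) (simp only: image_is_empty ne not_False_eq_True)
  then show ?thesis using M that by auto
qed

lemma R_in_carrier:
  assumes "Q \<in> carrier_vec d \<rightarrow> carrier_vec n" "N \<in> carrier_mat n m" "M \<in> carrier_mat d d"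
  shows "R N M Q \<in> carrier_vec d \<rightarrow> carrier_vec m"
  using assms by (auto simp: R_def intro!: mult_mat_vec_carrier[of _ m n])

lemma R_R:
  assumes "Q \<in> carrier_vec d \<rightarrow> carrier_vec n" "\<xi> \<in> carrier_vec d"
    and "N0 \<in> carrier_mat n n" "M0 \<in> carrier_mat d d" "N \<in> carrier_mat n m" "M \<in> carrier_mat d d"
  shows "R N M (R N0 M0 Q) \<xi> = R (N0 * N) (M0 * M) Q \<xi>"
proof -
  have "M0 *\<^sub>v (M *\<^sub>v \<xi>) = M0 * M *\<^sub>v \<xi>" using assms by simp
  moreover have "Q (M0 * M *\<^sub>v \<xi>) \<in> carrier_vec n" using assms by (intro funcset_mem[OF assms(1)]) auto
  moreover have "transpose_mat (N0 * N) = transpose_mat N * transpose_mat N0"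
    using assms transpose_mult by blast
  ultimately show ?thesis unfolding R_def using assms(3,5)
    by (simp add: assoc_mult_mat_vec[of _ m n _ n])
qed

lemma equivalent_carrier:
  assumes "equivalent d n Q Q'" "Q \<in> carrier_vec d \<rightarrow> carrier_vec n"
  shows "Q' \<in> carrier_vec d \<rightarrow> carrier_vec n"
  using assms R_in_carrier[OF assms(2)] unfolding equivalent_def by (auto simp: Pi_def)

lemma equivalent_trans:
  assumes "equivalent d n P Q" "equivalent d n Q S" "P \<in> carrier_vec d \<rightarrow> carrier_vec n"
  shows "equivalent d n P S"
proof -
  obtain N M where 1: "N \<in> carrier_mat n n" "M \<in> carrier_mat d d" "invertible_mat N" "invertible_mat M"
    "\<And>\<xi>. \<xi> \<in> carrier_vec d \<Longrightarrow> Q \<xi> = R N M P \<xi>"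
    using assms(1) unfolding equivalent_def by blast
  obtain N' M' where 2: "N' \<in> carrier_mat n n" "M' \<in> carrier_mat d d" "invertible_mat N'" "invertible_mat M'"
    "\<And>\<xi>. \<xi> \<in> carrier_vec d \<Longrightarrow> S \<xi> = R N' M' Q \<xi>"
    using assms(2) unfolding equivalent_def by blast
  have "S \<xi> = R (N * N') (M * M') P \<xi>" if \<xi>: "\<xi> \<in> carrier_vec d" for \<xi>
  proof -
    have "S \<xi> = R N' M' (R N M P) \<xi>"
      using 1 2 \<xi> by (simp add: R_def)
    then show ?thesis using R_R[OF assms(3) \<xi> 1(1,2) 2(1,2)] by simp
  qed
  then show ?thesis unfolding equivalent_def
    using 1 2 invertible_mat_mult[of N n N'] invertible_mat_mult[of M d M'] by (metis mult_carrier_mat)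
qed

lemma equivalent_sym:
  assumes "equivalent d n P Q" "P \<in> carrier_vec d \<rightarrow> carrier_vec n"
  shows "equivalent d n Q P"
proof -
  obtain N M where 1: "N \<in> carrier_mat n n" "M \<in> carrier_mat d d" "invertible_mat N" "invertible_mat M"
    "\<And>\<xi>. \<xi> \<in> carrier_vec d \<Longrightarrow> Q \<xi> = R N M P \<xi>"
    using assms(1) unfolding equivalent_def by blast
  obtain N' where N': "N' \<in> carrier_mat n n" "N * N' = 1\<^sub>m n" "N' * N = 1\<^sub>m n"
    using invertible_mat_obtain_inverse 1 by blast
  obtain M' where M': "M' \<in> carrier_mat d d" "M * M' = 1\<^sub>m d" "M' * M = 1\<^sub>m d"
    using invertible_mat_obtain_inverse 1 by blast
  have "P \<xi> = R N' M' Q \<xi>" if \<xi>: "\<xi> \<in> carrier_vec d" for \<xi>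
  proof -
    have "R N' M' Q \<xi> = R N' M' (R N M P) \<xi>" using 1 M' \<xi> by (simp add: R_def)
    also have "\<dots> = R (1\<^sub>m n) (1\<^sub>m d) P \<xi>"
      using R_R[OF assms(2) \<xi> 1(1,2) N'(1) M'(1)] N' M' by simp
    also have "\<dots> = P \<xi>" using funcset_mem[OF assms(2) \<xi>] \<xi> by (simp add: R_def)
    finally show ?thesis by simp
  qed
  moreover have "invertible_mat N'" "invertible_mat M'"
    using invertible_matI 1 N' M' by blast+
  ultimately show ?thesis unfolding equivalent_def using N' M' by blast
qed

text \<open>If \<open>Q = R N M P\<close>, then \<open>R N' M' Q = R (N * N') (M * M') P\<close>, and multiplication by invertible
  matrices preserves the ranks of \<open>N'\<close> and \<open>M'\<close>.\<close>

lemma dd_le_of_equivalent: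
  fixes M0 N0 :: "real mat"
  assumes "equivalent d n P Q" "P \<in> carrier_vec d \<rightarrow> carrier_vec n"
    and ne: "M0 \<in> carrier_mat d d" "vec_space.rank d M0 = d'" "N0 \<in> carrier_mat n n'" "vec_space.rank n N0 = n'"
  shows "dd d n P d' n' \<le> dd d n Q d' n'"
proof -
  obtain N M where 1: "N \<in> carrier_mat n n" "M \<in> carrier_mat d d" "invertible_mat N" "invertible_mat M"
    "\<And>\<xi>. \<xi> \<in> carrier_vec d \<Longrightarrow> Q \<xi> = R N M P \<xi>"
    using assms(1) unfolding equivalent_def by blast
  obtain M' N' where 2: "M' \<in> carrier_mat d d" "vec_space.rank d M' = d'"
    "N' \<in> carrier_mat n n'" "vec_space.rank n N' = n'" "NV d n' (R N' M' Q) = dd d n Q d' n'"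
    using dd_attained[OF ne] by blast
  have "R N' M' Q \<xi> = R (N * N') (M * M') P \<xi>" if \<xi>: "\<xi> \<in> carrier_vec d" for \<xi>
  proof -
    have "R N' M' Q \<xi> = R N' M' (R N M P) \<xi>" using 1 2 \<xi> by (simp add: R_def)
    then show ?thesis using R_R[OF assms(2) \<xi> 1(1,2) 2(3,1)] by simp
  qed
  then have "NV d n' (R N' M' Q) = NV d n' (R (N * N') (M * M') P)" by (rule NV_cong)
  moreover have "dd d n P d' n' \<le> NV d n' (R (N * N') (M * M') P)"
    using 1 2 by (intro dd_le) (simp_all add: vec_space.rank_mult_invertible)
  ultimately show ?thesis using 2 by simp
qed

lemma dd_equivalent:
  fixes M0 N0 :: "real mat"
  assumes "equivalent d n P Q" "P \<in> carrier_vec d \<rightarrow> carrier_vec n"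
    and ne: "M0 \<in> carrier_mat d d" "vec_space.rank d M0 = d'" "N0 \<in> carrier_mat n n'" "vec_space.rank n N0 = n'"
  shows "dd d n P d' n' = dd d n Q d' n'"
  using dd_le_of_equivalent[OF assms]
    dd_le_of_equivalent[OF equivalent_sym[OF assms(1,2)] equivalent_carrier[OF assms(1,2)] ne]
  by (rule antisym)

lemma mult_unit_vec:
  fixes M :: "real mat"
  assumes "M \<in> carrier_mat m k" "p < k"
  shows "M *\<^sub>v unit_vec k p = col M p"
  using assms by (intro eq_vecI) auto

lemma rank_one_mat: "vec_space.rank n (1\<^sub>m n :: real mat) = n"
  using rank_full_iff_invertible[of "1\<^sub>m n" n] invertible_matI[of "1\<^sub>m n" n "1\<^sub>m n"] by simp

lemma independent_unit_pair:
  assumes "i < d" "j < d" "i \<noteq> j"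
  shows "independent_pair d (unit_vec d i) (unit_vec d j)"
  unfolding independent_pair_def
proof (intro conjI allI impI)
  fix a b :: real
  assume *: "a \<cdot>\<^sub>v unit_vec d i + b \<cdot>\<^sub>v unit_vec d j = 0\<^sub>v d"
  have "(a \<cdot>\<^sub>v unit_vec d i + b \<cdot>\<^sub>v unit_vec d j) $ i = a" "(a \<cdot>\<^sub>v unit_vec d i + b \<cdot>\<^sub>v unit_vec d j) $ j = b"
    using assms by simp_all
  then show "a = 0" "b = 0" unfolding * using assms by simp_all
qed simp_all

lemma rank_two_matrix_exists:
  assumes "2 \<le> d"
  obtains M :: "real mat" where "M \<in> carrier_mat d d" "vec_space.rank d M = 2"
  by (rule that[OF rank_two_padded(1,2)[OF independent_unit_pair[of 0 d 1]]]) (use assms in auto)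

lemma rank_one_matrix_exists:
  assumes "1 \<le> d"
  obtains M :: "real mat" where "M \<in> carrier_mat d d" "vec_space.rank d M = 1"
  by (rule that[OF rank_one_padded(1,2)[of "unit_vec d 0" d]]) (use assms in auto)

lemma rank_one_column_exists:
  assumes "1 \<le> n"
  obtains N :: "real mat" where "N \<in> carrier_mat n 1" "vec_space.rank n N = 1"
  using that[of "mat_of_cols n [unit_vec n 0]"] rank_column[of "unit_vec n 0" n] assms
  by (metis (no_types) length_Cons list.size(3) mat_of_cols_carrier(1) One_nat_def less_eq_Suc_le
      unit_vec_carrier unit_vec_nonzero)

text \<open>The member of the linear system spanned by the components that has the coefficients \<open>c\<close>.\<close>

definition combination :: "nat \<Rightarrow> real vec \<Rightarrow> (real vec \<Rightarrow> real vec) \<Rightarrow> real vec \<Rightarrow> real" where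
  "combination n c Q \<xi> = (\<Sum>k<n. c $ k * Q \<xi> $ k)"

lemma R_column:
  assumes "Q \<in> carrier_vec d \<rightarrow> carrier_vec n" "N \<in> carrier_mat n 1" "M \<in> carrier_mat d d"
    and "\<xi> \<in> carrier_vec d"
  shows "R N M Q \<xi> $ 0 = combination n (col N 0) Q (M *\<^sub>v \<xi>)"
  using R_component[OF assms(1-4), of 0] assms(2) by (simp add: combination_def)

lemma quadratic_tuple_carrier: "quadratic_tuple d n Q \<Longrightarrow> Q \<in> carrier_vec d \<rightarrow> carrier_vec n"
  by (simp add: quadratic_tuple_def)

lemma dd_le_card:
  assumes Q: "quadratic_tuple d n Q"
    and M: "M \<in> carrier_mat d d" "vec_space.rank d M = d'" and N: "N \<in> carrier_mat n n'" "vec_space.rank n N = n'"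
    and S: "finite S" "\<And>i. i < d \<Longrightarrow> i \<notin> S \<Longrightarrow> independent_of d n' (R N M Q) i"
  shows "dd d n Q d' n' \<le> card S"
  using dd_le[OF M N, of Q] NV_le[OF line_quadratic_tuple_R[OF Q N(1) M(1)] S(2,1)] by simp

text \<open>The coefficients of a vanishing combination, taken as the single column of \<open>N\<close>, give a form that
  depends on no variable.\<close>

lemma combination_nonzero_of_dd:
  assumes Q: "quadratic_tuple d n Q" and pos: "dd d n Q d 1 > 0"
    and c: "c \<in> carrier_vec n" "c \<noteq> 0\<^sub>v n"
  shows "\<exists>\<xi> \<in> carrier_vec d. combination n c Q \<xi> \<noteq> 0"
proof (rule ccontr)
  assume "\<not> ?thesis"
  then have z: "\<And>\<xi>. \<xi> \<in> carrier_vec d \<Longrightarrow> combination n c Q \<xi> = 0" by blast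
  let ?N = "mat_of_cols n [c]"
  have N: "?N \<in> carrier_mat n 1" "col ?N 0 = c" using c by auto
  have "independent_of d 1 (R ?N (1\<^sub>m d) Q) i" for i
    using R_column[OF quadratic_tuple_carrier[OF Q] N(1)] N(2) z by (simp add: independent_of_def)
  then have "dd d n Q d 1 \<le> card ({} :: nat set)"
    using dd_le_card[OF Q _ rank_one_mat N(1) rank_column[OF c], of "{}"] by simp
  then show False using pos by simp
qed

lemma dd_pos_iff:
  assumes Q: "quadratic_tuple d n Q" and n: "1 \<le> n"
  shows "dd d n Q d 1 > 0 \<longleftrightarrow> (\<forall>c \<in> carrier_vec n. c \<noteq> 0\<^sub>v n \<longrightarrow> (\<exists>\<xi> \<in> carrier_vec d. combination n c Q \<xi> \<noteq> 0))"
    (is "_ \<longleftrightarrow> ?R")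
proof
  assume ?R
  show "dd d n Q d 1 > 0"
  proof (rule ccontr)
    assume "\<not> dd d n Q d 1 > 0"
    moreover obtain N0 :: "real mat" where "N0 \<in> carrier_mat n 1" "vec_space.rank n N0 = 1"
      using rank_one_column_exists[OF n] .
    ultimately obtain M N where M: "M \<in> carrier_mat d d" "vec_space.rank d M = d"
      and N: "N \<in> carrier_mat n 1" "vec_space.rank n N = 1" and NV: "NV d 1 (R N M Q) = 0"
      using dd_attained[OF _ rank_one_mat, of d N0 n 1 Q] by auto
    have "col N 0 \<noteq> 0\<^sub>v n" using rank_ge_one_imp_nonzero_col[OF N(1)] N(2) by auto
    then obtain \<xi> where \<xi>: "\<xi> \<in> carrier_vec d" "combination n (col N 0) Q \<xi> \<noteq> 0"
      using \<open>?R\<close> N(1) by (metis carrier_matD(1) col_carrier_vec less_one N(1) carrier_matD(2) carrier_vecI dim_col)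
    obtain M' where M': "M' \<in> carrier_mat d d" "M * M' = 1\<^sub>m d"
      using invertible_mat_obtain_inverse M rank_full_iff_invertible by blast
    have "M *\<^sub>v (M' *\<^sub>v \<xi>) = \<xi>" using M' M(1) \<xi>(1) by (simp flip: assoc_mult_mat_vec)
    then show False
      using R_column[OF quadratic_tuple_carrier[OF Q] N(1) M(1), of "M' *\<^sub>v \<xi>"] \<xi> M'
        NV_zero_imp_zero[OF line_quadratic_tuple_R[OF Q N(1) M(1)] NV, of 0 "M' *\<^sub>v \<xi>"] by simp
  qed
qed (use combination_nonzero_of_dd[OF Q] in blast)

text \<open>For \<open>M\<close> invertible, the form \<open>R N M Q\<close> depends on one coordinate only. Pulled back by the inverse of
  \<open>M\<close>, this coordinate becomes a linear form.\<close>

lemma dd_full_one_imp_square: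
  assumes Q: "quadratic_tuple d n Q" and n: "1 \<le> n" and d: "1 \<le> d" and le: "dd d n Q d 1 \<le> 1"
  obtains c p \<kappa> where "c \<in> carrier_vec n" "c \<noteq> 0\<^sub>v n" "p \<in> carrier_vec d"
    "\<And>\<xi>. \<xi> \<in> carrier_vec d \<Longrightarrow> combination n c Q \<xi> = \<kappa> * (p \<bullet> \<xi>)\<^sup>2"
proof -
  obtain N0 :: "real mat" where "N0 \<in> carrier_mat n 1" "vec_space.rank n N0 = 1"
    using rank_one_column_exists[OF n] .
  then obtain M N where M: "M \<in> carrier_mat d d" "vec_space.rank d M = d"
    and N: "N \<in> carrier_mat n 1" "vec_space.rank n N = 1" and NV: "NV d 1 (R N M Q) \<le> 1"
    using dd_attained[OF _ rank_one_mat, of d N0 n 1 Q] le by (metis one_carrier_mat)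
  have c: "col N 0 \<noteq> 0\<^sub>v n" "col N 0 \<in> carrier_vec n"
    using rank_ge_one_imp_nonzero_col[OF N(1)] N(2) col_dim[of N 0] N(1) by auto
  obtain M' where M': "M' \<in> carrier_mat d d" "M * M' = 1\<^sub>m d"
    using invertible_mat_obtain_inverse M rank_full_iff_invertible by blast
  obtain k where k: "k < d" "\<And>\<xi> j. \<xi> \<in> carrier_vec d \<Longrightarrow> j < 1 \<Longrightarrow>
      R N M Q \<xi> $ j = (\<xi> $ k)\<^sup>2 * R N M Q (unit_vec d k) $ j"
    using NV_one_imp_square[OF line_quadratic_tuple_R[OF Q N(1) M(1)] NV] d by (metis (lifting) less_eq_Suc_le One_nat_def)
  have "combination n (col N 0) Q \<xi> = R N M Q (unit_vec d k) $ 0 * (row M' k \<bullet> \<xi>)\<^sup>2"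
    if \<xi>: "\<xi> \<in> carrier_vec d" for \<xi>
  proof -
    have "M *\<^sub>v (M' *\<^sub>v \<xi>) = \<xi>" using M' M(1) \<xi>(1) by (simp flip: assoc_mult_mat_vec)
    then have "combination n (col N 0) Q \<xi> = R N M Q (M' *\<^sub>v \<xi>) $ 0"
      using R_column[OF quadratic_tuple_carrier[OF Q] N(1) M(1), of "M' *\<^sub>v \<xi>"] \<xi> M' by simp
    then show ?thesis using k(2)[of "M' *\<^sub>v \<xi>" 0] M' k(1) \<xi> by simp
  qed
  then show ?thesis using that[OF c(2,1), of "row M' k"] k(1) M'(1) by auto
qed

text \<open>The \<open>k\<close>-th component is itself a member of the linear system.\<close>

lemma dd_full_one_le:
  assumes Q: "quadratic_tuple d n Q" and k: "k < n" and S: "finite S"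
    and ind: "\<And>i \<xi> t. i < d \<Longrightarrow> i \<notin> S \<Longrightarrow> \<xi> \<in> carrier_vec d \<Longrightarrow> Q (\<xi> + t \<cdot>\<^sub>v unit_vec d i) $ k = Q \<xi> $ k"
  shows "dd d n Q d 1 \<le> card S"
proof -
  let ?e = "unit_vec n k :: real vec"
  let ?N = "mat_of_cols n [?e]"
  have N: "?N \<in> carrier_mat n 1" "col ?N 0 = ?e" using k by auto
  have e: "?e \<noteq> 0\<^sub>v n" "?e \<in> carrier_vec n" using k by auto
  have "combination n ?e Q \<xi> = Q \<xi> $ k" for \<xi>
  proof -
    have "combination n ?e Q \<xi> = (\<Sum>j\<in>{k}. ?e $ j * Q \<xi> $ j)"
      unfolding combination_def using k by (intro sum.mono_neutral_right) auto
    then show ?thesis using k by simp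
  qed
  then have "R ?N (1\<^sub>m d) Q \<xi> $ 0 = Q \<xi> $ k" if "\<xi> \<in> carrier_vec d" for \<xi>
    using R_column[OF quadratic_tuple_carrier[OF Q] N(1), of "1\<^sub>m d" \<xi>] that N(2) by simp
  then have "independent_of d 1 (R ?N (1\<^sub>m d) Q) i" if "i < d" "i \<notin> S" for i
    using that ind by (simp add: independent_of_def)
  then show ?thesis
    using dd_le_card[OF Q _ rank_one_mat N(1) rank_column[OF e(2,1)] S] by simp
qed

lemma R_one_left:
  assumes "Q \<in> carrier_vec d \<rightarrow> carrier_vec n" "M \<in> carrier_mat d d" "\<xi> \<in> carrier_vec d"
  shows "R (1\<^sub>m n) M Q \<xi> = Q (M *\<^sub>v \<xi>)"
proof -
  have "Q (M *\<^sub>v \<xi>) \<in> carrier_vec n" using assms by (intro funcset_mem[OF assms(1)]) simp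
  then show ?thesis by (simp add: R_def)
qed

lemma dd_full_radical:
  assumes Q: "quadratic_tuple d n Q" and i: "i < d"
    and inv: "\<And>\<xi> t. \<xi> \<in> carrier_vec d \<Longrightarrow> Q (\<xi> + t \<cdot>\<^sub>v unit_vec d i) = Q \<xi>"
  shows "dd d n Q d n < d"
proof -
  have "independent_of d n (R (1\<^sub>m n) (1\<^sub>m d) Q) i"
    using R_one_left[OF quadratic_tuple_carrier[OF Q], of "1\<^sub>m d"] inv by (simp add: independent_of_def)
  then have "dd d n Q d n \<le> card ({..<d} - {i})"
    by (intro dd_le_card[OF Q _ rank_one_mat _ rank_one_mat]) auto
  then show ?thesis using i by simp
qed

lemma transpose_mult_inj:
  fixes N :: "real mat"
  assumes N: "N \<in> carrier_mat n n" "vec_space.rank n N = n" and v: "v \<in> carrier_vec n" "w \<in> carrier_vec n"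
    and eq: "transpose_mat N *\<^sub>v v = transpose_mat N *\<^sub>v w"
  shows "v = w"
proof -
  have "invertible_mat (transpose_mat N)"
    using N rank_full_iff_invertible invertible_mat_transpose by blast
  then obtain B where B: "B \<in> carrier_mat n n" "B * transpose_mat N = 1\<^sub>m n"
    using invertible_mat_obtain_inverse N by (metis transpose_carrier_mat)
  have "B *\<^sub>v (transpose_mat N *\<^sub>v x) = x" if "x \<in> carrier_vec n" for x
    using assoc_mult_mat_vec[OF B(1) _ that, of "transpose_mat N"] N that B(2) by simp
  then show ?thesis using eq v by metis
qed

text \<open>\<open>N\<close> is invertible, so that no information about \<open>Q\<close> is lost in \<open>R N M Q\<close>.\<close>

lemma R_zero_imp_zero:
  assumes Q: "quadratic_tuple d n Q" and M: "M \<in> carrier_mat d d"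
    and N: "N \<in> carrier_mat n n" "vec_space.rank n N = n"
    and NV: "NV d n (R N M Q) = 0" and \<xi>: "\<xi> \<in> carrier_vec d"
  shows "Q (M *\<^sub>v \<xi>) = 0\<^sub>v n"
proof -
  note car = quadratic_tuple_carrier[OF Q]
  have QM: "Q (M *\<^sub>v \<xi>) \<in> carrier_vec n" using M \<xi> by (intro funcset_mem[OF car]) simp
  have "R N M Q \<xi> = 0\<^sub>v n"
    using NV_zero_imp_zero[OF line_quadratic_tuple_R[OF Q N(1) M] NV _ \<xi>] funcset_mem[OF R_in_carrier[OF car N(1) M] \<xi>]
    by (intro eq_vecI) auto
  then have "transpose_mat N *\<^sub>v Q (M *\<^sub>v \<xi>) = transpose_mat N *\<^sub>v 0\<^sub>v n"
    using N(1) by (auto simp: R_def)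
  then show ?thesis using transpose_mult_inj[OF N QM] by simp
qed

lemma dd_one_zero_iff:
  assumes Q: "quadratic_tuple d n Q" and d: "1 \<le> d"
  shows "dd d n Q 1 n = 0 \<longleftrightarrow> (\<exists>u \<in> carrier_vec d. u \<noteq> 0\<^sub>v d \<and> Q u = 0\<^sub>v n)"
proof
  assume "dd d n Q 1 n = 0"
  moreover obtain M0 :: "real mat" where "M0 \<in> carrier_mat d d" "vec_space.rank d M0 = 1"
    using rank_one_matrix_exists[OF d] .
  ultimately obtain M N where M: "M \<in> carrier_mat d d" "vec_space.rank d M = 1"
    and N: "N \<in> carrier_mat n n" "vec_space.rank n N = n" and NV: "NV d n (R N M Q) = 0"
    using dd_attained[OF _ _ _ rank_one_mat, of M0 d 1 n Q] by auto
  obtain p where p: "p < d" "col M p \<noteq> 0\<^sub>v d" using rank_ge_one_imp_nonzero_col[OF M(1)] M(2) by auto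
  have "M *\<^sub>v unit_vec d p = col M p" using M(1) p(1) by (simp add: mult_unit_vec)
  then have "Q (col M p) = 0\<^sub>v n" using R_zero_imp_zero[OF Q M(1) N NV, of "unit_vec d p"] by simp
  then show "\<exists>u \<in> carrier_vec d. u \<noteq> 0\<^sub>v d \<and> Q u = 0\<^sub>v n" using p M(1) by (metis col_carrier_vec)
next
  assume "\<exists>u \<in> carrier_vec d. u \<noteq> 0\<^sub>v d \<and> Q u = 0\<^sub>v n"
  then obtain u where u: "u \<in> carrier_vec d" "u \<noteq> 0\<^sub>v d" "Q u = 0\<^sub>v n" by blast
  note M = rank_one_padded[OF u(1,2) d]
  let ?M = "mat d d (\<lambda>(i, j). if j = 0 then u $ i else 0)"
  have "Q (a \<cdot>\<^sub>v u) = 0\<^sub>v n" for a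
  proof (intro eq_vecI)
    have "Q (a \<cdot>\<^sub>v u) \<in> carrier_vec n" using u by (intro funcset_mem[OF quadratic_tuple_carrier[OF Q]]) simp
    then show "dim_vec (Q (a \<cdot>\<^sub>v u)) = dim_vec (0\<^sub>v n)" by simp
    fix i assume "i < dim_vec (0\<^sub>v n)"
    then have "line_quadratic d (\<lambda>\<xi>. Q \<xi> $ i)"
      using Q unfolding quadratic_tuple_def by (auto intro: line_quadratic_of_form)
    then have "Q (a \<cdot>\<^sub>v u) $ i = a\<^sup>2 * Q u $ i" using u(1) unfolding line_quadratic_def by blast
    then show "Q (a \<cdot>\<^sub>v u) $ i = 0\<^sub>v n $ i" using u(3) \<open>i < dim_vec (0\<^sub>v n)\<close> by simp
  qed
  then have "R (1\<^sub>m n) ?M Q \<xi> = 0\<^sub>v n" if "\<xi> \<in> carrier_vec d" for \<xi>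
    using R_one_left[OF quadratic_tuple_carrier[OF Q] M(1) that] M(3)[OF that] by simp
  then have "independent_of d n (R (1\<^sub>m n) ?M Q) i" for i by (simp add: independent_of_def)
  then show "dd d n Q 1 n = 0"
    using dd_le_card[OF Q M(1,2) _ rank_one_mat, of "{}"] by simp
qed

lemma dd_one_le_one:
  assumes Q: "quadratic_tuple d n Q" and d: "1 \<le> d"
  shows "dd d n Q 1 n \<le> 1"
proof -
  let ?u = "unit_vec d 0 :: real vec"
  have u: "?u \<in> carrier_vec d" "?u \<noteq> 0\<^sub>v d" using d by auto
  note M = rank_one_padded[OF u d]
  let ?M = "mat d d (\<lambda>(i, j). if j = 0 then ?u $ i else 0)"
  have "independent_of d n (R (1\<^sub>m n) ?M Q) i" if "i < d" "i \<notin> {0}" for i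
    using R_one_left[OF quadratic_tuple_carrier[OF Q] M(1)] M(3) that by (simp add: independent_of_def)
  then show ?thesis
    using dd_le_card[OF Q M(1,2) _ rank_one_mat, of "{0}"] by simp
qed

lemma dd_two_zero_iff:
  assumes Q: "quadratic_tuple d n Q" and d: "2 \<le> d"
  shows "dd d n Q 2 n = 0 \<longleftrightarrow>
    (\<exists>u w. independent_pair d u w \<and> (\<forall>a b. Q (a \<cdot>\<^sub>v u + b \<cdot>\<^sub>v w) = 0\<^sub>v n))"
proof
  assume "dd d n Q 2 n = 0"
  moreover obtain M0 :: "real mat" where "M0 \<in> carrier_mat d d" "vec_space.rank d M0 = 2"
    using rank_two_matrix_exists[OF d] .
  ultimately obtain M N where M: "M \<in> carrier_mat d d" "vec_space.rank d M = 2"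
    and N: "N \<in> carrier_mat n n" "vec_space.rank n N = n" and NV: "NV d n (R N M Q) = 0"
    using dd_attained[OF _ _ _ rank_one_mat, of M0 d 2 n Q] by auto
  obtain p q where pq: "p < d" "q < d" "p \<noteq> q" "independent_pair d (col M p) (col M q)"
    using rank_ge_two_imp_independent_cols[OF M(1)] M(2) by auto
  have "M *\<^sub>v (a \<cdot>\<^sub>v unit_vec d p + b \<cdot>\<^sub>v unit_vec d q) = a \<cdot>\<^sub>v col M p + b \<cdot>\<^sub>v col M q" for a b
    using M(1) pq by (simp add: mult_add_distrib_mat_vec mult_mat_vec mult_unit_vec)
  then have "Q (a \<cdot>\<^sub>v col M p + b \<cdot>\<^sub>v col M q) = 0\<^sub>v n" for a b
    using R_zero_imp_zero[OF Q M(1) N NV, of "a \<cdot>\<^sub>v unit_vec d p + b \<cdot>\<^sub>v unit_vec d q"] by simp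
  then show "\<exists>u w. independent_pair d u w \<and> (\<forall>a b. Q (a \<cdot>\<^sub>v u + b \<cdot>\<^sub>v w) = 0\<^sub>v n)" using pq by blast
next
  assume "\<exists>u w. independent_pair d u w \<and> (\<forall>a b. Q (a \<cdot>\<^sub>v u + b \<cdot>\<^sub>v w) = 0\<^sub>v n)"
  then obtain u w where uw: "independent_pair d u w" and z: "\<And>a b. Q (a \<cdot>\<^sub>v u + b \<cdot>\<^sub>v w) = 0\<^sub>v n" by blast
  note M = rank_two_padded[OF uw d]
  let ?M = "mat d d (\<lambda>(i, j). if j = 0 then u $ i else if j = 1 then w $ i else 0)"
  have "R (1\<^sub>m n) ?M Q \<xi> = 0\<^sub>v n" if "\<xi> \<in> carrier_vec d" for \<xi>
    using R_one_left[OF quadratic_tuple_carrier[OF Q] M(1) that] M(3)[OF that] z by simp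
  then have "independent_of d n (R (1\<^sub>m n) ?M Q) i" for i by (simp add: independent_of_def)
  then show "dd d n Q 2 n = 0"
    using dd_le_card[OF Q M(1,2) _ rank_one_mat, of "{}"] by simp
qed

text \<open>A matrix \<open>M\<close> of rank two has two independent columns, which span its range. If \<open>Q \<circ> M\<close> depends on the
  coordinate \<open>k\<close> only, then one of the two columns, with an index other than \<open>k\<close>, is a direction \<open>w\<close>
  along which \<open>Q\<close> does not change on that plane; the other one serves as \<open>u\<close>.\<close>

lemma dd_two_le_one_iff:
  assumes Q: "quadratic_tuple d n Q" and d: "2 \<le> d"
  shows "dd d n Q 2 n \<le> 1 \<longleftrightarrow>
    (\<exists>u w. independent_pair d u w \<and> (\<forall>a b. Q (a \<cdot>\<^sub>v u + b \<cdot>\<^sub>v w) = a\<^sup>2 \<cdot>\<^sub>v Q u))"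
proof
  note car = quadratic_tuple_carrier[OF Q]
  assume le: "dd d n Q 2 n \<le> 1"
  obtain M0 :: "real mat" where "M0 \<in> carrier_mat d d" "vec_space.rank d M0 = 2"
    using rank_two_matrix_exists[OF d] .
  then obtain M N where M: "M \<in> carrier_mat d d" "vec_space.rank d M = 2"
    and N: "N \<in> carrier_mat n n" "vec_space.rank n N = n" and NV: "NV d n (R N M Q) \<le> 1"
    using dd_attained[OF _ _ _ rank_one_mat, of M0 d 2 n Q] le by (metis one_carrier_mat)
  obtain k where k: "k < d" "\<And>\<xi> j. \<xi> \<in> carrier_vec d \<Longrightarrow> j < n \<Longrightarrow>
      R N M Q \<xi> $ j = (\<xi> $ k)\<^sup>2 * R N M Q (unit_vec d k) $ j"
    using NV_one_imp_square[OF line_quadratic_tuple_R[OF Q N(1) M(1)] NV] d by (metis less_le_trans pos2)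
  have Qsq: "Q (M *\<^sub>v \<xi>) = (\<xi> $ k)\<^sup>2 \<cdot>\<^sub>v Q (M *\<^sub>v unit_vec d k)" if \<xi>: "\<xi> \<in> carrier_vec d" for \<xi>
  proof (rule transpose_mult_inj[OF N])
    have c: "Q (M *\<^sub>v \<xi>) \<in> carrier_vec n" "Q (M *\<^sub>v unit_vec d k) \<in> carrier_vec n"
      using M(1) \<xi> by (auto intro!: funcset_mem[OF car])
    then show "Q (M *\<^sub>v \<xi>) \<in> carrier_vec n" "(\<xi> $ k)\<^sup>2 \<cdot>\<^sub>v Q (M *\<^sub>v unit_vec d k) \<in> carrier_vec n" by auto
    have "R N M Q \<xi> = (\<xi> $ k)\<^sup>2 \<cdot>\<^sub>v R N M Q (unit_vec d k)"
      using k(2)[OF \<xi>] funcset_mem[OF R_in_carrier[OF car N(1) M(1)] \<xi>]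
        funcset_mem[OF R_in_carrier[OF car N(1) M(1)] unit_vec_carrier[of d k]]
      by (intro eq_vecI) auto
    then show "transpose_mat N *\<^sub>v Q (M *\<^sub>v \<xi>) = transpose_mat N *\<^sub>v ((\<xi> $ k)\<^sup>2 \<cdot>\<^sub>v Q (M *\<^sub>v unit_vec d k))"
      using c N(1) by (simp add: R_def mult_mat_vec[of _ n n])
  qed
  obtain p q where pq: "p < d" "q < d" "p \<noteq> q" "independent_pair d (col M p) (col M q)"
    using rank_ge_two_imp_independent_cols[OF M(1)] M(2) by auto
  have sym: "independent_pair d (col M q) (col M p)"
    using pq(4) unfolding independent_pair_def
    by (metis comm_add_vec smult_carrier_vec)
  have comb: "M *\<^sub>v (a \<cdot>\<^sub>v unit_vec d i + b \<cdot>\<^sub>v unit_vec d j) = a \<cdot>\<^sub>v col M i + b \<cdot>\<^sub>v col M j"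
    if "i < d" "j < d" for a b i j
    using M(1) that by (simp add: mult_add_distrib_mat_vec mult_mat_vec mult_unit_vec)
  have *: "Q (a \<cdot>\<^sub>v col M i + b \<cdot>\<^sub>v col M j) = a\<^sup>2 \<cdot>\<^sub>v Q (col M i)"
    if "i < d" "j < d" "i \<noteq> j" "j \<noteq> k" for a b i j
  proof -
    have "Q (col M i) = (if i = k then 1 else 0) \<cdot>\<^sub>v Q (M *\<^sub>v unit_vec d k)"
      using Qsq[of "unit_vec d i"] that k(1) M(1) by (simp add: mult_unit_vec)
    moreover have "Q (a \<cdot>\<^sub>v col M i + b \<cdot>\<^sub>v col M j) = (if i = k then a\<^sup>2 else 0) \<cdot>\<^sub>v Q (M *\<^sub>v unit_vec d k)"
      using Qsq[of "a \<cdot>\<^sub>v unit_vec d i + b \<cdot>\<^sub>v unit_vec d j"] that k(1) comb[OF that(1,2), of a b] by auto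
    ultimately show ?thesis by (auto simp: smult_smult_assoc)
  qed
  show "\<exists>u w. independent_pair d u w \<and> (\<forall>a b. Q (a \<cdot>\<^sub>v u + b \<cdot>\<^sub>v w) = a\<^sup>2 \<cdot>\<^sub>v Q u)"
  proof (cases "q = k")
    case False
    then show ?thesis using * pq by blast
  next
    case True
    then show ?thesis using *[of q p] pq sym by blast
  qed
next
  assume "\<exists>u w. independent_pair d u w \<and> (\<forall>a b. Q (a \<cdot>\<^sub>v u + b \<cdot>\<^sub>v w) = a\<^sup>2 \<cdot>\<^sub>v Q u)"
  then obtain u w where uw: "independent_pair d u w" and z: "\<And>a b. Q (a \<cdot>\<^sub>v u + b \<cdot>\<^sub>v w) = a\<^sup>2 \<cdot>\<^sub>v Q u" by blast
  note M = rank_two_padded[OF uw d]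
  let ?M = "mat d d (\<lambda>(i, j). if j = 0 then u $ i else if j = 1 then w $ i else 0)"
  have R: "R (1\<^sub>m n) ?M Q \<xi> = (\<xi> $ 0)\<^sup>2 \<cdot>\<^sub>v Q u" if "\<xi> \<in> carrier_vec d" for \<xi>
    using R_one_left[OF quadratic_tuple_carrier[OF Q] M(1) that] M(3)[OF that] z by simp
  have "independent_of d n (R (1\<^sub>m n) ?M Q) i" if "i < d" "i \<notin> {0}" for i
    using that d R by (simp add: independent_of_def)
  then show "dd d n Q 2 n \<le> 1"
    using dd_le_card[OF Q M(1,2) _ rank_one_mat, of "{0}"] by simp
qed

lemma dd_two_le_two:
  assumes Q: "quadratic_tuple d n Q" and d: "2 \<le> d"
  shows "dd d n Q 2 n \<le> 2"
proof -
  have uw: "independent_pair d (unit_vec d 0) (unit_vec d 1)" using d by (intro independent_unit_pair) auto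
  note M = rank_two_padded[OF uw d]
  let ?M = "mat d d (\<lambda>(i, j). if j = 0 then unit_vec d 0 $ i else if j = 1 then unit_vec d 1 $ i else 0)"
  have "independent_of d n (R (1\<^sub>m n) ?M Q) i" if "i < d" "i \<notin> {0, 1}" for i
    using R_one_left[OF quadratic_tuple_carrier[OF Q] M(1)] M(3) that d by (simp add: independent_of_def)
  then show ?thesis
    using dd_le_card[OF Q M(1,2) _ rank_one_mat, of "{0, 1}"] by simp
qed

definition nondegenerate :: "nat \<Rightarrow> nat \<Rightarrow> (real vec \<Rightarrow> real vec) \<Rightarrow> bool" where
  "nondegenerate d n Q \<longleftrightarrow> dd d n Q d n = d \<and> dd d n Q d 1 > 0"

text \<open>The conclusion of the classification together with its hypothesis. Both are invariant under
  equivalence, so that the predicate can be pulled back along each step of a reduction, and a tuple that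
  violates the hypothesis satisfies it trivially.\<close>

definition classified_by ::
    "nat \<Rightarrow> nat \<Rightarrow> (real vec \<Rightarrow> real vec) list \<Rightarrow> (real vec \<Rightarrow> real vec) \<Rightarrow> bool" where
  "classified_by d n Fs Q \<longleftrightarrow> (nondegenerate d n Q \<longrightarrow> (\<exists>F \<in> set Fs. equivalent d n Q F))"

lemma equivalent_refl:
  assumes "Q \<in> carrier_vec d \<rightarrow> carrier_vec n"
  shows "equivalent d n Q Q"
  unfolding equivalent_def
proof (intro bexI conjI ballI)
  show "invertible_mat (1\<^sub>m n :: real mat)" "invertible_mat (1\<^sub>m d :: real mat)"
    using invertible_matI[of "1\<^sub>m n" n "1\<^sub>m n"] invertible_matI[of "1\<^sub>m d" d "1\<^sub>m d"] by simp_all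
  show "Q \<xi> = R (1\<^sub>m n) (1\<^sub>m d) Q \<xi>" if "\<xi> \<in> carrier_vec d" for \<xi>
    using R_one_left[OF assms, of "1\<^sub>m d"] that by simp
qed auto

lemma dd_full_equivalent:
  assumes "equivalent d n P Q" "P \<in> carrier_vec d \<rightarrow> carrier_vec n" "1 \<le> n"
  shows "dd d n P d n = dd d n Q d n" "dd d n P d 1 = dd d n Q d 1"
proof -
  show "dd d n P d n = dd d n Q d n"
    using dd_equivalent[OF assms(1,2) _ rank_one_mat _ rank_one_mat] by simp
  obtain N0 :: "real mat" where "N0 \<in> carrier_mat n 1" "vec_space.rank n N0 = 1"
    using rank_one_column_exists[OF assms(3)] .
  then show "dd d n P d 1 = dd d n Q d 1"
    using dd_equivalent[OF assms(1,2) _ rank_one_mat, of N0] by simp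
qed

lemma dd_two_equivalent:
  assumes "equivalent d n P Q" "P \<in> carrier_vec d \<rightarrow> carrier_vec n" "2 \<le> d"
  shows "dd d n P 2 n = dd d n Q 2 n"
proof -
  obtain M0 :: "real mat" where "M0 \<in> carrier_mat d d" "vec_space.rank d M0 = 2"
    using rank_two_matrix_exists[OF assms(3)] .
  then show ?thesis using dd_equivalent[OF assms(1,2) _ _ _ rank_one_mat, of M0 2] by simp
qed

lemma dd_one_equivalent:
  assumes "equivalent d n P Q" "P \<in> carrier_vec d \<rightarrow> carrier_vec n" "1 \<le> d"
  shows "dd d n P 1 n = dd d n Q 1 n"
proof -
  obtain M0 :: "real mat" where "M0 \<in> carrier_mat d d" "vec_space.rank d M0 = 1"
    using rank_one_matrix_exists[OF assms(3)] .
  then show ?thesis using dd_equivalent[OF assms(1,2) _ _ _ rank_one_mat, of M0 1] by simp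
qed

lemma classified_by_equivalent:
  assumes "equivalent d n P Q" "P \<in> carrier_vec d \<rightarrow> carrier_vec n" "1 \<le> n" "classified_by d n Fs Q"
  shows "classified_by d n Fs P"
  using assms equivalent_trans[OF assms(1) _ assms(2)] dd_full_equivalent[OF assms(1-3)]
  unfolding classified_by_def nondegenerate_def by auto

lemma classified_by_member:
  assumes "F \<in> set Fs" "F \<in> carrier_vec d \<rightarrow> carrier_vec n"
  shows "classified_by d n Fs F"
  using assms equivalent_refl unfolding classified_by_def by blast

section \<open>Vectors and matrices of size two and three in coordinates\<close>

text \<open>Explicit vectors stay in list notation, so that their entries are found by list indexing.\<close>

declare vec_of_list_Cons [simp del] vec_of_list_Nil [simp del]

lemma vec_of_list_3:
  "vec_of_list [x, y, z] \<in> carrier_vec 3" "vec_of_list [x, y, z] $ 0 = x"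
  "vec_of_list [x, y, z] $ 1 = y" "vec_of_list [x, y, z] $ Suc 0 = y" "vec_of_list [x, y, z] $ 2 = z"
  by (simp_all add: vec_of_list_index carrier_vecI)

lemma vec_of_list_2:
  "vec_of_list [x, y] \<in> carrier_vec 2" "vec_of_list [x, y] $ 0 = x" "vec_of_list [x, y] $ 1 = y" "vec_of_list [x, y] $ Suc 0 = y"
  by (simp_all add: vec_of_list_index carrier_vecI)

lemma vec_of_list_2_eq_0_iff: "vec_of_list [s, t] = 0\<^sub>v 2 \<longleftrightarrow> s = 0 \<and> t = (0 :: real)"
proof
  assume "vec_of_list [s, t] = 0\<^sub>v 2"
  then have "vec_of_list [s, t] $ 0 = 0" "vec_of_list [s, t] $ 1 = 0" by simp_all
  then show "s = 0 \<and> t = 0" by (simp add: vec_of_list_2)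
next
  assume "s = 0 \<and> t = 0"
  then show "vec_of_list [s, t] = 0\<^sub>v 2"
    by (intro eq_vecI) (auto simp: vec_of_list_2 less_2_cases_iff)
qed

lemma carrier_vec_3E:
  assumes "\<xi> \<in> carrier_vec 3"
  obtains x y z where "\<xi> = vec_of_list [x, y, z]"
proof
  show "\<xi> = vec_of_list [\<xi> $ 0, \<xi> $ 1, \<xi> $ 2]"
    using assms by (intro eq_vecI) (auto simp: vec_of_list_index less_Suc_eq numeral_3_eq_3 numeral_2_eq_2)
qed

lemma carrier_vec_2E:
  assumes "\<xi> \<in> carrier_vec 2"
  obtains x y where "\<xi> = vec_of_list [x, y]"
proof
  show "\<xi> = vec_of_list [\<xi> $ 0, \<xi> $ 1]"
    using assms by (intro eq_vecI) (auto simp: vec_of_list_index less_Suc_eq numeral_2_eq_2)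
qed

lemma mat_2_mult:
  "mat_of_rows_list 2 [[a, b], [c, d]] *\<^sub>v vec_of_list [x, y] = vec_of_list [a * x + b * y, c * x + d * y :: real]"
  by (intro eq_vecI)
    (auto simp: mat_of_rows_list_def scalar_prod_def vec_of_list_index less_Suc_eq numeral_2_eq_2
      atLeast0_lessThan_Suc)

lemma mat_3_mult:
  "mat_of_rows_list 3 [[a, b, c], [d, e, f], [g, h, i]] *\<^sub>v vec_of_list [x, y, z]
   = vec_of_list [a * x + b * y + c * z, d * x + e * y + f * z, g * x + h * y + i * z :: real]"
  by (intro eq_vecI)
    (auto simp: mat_of_rows_list_def scalar_prod_def vec_of_list_index less_Suc_eq numeral_2_eq_2 numeral_3_eq_3
      atLeast0_lessThan_Suc)

lemma invertible_mat_if_inj: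
  fixes A :: "real mat"
  assumes A: "A \<in> carrier_mat n n" and inj: "\<And>v. v \<in> carrier_vec n \<Longrightarrow> A *\<^sub>v v = 0\<^sub>v n \<Longrightarrow> v = 0\<^sub>v n"
  shows "invertible_mat A"
  using inj det_0_iff_vec_prod_zero[OF A] unfolding invertible_mat_iff_det[OF A] by blast

definition det2 :: "real \<Rightarrow> real \<Rightarrow> real \<Rightarrow> real \<Rightarrow> real" where
  [simp]: "det2 a b c d = a * d - b * c"

definition det3 :: "real \<Rightarrow> real \<Rightarrow> real \<Rightarrow> real \<Rightarrow> real \<Rightarrow> real \<Rightarrow> real \<Rightarrow> real \<Rightarrow> real \<Rightarrow> real" where
  [simp]: "det3 a b c d e f g h i = a * (e * i - f * h) - b * (d * i - f * g) + c * (d * h - e * g)"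

lemma mat_2_invertible:
  fixes a b c d :: real
  assumes "det2 a b c d \<noteq> 0"
  shows "mat_of_rows_list 2 [[a, b], [c, d]] \<in> carrier_mat 2 2" "invertible_mat (mat_of_rows_list 2 [[a, b], [c, d]])"
proof -
  let ?A = "mat_of_rows_list 2 [[a, b], [c, d]]"
  note det = assms[unfolded det2_def]
  show A: "?A \<in> carrier_mat 2 2" by (intro carrier_matI) (simp_all add: mat_of_rows_list_def)
  show "invertible_mat ?A"
  proof (rule invertible_mat_if_inj[OF A])
    fix v :: "real vec" assume v: "v \<in> carrier_vec 2" "?A *\<^sub>v v = 0\<^sub>v 2"
    then obtain x y where xy: "v = vec_of_list [x, y]" using carrier_vec_2E by blast
    have eq: "vec_of_list [a * x + b * y, c * x + d * y] = 0\<^sub>v 2" using v(2) unfolding xy mat_2_mult .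
    have 1: "a * x + b * y = 0" "c * x + d * y = 0"
      using arg_cong[OF eq, of "\<lambda>w. w $ 0"] arg_cong[OF eq, of "\<lambda>w. w $ 1"] by (simp_all add: vec_of_list_2)
    have "(a * d - b * c) * x = d * (a * x + b * y) - b * (c * x + d * y)"
      "(a * d - b * c) * y = a * (c * x + d * y) - c * (a * x + b * y)" by (simp_all add: algebra_simps)
    then have "(a * d - b * c) * x = 0" "(a * d - b * c) * y = 0" unfolding 1 by simp_all
    then have "x = 0" "y = 0" using det by simp_all
    then show "v = 0\<^sub>v 2" unfolding xy by (intro eq_vecI) (auto simp: vec_of_list_index less_Suc_eq numeral_2_eq_2)
  qed
qed

lemma mat_3_invertible:
  fixes a b c d e f g h i :: real
  assumes "det3 a b c d e f g h i \<noteq> 0"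
  shows "mat_of_rows_list 3 [[a, b, c], [d, e, f], [g, h, i]] \<in> carrier_mat 3 3"
    "invertible_mat (mat_of_rows_list 3 [[a, b, c], [d, e, f], [g, h, i]])"
proof -
  let ?A = "mat_of_rows_list 3 [[a, b, c], [d, e, f], [g, h, i]]"
  note det = assms[unfolded det3_def]
  let ?D = "a * (e * i - f * h) - b * (d * i - f * g) + c * (d * h - e * g)"
  show A: "?A \<in> carrier_mat 3 3" by (intro carrier_matI) (simp_all add: mat_of_rows_list_def)
  show "invertible_mat ?A"
  proof (rule invertible_mat_if_inj[OF A])
    fix v :: "real vec" assume v: "v \<in> carrier_vec 3" "?A *\<^sub>v v = 0\<^sub>v 3"
    then obtain x y z where xyz: "v = vec_of_list [x, y, z]" using carrier_vec_3E by blast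
    have eq: "vec_of_list [a * x + b * y + c * z, d * x + e * y + f * z, g * x + h * y + i * z] = 0\<^sub>v 3"
      using v(2) unfolding xyz mat_3_mult .
    have 1: "a * x + b * y + c * z = 0" "d * x + e * y + f * z = 0" "g * x + h * y + i * z = 0"
      using arg_cong[OF eq, of "\<lambda>w. w $ 0"] arg_cong[OF eq, of "\<lambda>w. w $ 1"] arg_cong[OF eq, of "\<lambda>w. w $ 2"]
      by (simp_all add: vec_of_list_3)
    let ?E1 = "a * x + b * y + c * z" and ?E2 = "d * x + e * y + f * z" and ?E3 = "g * x + h * y + i * z"
    have "?D * x = (e * i - f * h) * ?E1 - (b * i - c * h) * ?E2 + (b * f - c * e) * ?E3"
      "?D * y = (a * i - c * g) * ?E2 - (d * i - f * g) * ?E1 - (a * f - c * d) * ?E3"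
      "?D * z = (d * h - e * g) * ?E1 - (a * h - b * g) * ?E2 + (a * e - b * d) * ?E3"
      by (simp_all add: algebra_simps)
    then have "?D * x = 0" "?D * y = 0" "?D * z = 0" unfolding 1 by simp_all
    then have "x = 0" "y = 0" "z = 0" using det by simp_all
    then show "v = 0\<^sub>v 3" unfolding xyz
      by (intro eq_vecI) (auto simp: vec_of_list_index less_Suc_eq numeral_3_eq_3)
  qed
qed

section \<open>Real binary quadratic forms\<close>

text \<open>Completing the square turns the form into \<open>a * ((u + h * v)\<^sup>2 + \<delta> * v\<^sup>2)\<close>; scaling \<open>v\<close> makes
  \<open>\<delta>\<close> equal to \<open>0\<close>, \<open>1\<close> or \<open>-1\<close>, and in the last case the form is a difference of two squares, hence
  a product.\<close>

lemma binary_form_normal_lead: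
  fixes a b c :: real
  assumes "a \<noteq> 0"
  obtains k l m n \<sigma> A B C where "k * n - l * m \<noteq> 0" "\<sigma> \<noteq> 0" "(A, B, C) \<in> {(1, 0, 0), (0, 0, 1), (1, 1, 0)}"
    "\<And>x y. a * (k * x + l * y)\<^sup>2 + b * (m * x + n * y)\<^sup>2 + c * ((k * x + l * y) * (m * x + n * y))
      = \<sigma> * (A * x\<^sup>2 + B * y\<^sup>2 + C * (x * y))"
proof -
  define h where "h = c / (2 * a)"
  define \<delta> where "\<delta> = b / a - h\<^sup>2"
  have form: "a * u\<^sup>2 + b * v\<^sup>2 + c * (u * v) = a * ((u + h * v)\<^sup>2 + \<delta> * v\<^sup>2)" for u v
    using assms by (simp add: h_def \<delta>_def field_simps power2_eq_square)
  consider "\<delta> = 0" | "\<delta> > 0" | "\<delta> < 0" by linarith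
  then show thesis
  proof cases
    case 1
    have "a * (1 * x + (- h) * y)\<^sup>2 + b * (0 * x + 1 * y)\<^sup>2 + c * ((1 * x + (- h) * y) * (0 * x + 1 * y))
      = a * (1 * x\<^sup>2 + 0 * y\<^sup>2 + 0 * (x * y))" for x y
      unfolding form by (simp add: 1)
    then show thesis by (rule that[rotated 3]) (use assms in simp_all)
  next
    case 2
    define s where "s = sqrt \<delta>"
    have s: "s \<noteq> 0" "\<delta> = s\<^sup>2" using 2 by (simp_all add: s_def)
    have "a * (1 * x + (- h / s) * y)\<^sup>2 + b * (0 * x + (1 / s) * y)\<^sup>2 + c * ((1 * x + (- h / s) * y) * (0 * x + (1 / s) * y))
      = a * (1 * x\<^sup>2 + 1 * y\<^sup>2 + 0 * (x * y))" for x y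
      unfolding form unfolding s(2) using s(1) by (simp add: field_simps power2_eq_square)
    then show thesis by (rule that[rotated 3]) (use assms s in simp_all)
  next
    case 3
    define s where "s = sqrt (- \<delta>)"
    have s: "s \<noteq> 0" "\<delta> = - (s\<^sup>2)" using 3 by (simp_all add: s_def)
    have "a * (((1 - h / s) / 2) * x + ((1 + h / s) / 2) * y)\<^sup>2 + b * ((1 / (2 * s)) * x + (- (1 / (2 * s))) * y)\<^sup>2 + c * ((((1 - h / s) / 2) * x + ((1 + h / s) / 2) * y) * ((1 / (2 * s)) * x + (- (1 / (2 * s))) * y))
      = a * (0 * x\<^sup>2 + 0 * y\<^sup>2 + 1 * (x * y))" for x y
      unfolding form unfolding s(2) using s(1) by (simp add: field_simps power2_eq_square)
    then show thesis by (rule that[rotated 3]) (use assms s in \<open>simp_all add: field_simps\<close>)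
  qed
qed

text \<open>Without a square term the form is a multiple of \<open>x * y\<close>; otherwise one of the two variables can be
  taken as the leading one.\<close>

lemma binary_form_normal:
  fixes a b c :: real
  obtains k l m n \<sigma> A B C where "k * n - l * m \<noteq> 0" "\<sigma> \<noteq> 0"
    "(A, B, C) \<in> {(0, 0, 0), (1, 0, 0), (0, 0, 1), (1, 1, 0)}"
    "\<And>x y. a * (k * x + l * y)\<^sup>2 + b * (m * x + n * y)\<^sup>2 + c * ((k * x + l * y) * (m * x + n * y))
      = \<sigma> * (A * x\<^sup>2 + B * y\<^sup>2 + C * (x * y))"
proof -
  consider "a \<noteq> 0" | "a = 0" "b \<noteq> 0" | "a = 0" "b = 0" "c \<noteq> 0" | "a = 0" "b = 0" "c = 0" by blast
  then show thesis
  proof cases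
    case 1
    obtain k l m n \<sigma> A B C where "k * n - l * m \<noteq> 0" "\<sigma> \<noteq> 0" "(A, B, C) \<in> {(1, 0, 0), (0, 0, 1), (1, 1, 0)}"
      "\<And>x y. a * (k * x + l * y)\<^sup>2 + b * (m * x + n * y)\<^sup>2 + c * ((k * x + l * y) * (m * x + n * y))
      = \<sigma> * (A * x\<^sup>2 + B * y\<^sup>2 + C * (x * y))"
      using binary_form_normal_lead[OF 1, of b c] by metis
    then show thesis by (intro that[of k n l m \<sigma> A B C]) auto
  next
    case 2
    obtain k l m n \<sigma> A B C where "k * n - l * m \<noteq> 0" "\<sigma> \<noteq> 0" "(A, B, C) \<in> {(1, 0, 0), (0, 0, 1), (1, 1, 0)}"
      "\<And>x y. b * (k * x + l * y)\<^sup>2 + a * (m * x + n * y)\<^sup>2 + c * ((k * x + l * y) * (m * x + n * y))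
      = \<sigma> * (A * x\<^sup>2 + B * y\<^sup>2 + C * (x * y))"
      using binary_form_normal_lead[OF 2(2), of a c] by metis
    then show thesis by (intro that[of m l n k \<sigma> A B C]) (auto simp: algebra_simps)
  next
    case 3
    show thesis by (rule that[of 1 1 0 0 c 0 0 1]) (use 3 in simp_all)
  next
    case 4
    show thesis by (rule that[of 1 1 0 0 1 0 0 0]) (use 4 in simp_all)
  qed
qed

text \<open>The expression is the coefficient of \<open>x * y\<close> after the substitution of \<open>x - t * y\<close> for \<open>x\<close> and
  \<open>t * x + y\<close> for \<open>y\<close>, a scaled rotation, which multiplies \<open>x\<^sup>2 + y\<^sup>2\<close> by \<open>1 + t\<^sup>2\<close>. For \<open>c \<noteq> 0\<close> it
  is a quadratic polynomial in \<open>t\<close> with discriminant \<open>4 * ((b - a)\<^sup>2 + c\<^sup>2)\<close>, so there is a real root.\<close>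

lemma rotation_diagonalizes:
  fixes a b c :: real
  obtains t where "c * (1 - t\<^sup>2) + 2 * (b - a) * t = 0"
proof (cases "c = 0")
  case True
  then show thesis using that[of 0] by simp
next
  case False
  define s where "s = sqrt ((b - a)\<^sup>2 + c\<^sup>2)"
  have s: "s\<^sup>2 = (b - a)\<^sup>2 + c\<^sup>2" by (simp add: s_def)
  have "c * (1 - (((b - a) + s) / c)\<^sup>2) + 2 * (b - a) * (((b - a) + s) / c) = (c\<^sup>2 + (b - a)\<^sup>2 - s\<^sup>2) / c"
    using False by (simp add: field_simps power2_eq_square)
  also have "\<dots> = 0" using s by simp
  finally show thesis by (rule that)
qed

section \<open>Pencils of ternary quadratic forms\<close>

definition tuple3 :: "(real \<Rightarrow> real \<Rightarrow> real \<Rightarrow> real) \<Rightarrow> (real \<Rightarrow> real \<Rightarrow> real \<Rightarrow> real) \<Rightarrow> real vec \<Rightarrow> real vec" where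
  "tuple3 f g = (\<lambda>\<xi>. vec_of_list [f (\<xi> $ 0) (\<xi> $ 1) (\<xi> $ 2), g (\<xi> $ 0) (\<xi> $ 1) (\<xi> $ 2)])"

lemma tuple3_carrier: "tuple3 f g \<in> carrier_vec 3 \<rightarrow> carrier_vec 2"
  by (simp add: tuple3_def vec_of_list_2)

lemma transpose_mat_2: "transpose_mat (mat_of_rows_list 2 [[a, b], [c, d]]) = mat_of_rows_list 2 [[a, c], [b, d]]"
  by (intro eq_matI) (auto simp: mat_of_rows_list_def less_Suc_eq numeral_2_eq_2)

lemma equivalent_tuple3:
  fixes f g f' g' :: "real \<Rightarrow> real \<Rightarrow> real \<Rightarrow> real"
  assumes "det3 m_xx m_xy m_xz m_yx m_yy m_yz m_zx m_zy m_zz \<noteq> 0"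
    and "det2 n_ff n_fg n_gf n_gg \<noteq> 0"
    and f': "\<And>x y z. f' x y z =
      n_ff * f (m_xx * x + m_xy * y + m_xz * z) (m_yx * x + m_yy * y + m_yz * z) (m_zx * x + m_zy * y + m_zz * z) +
      n_fg * g (m_xx * x + m_xy * y + m_xz * z) (m_yx * x + m_yy * y + m_yz * z) (m_zx * x + m_zy * y + m_zz * z)"
    and g': "\<And>x y z. g' x y z =
      n_gf * f (m_xx * x + m_xy * y + m_xz * z) (m_yx * x + m_yy * y + m_yz * z) (m_zx * x + m_zy * y + m_zz * z) +
      n_gg * g (m_xx * x + m_xy * y + m_xz * z) (m_yx * x + m_yy * y + m_yz * z) (m_zx * x + m_zy * y + m_zz * z)"
  shows "equivalent 3 2 (tuple3 f g) (tuple3 f' g')"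
proof -
  let ?M = "mat_of_rows_list 3 [[m_xx, m_xy, m_xz], [m_yx, m_yy, m_yz], [m_zx, m_zy, m_zz]]"
  let ?N = "mat_of_rows_list 2 [[n_ff, n_gf], [n_fg, n_gg]]"
  have "det2 n_ff n_gf n_fg n_gg \<noteq> 0" using assms(2) by (simp add: det2_def mult.commute)
  note inv = mat_3_invertible[OF assms(1)] mat_2_invertible[OF this]
  have "tuple3 f' g' \<xi> = R ?N ?M (tuple3 f g) \<xi>" if "\<xi> \<in> carrier_vec 3" for \<xi>
  proof -
    obtain x y z where \<xi>: "\<xi> = vec_of_list [x, y, z]" by (rule carrier_vec_3E[OF \<open>\<xi> \<in> carrier_vec 3\<close>])
    show ?thesis unfolding R_def \<xi> mat_3_mult transpose_mat_2
      unfolding tuple3_def mat_2_mult vec_of_list_3 f' g' ..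
  qed
  then show ?thesis unfolding equivalent_def using inv by blast
qed

definition q3 :: "real \<Rightarrow> real \<Rightarrow> real \<Rightarrow> real \<Rightarrow> real \<Rightarrow> real \<Rightarrow> real \<Rightarrow> real \<Rightarrow> real \<Rightarrow> real" where
  "q3 a b c p q r x y z = a * x\<^sup>2 + b * y\<^sup>2 + c * z\<^sup>2 + p * (x * y) + q * (x * z) + r * (y * z)"

lemma quadratic_form_3:
  "quadratic_form 3 F \<longleftrightarrow> (\<exists>a b c p q r. \<forall>\<xi> \<in> carrier_vec 3. F \<xi> = q3 a b c p q r (\<xi> $ 0) (\<xi> $ 1) (\<xi> $ 2))"
proof
  assume "quadratic_form 3 F"
  then obtain a :: "nat \<Rightarrow> nat \<Rightarrow> real"
    where a: "\<And>\<xi>. \<xi> \<in> carrier_vec 3 \<Longrightarrow> F \<xi> = (\<Sum>i<3. \<Sum>j<3. a i j * (\<xi> $ i * \<xi> $ j))"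
    unfolding quadratic_form_def by blast
  have "F \<xi> = q3 (a 0 0) (a 1 1) (a 2 2) (a 0 1 + a 1 0) (a 0 2 + a 2 0) (a 1 2 + a 2 1) (\<xi> $ 0) (\<xi> $ 1) (\<xi> $ 2)"
    if "\<xi> \<in> carrier_vec 3" for \<xi>
    unfolding a[OF that]
    by (simp add: q3_def numeral_3_eq_3 numeral_2_eq_2 lessThan_Suc algebra_simps power2_eq_square)
  then show "\<exists>a b c p q r. \<forall>\<xi> \<in> carrier_vec 3. F \<xi> = q3 a b c p q r (\<xi> $ 0) (\<xi> $ 1) (\<xi> $ 2)" by blast
next
  assume "\<exists>a b c p q r. \<forall>\<xi> \<in> carrier_vec 3. F \<xi> = q3 a b c p q r (\<xi> $ 0) (\<xi> $ 1) (\<xi> $ 2)"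
  then obtain a b c p q r where F: "\<And>\<xi>. \<xi> \<in> carrier_vec 3 \<Longrightarrow> F \<xi> = q3 a b c p q r (\<xi> $ 0) (\<xi> $ 1) (\<xi> $ 2)"
    by blast
  have *: "F \<xi> = (\<Sum>i<3. \<Sum>j<3. [[a, p, q], [0, b, r], [0, 0, c]] ! i ! j * (\<xi> $ i * \<xi> $ j))"
    if "\<xi> \<in> carrier_vec 3" for \<xi>
    unfolding F[OF that]
    by (simp add: q3_def numeral_3_eq_3 numeral_2_eq_2 lessThan_Suc algebra_simps power2_eq_square)
  show "quadratic_form 3 F" unfolding quadratic_form_def
    by (rule exI[of _ "\<lambda>i j. [[a, p, q], [0, b, r], [0, 0, c]] ! i ! j"], rule ballI, rule *)
qed

lemma quadratic_tuple_tuple3: "quadratic_tuple 3 2 (tuple3 (q3 a b c p q r) (q3 a' b' c' p' q' r'))"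
proof -
  have q: "quadratic_form 3 (\<lambda>\<xi>. q3 a b c p q r (\<xi> $ 0) (\<xi> $ 1) (\<xi> $ 2))" for a b c p q r
    unfolding quadratic_form_3 by blast
  show ?thesis
    using q[unfolded One_nat_def] unfolding quadratic_tuple_def
    by (auto simp: tuple3_carrier less_2_cases_iff tuple3_def vec_of_list_2)
qed

lemma quadratic_tuple_3_2E:
  assumes "quadratic_tuple 3 2 Q"
  obtains a b c p q r a' b' c' p' q' r'
  where "\<And>\<xi>. \<xi> \<in> carrier_vec 3 \<Longrightarrow> Q \<xi> = tuple3 (q3 a b c p q r) (q3 a' b' c' p' q' r') \<xi>"
proof -
  have "quadratic_form 3 (\<lambda>\<xi>. Q \<xi> $ 0)" "quadratic_form 3 (\<lambda>\<xi>. Q \<xi> $ 1)"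
    using assms by (auto simp: quadratic_tuple_def)
  then obtain a b c p q r a' b' c' p' q' r' where
    0: "\<And>\<xi>. \<xi> \<in> carrier_vec 3 \<Longrightarrow> Q \<xi> $ 0 = q3 a b c p q r (\<xi> $ 0) (\<xi> $ 1) (\<xi> $ 2)" and
    1: "\<And>\<xi>. \<xi> \<in> carrier_vec 3 \<Longrightarrow> Q \<xi> $ 1 = q3 a' b' c' p' q' r' (\<xi> $ 0) (\<xi> $ 1) (\<xi> $ 2)"
    unfolding quadratic_form_3 by metis
  have "Q \<xi> = tuple3 (q3 a b c p q r) (q3 a' b' c' p' q' r') \<xi>" if "\<xi> \<in> carrier_vec 3" for \<xi>
  proof -
    have "Q \<xi> \<in> carrier_vec 2" using assms that by (auto simp: quadratic_tuple_def)
    then obtain u v where uv: "Q \<xi> = vec_of_list [u, v]" by (rule carrier_vec_2E)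
    then show ?thesis using 0[OF that] 1[OF that] by (simp add: vec_of_list_2 tuple3_def)
  qed
  then show ?thesis by (rule that)
qed

definition forms3 :: "(real vec \<Rightarrow> real vec) list" where
  "forms3 = [form_c1_1, form_c1_2, form_c2, form_c3, form_c4_1, form_c4_2, form_c4_3,
     form_c5_1, form_c5_2, form_c5_3]"

abbreviation classified3 where "classified3 f g \<equiv> classified_by 3 2 forms3 (tuple3 f g)"

text \<open>One step of a reduction: the row \<open>m_x\<close> contains the coefficients of the linear form that is substituted
  for the first variable, and the row \<open>n_f\<close> those of the new first component in terms of the two old ones;
  the other rows are named likewise. In each use below the two matrices are given
  row by row, first \<open>m\<close> and then \<open>n\<close>.\<close>

lemma classified3_pullback:
  fixes f g f' g' :: "real \<Rightarrow> real \<Rightarrow> real \<Rightarrow> real"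
  assumes "classified3 f' g'"
    and "det3 m_xx m_xy m_xz m_yx m_yy m_yz m_zx m_zy m_zz \<noteq> 0"
    and "det2 n_ff n_fg n_gf n_gg \<noteq> 0"
    and "\<And>x y z. f' x y z =
      n_ff * f (m_xx * x + m_xy * y + m_xz * z) (m_yx * x + m_yy * y + m_yz * z) (m_zx * x + m_zy * y + m_zz * z) +
      n_fg * g (m_xx * x + m_xy * y + m_xz * z) (m_yx * x + m_yy * y + m_yz * z) (m_zx * x + m_zy * y + m_zz * z)"
    and "\<And>x y z. g' x y z =
      n_gf * f (m_xx * x + m_xy * y + m_xz * z) (m_yx * x + m_yy * y + m_yz * z) (m_zx * x + m_zy * y + m_zz * z) +
      n_gg * g (m_xx * x + m_xy * y + m_xz * z) (m_yx * x + m_yy * y + m_yz * z) (m_zx * x + m_zy * y + m_zz * z)"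
  shows "classified3 f g"
proof -
  have "equivalent 3 2 (tuple3 f g) (tuple3 f' g')" by (rule equivalent_tuple3) (fact assms)+
  then show ?thesis by (rule classified_by_equivalent[OF _ tuple3_carrier _ assms(1)]) simp
qed

lemma forms3_tuple3:
  "form_c1_1 = tuple3 (q3 1 0 0 0 0 0) (q3 0 1 0 0 1 0)"
  "form_c1_2 = tuple3 (q3 1 0 0 0 0 0) (q3 0 0 0 0 0 1)"
  "form_c2 = tuple3 (q3 1 0 0 0 0 0) (q3 0 1 1 0 0 0)"
  "form_c3 = tuple3 (q3 0 0 0 1 0 0) (q3 0 0 0 0 1 0)"
  "form_c4_1 = tuple3 (q3 0 0 0 1 0 0) (q3 0 1 0 0 1 0)"
  "form_c4_2 = tuple3 (q3 0 0 0 1 0 0) (q3 1 0 1 0 0 0)"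
  "form_c4_3 = tuple3 (q3 0 0 0 1 0 0) (q3 1 0 (-1) 0 0 0)"
  "form_c5_1 = tuple3 (q3 1 1 0 0 0 0) (q3 0 1 1 0 0 0)"
  "form_c5_2 = tuple3 (q3 1 (-1) 0 0 0 0) (q3 0 1 (-1) 0 0 0)"
  "form_c5_3 = tuple3 (q3 1 (-1) 0 0 0 0) (q3 0 0 1 1 0 0)"
  by (simp_all add: fun_eq_iff tuple3_def q3_def
        form_c1_1_def form_c1_2_def form_c2_def form_c3_def form_c4_1_def form_c4_2_def form_c4_3_def
        form_c5_1_def form_c5_2_def form_c5_3_def add.commute)

lemma classified3_forms:
  "classified3 (q3 1 0 0 0 0 0) (q3 0 1 0 0 1 0)"
  "classified3 (q3 1 0 0 0 0 0) (q3 0 0 0 0 0 1)"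
  "classified3 (q3 1 0 0 0 0 0) (q3 0 1 1 0 0 0)"
  "classified3 (q3 0 0 0 1 0 0) (q3 0 0 0 0 1 0)"
  "classified3 (q3 0 0 0 1 0 0) (q3 0 1 0 0 1 0)"
  "classified3 (q3 0 0 0 1 0 0) (q3 1 0 1 0 0 0)"
  "classified3 (q3 0 0 0 1 0 0) (q3 1 0 (-1) 0 0 0)"
  "classified3 (q3 1 1 0 0 0 0) (q3 0 1 1 0 0 0)"
  "classified3 (q3 1 (-1) 0 0 0 0) (q3 0 1 (-1) 0 0 0)"
  "classified3 (q3 1 (-1) 0 0 0 0) (q3 0 0 1 1 0 0)"
  by (rule classified_by_member[OF _ tuple3_carrier]; simp add: forms3_def forms3_tuple3)+

text \<open>Both forms are independent of the third variable, so the third unit vector is a common radical vector,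
  in contradiction to nondegeneracy.\<close>

lemma classified3_radical: "classified3 (q3 a b 0 p 0 0) (q3 a' b' 0 p' 0 0)"
proof -
  let ?Q = "tuple3 (q3 a b 0 p 0 0) (q3 a' b' 0 p' 0 0)"
  have "?Q (\<xi> + t \<cdot>\<^sub>v unit_vec 3 2) = ?Q \<xi>" if "\<xi> \<in> carrier_vec 3" for \<xi> t
    using that by (simp add: tuple3_def q3_def)
  then have "dd 3 2 ?Q 3 2 < 3" by (intro dd_full_radical[OF quadratic_tuple_tuple3]) auto
  then show ?thesis by (simp add: classified_by_def nondegenerate_def)
qed

lemma combination_2: "combination 2 c Q \<xi> = c $ 0 * Q \<xi> $ 0 + c $ 1 * Q \<xi> $ 1"
  by (simp add: combination_def numeral_2_eq_2 lessThan_Suc)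

lemma classified3_dependent:
  assumes st: "s \<noteq> 0 \<or> t \<noteq> 0" and z: "\<And>x y z. s * q3 a b c p q r x y z + t * q3 a' b' c' p' q' r' x y z = 0"
  shows "classified3 (q3 a b c p q r) (q3 a' b' c' p' q' r')"
proof -
  let ?Q = "tuple3 (q3 a b c p q r) (q3 a' b' c' p' q' r')"
  let ?c = "vec_of_list [s, t]"
  have c: "?c \<in> carrier_vec 2" "?c \<noteq> 0\<^sub>v 2"
    using st by (simp_all add: vec_of_list_2 vec_of_list_2_eq_0_iff)
  have "combination 2 ?c ?Q \<xi> = 0" for \<xi>
    using z[of "\<xi> $ 0" "\<xi> $ 1" "\<xi> $ 2"] by (simp add: combination_2 tuple3_def vec_of_list_2)
  then have "\<not> dd 3 2 ?Q 3 1 > 0"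
    using combination_nonzero_of_dd[OF quadratic_tuple_tuple3 _ c] by blast
  then show ?thesis by (simp add: classified_by_def nondegenerate_def)
qed

text \<open>The coefficient of a square is a value of the form, that of a mixed product a value of its polar form.\<close>

lemma q3_linear_substitution:
  "\<exists>a' b' c' p' q' r'. \<forall>x y z. q3 a b c p q r (m_xx * x + m_xy * y + m_xz * z)
     (m_yx * x + m_yy * y + m_yz * z) (m_zx * x + m_zy * y + m_zz * z) = q3 a' b' c' p' q' r' x y z"
proof (intro exI allI)
  fix x y z
  let ?q = "q3 a b c p q r"
  show "?q (m_xx * x + m_xy * y + m_xz * z) (m_yx * x + m_yy * y + m_yz * z) (m_zx * x + m_zy * y + m_zz * z)
    = q3 (?q m_xx m_yx m_zx) (?q m_xy m_yy m_zy) (?q m_xz m_yz m_zz)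
        (?q (m_xx + m_xy) (m_yx + m_yy) (m_zx + m_zy) - ?q m_xx m_yx m_zx - ?q m_xy m_yy m_zy)
        (?q (m_xx + m_xz) (m_yx + m_yz) (m_zx + m_zz) - ?q m_xx m_yx m_zx - ?q m_xz m_yz m_zz)
        (?q (m_xy + m_xz) (m_yy + m_yz) (m_zy + m_zz) - ?q m_xy m_yy m_zy - ?q m_xz m_yz m_zz) x y z"
    by (simp add: q3_def power2_eq_square algebra_simps)
qed

text \<open>The pencils that contain \<open>x\<^sup>2\<close>, in terms of the restriction of a second member to the line
  \<open>x = 0\<close> of the projective plane, which is already in normal form. Only the products \<open>x * y\<close> and
  \<open>x * z\<close> remain, since \<open>x\<^sup>2\<close> can be subtracted.\<close>

lemma classified3_square_normal:
  assumes "(B, C, K) \<in> {(0, 0, 0), (1, 0, 0), (0, 0, 1), (1, 1, 0 :: real)}"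
  shows "classified3 (q3 1 0 0 0 0 0) (q3 0 B C p q K)"
proof -
  consider "B = 0" "C = 0" "K = 0" | "B = 1" "C = 0" "K = 0" | "B = 0" "C = 0" "K = 1" | "B = 1" "C = 1" "K = 0"
    using assms by auto
  then show ?thesis
  proof cases
    case 1
    \<comment> \<open>The second form is \<open>x\<close> times a linear form in \<open>y\<close> and \<open>z\<close>, so there is a common radical vector.\<close>
    show ?thesis
    proof (cases "p = 0")
      case True
      show ?thesis unfolding 1 True
        by (rule classified3_pullback[OF classified3_radical[of 1 0 0 0 0 q], of
          1  0  0
          0  0  1
          0  1  0
          1  0   0  1])
          (simp_all add: q3_def)
    next
      case False
      show ?thesis unfolding 1
        by (rule classified3_pullback[OF classified3_radical[of 1 0 0 0 0 p], of
          1  0  0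
          0  1  "- q / p"
          0  0  1
          1  0   0  1])
          (use False in \<open>simp_all add: q3_def field_simps\<close>)
    qed
  next
    case 2
    show ?thesis
    proof (cases "q = 0")
      case True
      show ?thesis unfolding 2 True by (rule classified3_radical)
    next
      case False
      \<comment> \<open>Completing the square in \<open>y\<close> leaves \<open>q * x * z\<close> and a multiple of \<open>x\<^sup>2\<close>, which is absorbed in \<open>z\<close>.\<close>
      show ?thesis unfolding 2
        by (rule classified3_pullback[OF classified3_forms(1), of
          1  0  0
          "- p / 2"  1  0
          "p\<^sup>2 / (4 * q)"  0  "1 / q"
          1  0   0  1])
          (use False in \<open>simp_all add: q3_def field_simps power2_eq_square\<close>)
    qed
  next
    case 3
    \<comment> \<open>\<open>(y + q * x) * (z + p * x)\<close> agrees with the second form up to a multiple of \<open>x\<^sup>2\<close>.\<close>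
    show ?thesis unfolding 3
      by (rule classified3_pullback[OF classified3_forms(2), of
          1  0  0
          "- q"  1  0
          "- p"  0  1
          1  0   "p * q"  1])
        (simp_all add: q3_def algebra_simps power2_eq_square)
  next
    case 4
    \<comment> \<open>Squares are completed in \<open>y\<close> and in \<open>z\<close>, up to a multiple of \<open>x\<^sup>2\<close>.\<close>
    show ?thesis unfolding 4
      by (rule classified3_pullback[OF classified3_forms(3), of
          1  0  0
          "- p / 2"  1  0
          "- q / 2"  0  1
          1  0   "(p\<^sup>2 + q\<^sup>2) / 4"  1])
        (simp_all add: q3_def field_simps power2_eq_square)
  qed
qed

lemma classified3_square: "classified3 (q3 1 0 0 0 0 0) (q3 a b c p q r)"
proof -
  obtain k l m n \<sigma> B C K where *: "k * n - l * m \<noteq> 0" "\<sigma> \<noteq> 0"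
    "(B, C, K) \<in> {(0, 0, 0), (1, 0, 0), (0, 0, 1), (1, 1, 0)}"
    and eq: "\<And>x y. b * (k * x + l * y)\<^sup>2 + c * (m * x + n * y)\<^sup>2 + r * ((k * x + l * y) * (m * x + n * y))
      = \<sigma> * (B * x\<^sup>2 + C * y\<^sup>2 + K * (x * y))"
    using binary_form_normal[of b c r] by metis
  have "q3 0 B C ((p * k + q * m) / \<sigma>) ((p * l + q * n) / \<sigma>) K x y z
      = - a / \<sigma> * q3 1 0 0 0 0 0 x (k * y + l * z) (m * y + n * z)
        + 1 / \<sigma> * q3 a b c p q r x (k * y + l * z) (m * y + n * z)" for x y z
  proof -
    have "1 / \<sigma> * q3 a b c p q r x (k * y + l * z) (m * y + n * z)
      = 1 / \<sigma> * (a * x\<^sup>2 + p * (x * (k * y + l * z)) + q * (x * (m * y + n * z))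
          + \<sigma> * (B * y\<^sup>2 + C * z\<^sup>2 + K * (y * z)))"
      unfolding eq[symmetric] q3_def by (simp add: algebra_simps)
    then show ?thesis using *(2) by (simp add: q3_def field_simps)
  qed
  then show ?thesis
    by (intro classified3_pullback[OF classified3_square_normal[OF *(3),
            of "(p * k + q * m) / \<sigma>" "(p * l + q * n) / \<sigma>"], of
          1  0  0
          0  k  l
          0  m  n
          1  0   "- a / \<sigma>"  "1 / \<sigma>"])
      (use *(1,2) in \<open>simp_all add: q3_def\<close>)
qed

text \<open>The forms \<open>x * y\<close> and \<open>x\<^sup>2 + y\<^sup>2\<close> are symmetric in the first two variables, so that one of two
  mirror-image cases suffices below.\<close>

lemma classified3_swap:
  assumes "classified3 (q3 b a c p r q) (q3 b' a' c' p' r' q')"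
  shows "classified3 (q3 a b c p q r) (q3 a' b' c' p' q' r')"
  by (rule classified3_pullback[OF assms, of
          0  1  0
          1  0  0
          0  0  1
          1  0   0  1])
      (simp_all add: q3_def)

text \<open>The common zeros have a double point: the line \<open>x = 0\<close> meets \<open>a * x\<^sup>2 + z\<^sup>2 = 0\<close> only in the second unit vector.\<close>

lemma classified3_hyperbolic_one: "classified3 (q3 0 0 0 1 0 0) (q3 a 0 1 0 0 0)"
proof -
  consider "a = 0" | "a > 0" | "a < 0" by linarith
  then show ?thesis
  proof cases
    case 1
    \<comment> \<open>The pencil contains the square \<open>z\<^sup>2\<close>, which takes the place of the first form.\<close>
    show ?thesis unfolding 1
      by (rule classified3_pullback[OF classified3_forms(2), of
          0  1  0
          0  0  1
          1  0  0
          0  1   1  0])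
      (simp_all add: q3_def)
  next
    case 2
    define s where "s = 1 / sqrt a"
    have s: "s \<noteq> 0" "a * s\<^sup>2 = 1" using 2 by (simp_all add: s_def field_simps)
    show ?thesis
      by (rule classified3_pullback[OF classified3_forms(6), of
          s  0  0
          0  1  0
          0  0  1
          "1 / s"  0   0  1])
      (use s in \<open>simp_all add: q3_def power_mult_distrib mult.assoc[symmetric]\<close>)
  next
    case 3
    define s where "s = 1 / sqrt (- a)"
    have s: "s \<noteq> 0" "a * s\<^sup>2 = -1" using 3 by (simp_all add: s_def field_simps)
    show ?thesis
      by (rule classified3_pullback[OF classified3_forms(7), of
          s  0  0
          0  1  0
          0  0  1
          "1 / s"  0   0  "- 1"])
      (use s in \<open>simp_all add: q3_def power_mult_distrib mult.assoc[symmetric]\<close>)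
  qed
qed

text \<open>On each of the lines \<open>x = 0\<close> and \<open>y = 0\<close> the second form has two distinct zeros, real or complex
  conjugate depending on the sign. The forms \<open>g + 2 * x * y\<close> and \<open>g - 2 * x * y\<close>, or the coordinates
  \<open>x + y\<close> and \<open>x - y\<close>, bring the pencil into the shape of a normal form.\<close>

lemma classified3_hyperbolic_two:
  assumes "\<epsilon> \<in> {1, -1}" "\<delta> \<in> {1, -1 :: real}"
  shows "classified3 (q3 0 0 0 1 0 0) (q3 \<epsilon> \<delta> 1 0 0 0)"
proof -
  have mixed: "classified3 (q3 0 0 0 1 0 0) (q3 1 (-1) 1 0 0 0)"
    by (rule classified3_pullback[OF classified3_forms(10), of
          "1 / 2"  "1 / 2"  0
          "1 / 2"  "- (1 / 2)"  0
          0  0  1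
          4  0   0  1])
      (simp_all add: q3_def field_simps power2_eq_square)
  consider "\<epsilon> = 1" "\<delta> = 1" | "\<epsilon> = -1" "\<delta> = -1" | "\<epsilon> = 1" "\<delta> = -1" | "\<epsilon> = -1" "\<delta> = 1"
    using assms by auto
  then show ?thesis
  proof cases
    case 1
    show ?thesis unfolding 1
      by (rule classified3_pullback[OF classified3_forms(8), of
          "1 / 2"  0  "1 / 2"
          "1 / 2"  0  "- (1 / 2)"
          0  1  0
          2  1   "- 2"  1])
      (simp_all add: q3_def field_simps power2_eq_square)
  next
    case 2
    show ?thesis unfolding 2
      by (rule classified3_pullback[OF classified3_forms(9), of
          "1 / 2"  0  "1 / 2"
          "1 / 2"  0  "- (1 / 2)"
          0  1  0
          2  "- 1"   2  1])
      (simp_all add: q3_def field_simps power2_eq_square)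
  next
    case 3
    show ?thesis unfolding 3 by (rule mixed)
  next
    case 4
    show ?thesis unfolding 4 by (rule classified3_swap[OF mixed])
  qed
qed

lemma rescale_to_sign:
  fixes a :: real
  assumes "a \<noteq> 0"
  obtains s \<epsilon> where "s \<noteq> 0" "\<epsilon> \<in> {1, -1}" "a * s\<^sup>2 = \<epsilon>"
proof
  show "1 / sqrt \<bar>a\<bar> \<noteq> 0" "sgn a \<in> {1, -1}" "a * (1 / sqrt \<bar>a\<bar>)\<^sup>2 = sgn a"
    using assms by (auto simp: sgn_if power_divide)
qed

lemma classified3_hyperbolic_regular_vertex:
  "classified3 (q3 0 0 0 1 0 0) (q3 a b 1 0 0 0)"
proof -
  consider "b = 0" | "a = 0" | "a \<noteq> 0" "b \<noteq> 0" by blast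
  then show ?thesis
  proof cases
    case 1
    then show ?thesis using classified3_hyperbolic_one by simp
  next
    case 2
    then show ?thesis using classified3_swap[OF classified3_hyperbolic_one[of b]] by simp
  next
    case 3
    obtain s \<epsilon> where s: "s \<noteq> 0" "\<epsilon> \<in> {1, -1}" "a * s\<^sup>2 = \<epsilon>" using rescale_to_sign[OF 3(1)] .
    obtain t \<delta> where t: "t \<noteq> 0" "\<delta> \<in> {1, -1}" "b * t\<^sup>2 = \<delta>" using rescale_to_sign[OF 3(2)] .
    show ?thesis
      by (rule classified3_pullback[OF classified3_hyperbolic_two[OF s(2) t(2)], of
          s  0  0
          0  t  0
          0  0  1
          "1 / (s * t)"  0   0  1])
      (use s t in \<open>simp_all add: q3_def power_mult_distrib mult.assoc[symmetric]\<close>)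
  qed
qed

text \<open>Here the vertex of \<open>x * y\<close>, the third unit vector, is a common zero. The substitution for \<open>z\<close>
  absorbs \<open>x\<^sup>2\<close> and \<open>y\<^sup>2\<close>, which reduces to the second form \<open>z * (x + y)\<close>; together with
  \<open>4 * x * y = (x + y)\<^sup>2 - (x - y)\<^sup>2\<close> this is the pencil of \<open>form_c4_3\<close>.\<close>

lemma classified3_hyperbolic_both_tangents:
  "classified3 (q3 0 0 0 1 0 0) (q3 a b 0 p 1 1)"
proof -
  have "classified3 (q3 0 0 0 1 0 0) (q3 0 0 0 0 1 1)"
    by (rule classified3_pullback[OF classified3_forms(7), of
          "1 / 2"  0  "1 / 2"
          "1 / 2"  0  "- (1 / 2)"
          0  1  0
          0  1   4  0])
      (simp_all add: q3_def field_simps power2_eq_square)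
  then show ?thesis
    by (rule classified3_pullback[OF _, of _ _
          1  0  0
          0  1  0
          "- a"  "- b"  1
          1  0   "a + b - p"  1])
      (simp_all add: q3_def algebra_simps power2_eq_square)
qed

lemma classified3_hyperbolic_one_tangent:
  assumes "q \<noteq> 0"
  shows "classified3 (q3 0 0 0 1 0 0) (q3 a b 0 p q 0)"
proof -
  have "classified3 (q3 0 0 0 1 0 0) (q3 0 b 0 0 1 0)"
  proof (cases "b = 0")
    case True
    then show ?thesis using classified3_forms(4) by simp
  next
    case False
    show ?thesis
      by (rule classified3_pullback[OF classified3_forms(5), of
          1  0  0
          0  1  0
          0  0  b
          1  0   0  "1 / b"])
      (use False in \<open>simp_all add: q3_def field_simps power2_eq_square\<close>)
  qed
  \<comment> \<open>The new \<open>z\<close> is \<open>q * z + a * x\<close>, which absorbs \<open>x\<^sup>2\<close>.\<close>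
  then show ?thesis
    by (rule classified3_pullback[OF _, of _ _
          1  0  0
          0  1  0
          "- a / q"  0  "1 / q"
          1  0   "- p"  1])
      (use assms in \<open>simp_all add: q3_def field_simps power2_eq_square\<close>)
qed

lemma classified3_hyperbolic: "classified3 (q3 0 0 0 1 0 0) (q3 a b c p q r)"
proof -
  consider "c \<noteq> 0" | "c = 0" "q = 0" "r = 0" | "c = 0" "q \<noteq> 0" "r \<noteq> 0" | "c = 0" "q \<noteq> 0" "r = 0" | "c = 0" "q = 0" "r \<noteq> 0"
    by blast
  then show ?thesis
  proof cases
    case 1
    \<comment> \<open>Completing the square in \<open>z\<close>; the product \<open>x * y\<close> is subtracted.\<close>
    show ?thesis
      by (rule classified3_pullback[OF classified3_hyperbolic_regular_vertex[of "(a - q\<^sup>2 / (4 * c)) / c" "(b - r\<^sup>2 / (4 * c)) / c"], of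
          1  0  0
          0  1  0
          "- q / (2 * c)"  "- r / (2 * c)"  1
          1  0   "(q * r / (2 * c) - p) / c"  "1 / c"])
      (use 1 in \<open>simp_all add: q3_def field_simps power2_eq_square\<close>)
  next
    case 2
    then show ?thesis using classified3_radical by simp
  next
    case 3
    show ?thesis unfolding 3(1)
      by (rule classified3_pullback[OF classified3_hyperbolic_both_tangents[of "a / q\<^sup>2" "b / r\<^sup>2" "p / (q * r)"], of
          "1 / q"  0  0
          0  "1 / r"  0
          0  0  1
          "q * r"  0   0  1])
      (use 3 in \<open>simp_all add: q3_def field_simps power2_eq_square\<close>)
  next
    case 4
    show ?thesis unfolding 4(1,3) by (rule classified3_hyperbolic_one_tangent[OF 4(2)])
  next
    case 5
    show ?thesis unfolding 5(1,2) by (rule classified3_swap[OF classified3_hyperbolic_one_tangent[OF 5(3)]])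
  qed
qed

text \<open>For \<open>a \<noteq> b\<close>, subtracting the smaller coefficient times the first form leaves a positive definite
  form in two variables; for \<open>a = b\<close> the pencil contains \<open>z\<^sup>2\<close>.\<close>

lemma classified3_elliptic_diagonal: "classified3 (q3 1 1 0 0 0 0) (q3 a b 1 0 0 0)"
proof -
  have less: "classified3 (q3 1 1 0 0 0 0) (q3 a b 1 0 0 0)" if "a < b" for a b
  proof -
    define s where "s = sqrt (b - a)"
    have s: "s \<noteq> 0" "b = a + s\<^sup>2" using that by (simp_all add: s_def)
    show ?thesis
      by (rule classified3_pullback[OF classified3_forms(8), of
          1  0  0
          0  1  0
          0  0  s
          1  0   "- a / s\<^sup>2"  "1 / s\<^sup>2"])
      (use s in \<open>simp_all add: q3_def field_simps power2_eq_square\<close>)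
  qed
  consider "a < b" | "b < a" | "a = b" by linarith
  then show ?thesis
  proof cases
    case 1
    then show ?thesis by (rule less)
  next
    case 2
    show ?thesis by (rule classified3_swap[OF less[OF 2]])
  next
    case 3
    show ?thesis unfolding 3
      by (rule classified3_pullback[OF classified3_forms(3), of
          0  1  0
          0  0  1
          1  0  0
          "- b"  1   1  0])
      (simp_all add: q3_def algebra_simps)
  qed
qed

lemma classified3_elliptic_tangent: "classified3 (q3 1 1 0 0 0 0) (q3 a b 0 p 1 0)"
  \<comment> \<open>The square of \<open>y\<close> is eliminated by the first form; \<open>x\<^sup>2\<close> and \<open>x * y\<close> are absorbed in \<open>z\<close>.\<close>
  by (rule classified3_pullback[OF classified3_forms(6), of
          1  0  0
          0  0  1
          "b - a"  1  "- p"
          "- b"  1   1  0])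
      (simp_all add: q3_def algebra_simps power2_eq_square)

text \<open>If the vertex of \<open>x\<^sup>2 + y\<^sup>2\<close>, the third unit vector, is not a zero of the second form, completing
  the square splits off \<open>z\<^sup>2\<close> and a rotation diagonalizes the rest. Otherwise a rotation turns the
  linear form multiplying \<open>z\<close> into a multiple of \<open>x\<close>.\<close>

lemma classified3_elliptic: "classified3 (q3 1 1 0 0 0 0) (q3 a b c p q r)"
proof (cases "c = 0")
  case False
  have rotate: "classified3 (q3 1 1 0 0 0 0) (q3 a b 1 p 0 0)" for a b p
  proof -
    obtain t where t: "p * (1 - t\<^sup>2) + 2 * (b - a) * t = 0" by (rule rotation_diagonalizes)
    have pos: "1 + t\<^sup>2 \<noteq> 0" by (metis add_pos_nonneg less_numeral_extra(1,3) zero_le_power2)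
    have cross: "(a * (x - t * y)\<^sup>2 + b * (t * x + y)\<^sup>2 + p * ((x - t * y) * (t * x + y)))
      = (a + b * t\<^sup>2 + p * t) * x\<^sup>2 + (a * t\<^sup>2 + b - p * t) * y\<^sup>2
        + (p * (1 - t\<^sup>2) + 2 * (b - a) * t) * (x * y)" for x y
      by (simp add: power2_eq_square algebra_simps)
    have circle: "(x - t * y)\<^sup>2 + (t * x + y)\<^sup>2 = (1 + t\<^sup>2) * (x\<^sup>2 + y\<^sup>2)" for x y
      by (simp add: power2_eq_square algebra_simps)
    have f: "q3 1 1 0 0 0 0 (x - t * y) (t * x + y) z = (1 + t\<^sup>2) * q3 1 1 0 0 0 0 x y z" for x y z
      using circle[of x y] pos by (simp add: q3_def)
    have g: "q3 a b 1 p 0 0 (x - t * y) (t * x + y) z = q3 (a + b * t\<^sup>2 + p * t) (a * t\<^sup>2 + b - p * t) 1 0 0 0 x y z" for x y z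
      using cross[of x y] t by (simp add: q3_def)
    show ?thesis
      by (rule classified3_pullback[OF classified3_elliptic_diagonal[of "a + b * t\<^sup>2 + p * t" "a * t\<^sup>2 + b - p * t"], of
          1  "- t"  0
          t  1  0
          0  0  1
          "1 / (1 + t\<^sup>2)"  0   0  1])
      (use pos f g in \<open>simp_all add: power2_eq_square[symmetric]\<close>)
  qed
  \<comment> \<open>Completing the square in \<open>z\<close>.\<close>
  show ?thesis
    by (rule classified3_pullback[OF rotate[of "(a - q\<^sup>2 / (4 * c)) / c" "(b - r\<^sup>2 / (4 * c)) / c" "(p - q * r / (2 * c)) / c"], of
          1  0  0
          0  1  0
          "- q / (2 * c)"  "- r / (2 * c)"  1
          1  0   0  "1 / c"])
      (use False in \<open>simp_all add: q3_def field_simps power2_eq_square\<close>)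
next
  case True
  show ?thesis
  proof (cases "q = 0 \<and> r = 0")
    case True
    then show ?thesis using \<open>c = 0\<close> classified3_radical by simp
  next
    case False
    \<comment> \<open>The scaled rotation substitutes \<open>q * x - r * y\<close> and \<open>r * x + q * y\<close>, whence \<open>q * x + r * y\<close> becomes \<open>D * x\<close>.\<close>
    define D where "D = q\<^sup>2 + r\<^sup>2"
    have D: "D \<noteq> 0" using False by (simp add: D_def sum_power2_eq_zero_iff)
    show ?thesis unfolding \<open>c = 0\<close>
      by (rule classified3_pullback[OF classified3_elliptic_tangent[of "(a * q\<^sup>2 + b * r\<^sup>2 + p * q * r) / D" "(a * r\<^sup>2 + b * q\<^sup>2 - p * q * r) / D" "(2 * q * r * (b - a) + p * (q\<^sup>2 - r\<^sup>2)) / D"], of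
          q  "- r"  0
          r  q  0
          0  0  1
          "1 / D"  0   0  "1 / D"])
      (use D in \<open>simp_all add: q3_def field_simps\<close>, simp_all add: D_def power2_eq_square algebra_simps)
  qed
qed

text \<open>A first form without the third variable is brought into normal form by a substitution in the first two
  variables; the second form changes to some other quadratic form.\<close>

lemma classified3_binary: "classified3 (q3 a b 0 p 0 0) (q3 a' b' c' p' q' r')"
proof -
  obtain k l m n \<sigma> A B C where *: "k * n - l * m \<noteq> 0" "\<sigma> \<noteq> 0"
    "(A, B, C) \<in> {(0, 0, 0), (1, 0, 0), (0, 0, 1), (1, 1, 0)}"
    and eq: "\<And>x y. a * (k * x + l * y)\<^sup>2 + b * (m * x + n * y)\<^sup>2 + p * ((k * x + l * y) * (m * x + n * y))
      = \<sigma> * (A * x\<^sup>2 + B * y\<^sup>2 + C * (x * y))"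
    using binary_form_normal[of a b p] by metis
  obtain \<alpha> \<beta> \<gamma> \<delta> \<epsilon> \<eta> where g: "\<And>x y z. q3 a' b' c' p' q' r' (k * x + l * y + 0 * z) (m * x + n * y + 0 * z) (0 * x + 0 * y + 1 * z)
      = q3 \<alpha> \<beta> \<gamma> \<delta> \<epsilon> \<eta> x y z"
    using q3_linear_substitution[of a' b' c' p' q' r' k l 0 m n 0 0 0 1] by blast
  have "q3 A B 0 C 0 0 x y z = 1 / \<sigma> * q3 a b 0 p 0 0 (k * x + l * y) (m * x + n * y) z" for x y z
    using eq[of x y] *(2) by (simp add: q3_def)
  note f = this
  have "classified3 (q3 A B 0 C 0 0) (q3 \<alpha> \<beta> \<gamma> \<delta> \<epsilon> \<eta>)"
    using *(3) classified3_square classified3_hyperbolic classified3_elliptic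
      classified3_dependent[of 1 0 0 0 0 0 0 0 \<alpha> \<beta> \<gamma> \<delta> \<epsilon> \<eta>] by (auto simp: q3_def)
  then show ?thesis
    by (rule classified3_pullback[OF _, of _ _
          k  l  0
          m  n  0
          0  0  1
          "1 / \<sigma>"  0   0  1])
      (use *(1,2) f g in simp_all)
qed

text \<open>If two rows are not parallel, their vector product is a null vector: it is orthogonal to both of them,
  and to the third row because the determinant vanishes. If all rows are parallel, a vector
  orthogonal to a nonzero row is a null vector.\<close>

lemma singular_null_vector:
  fixes a1 :: real
  assumes det: "a1 * (b2 * c3 - c2 * b3) - b1 * (a2 * c3 - c2 * a3) + c1 * (a2 * b3 - b2 * a3) = 0"
  obtains u v w where "u \<noteq> 0 \<or> v \<noteq> 0 \<or> w \<noteq> 0"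
    "a1 * u + b1 * v + c1 * w = 0" "a2 * u + b2 * v + c2 * w = 0" "a3 * u + b3 * v + c3 * w = 0"
proof -
  consider (12) "b1 * c2 - c1 * b2 \<noteq> 0 \<or> c1 * a2 - a1 * c2 \<noteq> 0 \<or> a1 * b2 - b1 * a2 \<noteq> 0"
    | (13) "b1 * c3 - c1 * b3 \<noteq> 0 \<or> c1 * a3 - a1 * c3 \<noteq> 0 \<or> a1 * b3 - b1 * a3 \<noteq> 0"
    | (23) "b2 * c3 - c2 * b3 \<noteq> 0 \<or> c2 * a3 - a2 * c3 \<noteq> 0 \<or> a2 * b3 - b2 * a3 \<noteq> 0"
    | (par) "b1 * c2 - c1 * b2 = 0" "c1 * a2 - a1 * c2 = 0" "a1 * b2 - b1 * a2 = 0"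
       "b1 * c3 - c1 * b3 = 0" "c1 * a3 - a1 * c3 = 0" "a1 * b3 - b1 * a3 = 0"
       "b2 * c3 - c2 * b3 = 0" "c2 * a3 - a2 * c3 = 0" "a2 * b3 - b2 * a3 = 0" by blast
  then show thesis
  proof cases
    case 12
    then show thesis by (rule that) (use det in \<open>simp_all add: algebra_simps\<close>)
  next
    case 13
    then show thesis by (rule that) (use det in \<open>simp_all add: algebra_simps\<close>)
  next
    case 23
    then show thesis by (rule that) (use det in \<open>simp_all add: algebra_simps\<close>)
  next
    case par
    consider "a1 \<noteq> 0 \<or> b1 \<noteq> 0" | "c1 \<noteq> 0" | "a1 = 0" "b1 = 0" "c1 = 0" "a2 \<noteq> 0 \<or> b2 \<noteq> 0"
      | "a1 = 0" "b1 = 0" "c1 = 0" "c2 \<noteq> 0"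
      | "a1 = 0" "b1 = 0" "c1 = 0" "a2 = 0" "b2 = 0" "c2 = 0" "a3 \<noteq> 0 \<or> b3 \<noteq> 0"
      | "a1 = 0" "b1 = 0" "c1 = 0" "a2 = 0" "b2 = 0" "c2 = 0" "a3 = 0" "b3 = 0" by blast
    then show thesis
    proof cases
      case 1 show thesis by (rule that[of b1 "- a1" 0]) (use par 1 in \<open>auto simp: algebra_simps\<close>)
    next
      case 2 show thesis by (rule that[of c1 0 "- a1"]) (use par 2 in \<open>auto simp: algebra_simps\<close>)
    next
      case 3 show thesis by (rule that[of b2 "- a2" 0]) (use par 3 in \<open>auto simp: algebra_simps\<close>)
    next
      case 4 show thesis by (rule that[of c2 0 "- a2"]) (use par 4 in \<open>auto simp: algebra_simps\<close>)
    next
      case 5 show thesis by (rule that[of b3 "- a3" 0]) (use par 5 in \<open>auto simp: algebra_simps\<close>)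
    next
      case 6 show thesis by (rule that[of 1 0 0]) (use par 6 in auto)
    qed
  qed
qed

text \<open>Half of the determinant of the Hessian matrix of \<open>q3 a b c p q r\<close>.\<close>

definition disc3 :: "real \<Rightarrow> real \<Rightarrow> real \<Rightarrow> real \<Rightarrow> real \<Rightarrow> real \<Rightarrow> real" where
  "disc3 a b c p q r = 4 * a * b * c + p * q * r - a * r\<^sup>2 - b * q\<^sup>2 - c * p\<^sup>2"

text \<open>A null vector of the Hessian is a direction of translation invariance. Completing it to a basis by two
  of the unit vectors, as its third element, makes the form binary.\<close>

lemma classified3_singular_member:
  assumes "disc3 a b c p q r = 0"
  shows "classified3 (q3 a b c p q r) (q3 a' b' c' p' q' r')"
proof -
  let ?f = "q3 a b c p q r" and ?g = "q3 a' b' c' p' q' r'"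
  have "2 * a * (2 * b * (2 * c) - r * r) - p * (p * (2 * c) - r * q) + q * (p * r - 2 * b * q) = 0"
    using assms by (simp add: disc3_def power2_eq_square algebra_simps)
  then obtain u v w where nz: "u \<noteq> 0 \<or> v \<noteq> 0 \<or> w \<noteq> 0"
    and null: "2 * a * u + p * v + q * w = 0" "p * u + 2 * b * v + r * w = 0" "q * u + r * v + 2 * c * w = 0"
    by (rule singular_null_vector)
  have translate: "?f (x + t * u) (y + t * v) (z + t * w) = ?f x y z" for x y z t
  proof -
    have "?f (x + t * u) (y + t * v) (z + t * w) = ?f x y z
      + t * (x * (2 * a * u + p * v + q * w) + y * (p * u + 2 * b * v + r * w) + z * (q * u + r * v + 2 * c * w))
      + t\<^sup>2 * (u * (2 * a * u + p * v + q * w) + v * (p * u + 2 * b * v + r * w) + w * (q * u + r * v + 2 * c * w)) / 2"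
      by (simp add: q3_def power2_eq_square field_simps)
    then show ?thesis unfolding null by simp
  qed
  consider "w \<noteq> 0" | "v \<noteq> 0" | "u \<noteq> 0" using nz by blast
  then show ?thesis
  proof cases
    case 1
    obtain \<alpha> \<beta> \<gamma> \<delta> \<epsilon> \<eta> where g: "\<And>x y z. ?g (1 * x + 0 * y + u * z) (0 * x + 1 * y + v * z) (0 * x + 0 * y + w * z)
        = q3 \<alpha> \<beta> \<gamma> \<delta> \<epsilon> \<eta> x y z"
      using q3_linear_substitution[of a' b' c' p' q' r' 1 0 u 0 1 v 0 0 w] by blast
    have f: "q3 a b 0 p 0 0 x y z = ?f (x + u * z) (y + v * z) (w * z)" for x y z
      using translate[of x z y 0] by (simp add: q3_def mult.commute)
    show ?thesis
      by (rule classified3_pullback[OF classified3_binary[of a b p \<alpha> \<beta> \<gamma> \<delta> \<epsilon> \<eta>], of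
          1  0  u
          0  1  v
          0  0  w
          1  0   0  1])
      (use 1 f g in simp_all)
  next
    case 2
    obtain \<alpha> \<beta> \<gamma> \<delta> \<epsilon> \<eta> where g: "\<And>x y z. ?g (1 * x + 0 * y + u * z) (0 * x + 0 * y + v * z) (0 * x + 1 * y + w * z)
        = q3 \<alpha> \<beta> \<gamma> \<delta> \<epsilon> \<eta> x y z"
      using q3_linear_substitution[of a' b' c' p' q' r' 1 0 u 0 0 v 0 1 w] by blast
    have f: "q3 a c 0 q 0 0 x y z = ?f (x + u * z) (v * z) (y + w * z)" for x y z
      using translate[of x z 0 y] by (simp add: q3_def mult.commute)
    show ?thesis
      by (rule classified3_pullback[OF classified3_binary[of a c q \<alpha> \<beta> \<gamma> \<delta> \<epsilon> \<eta>], of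
          1  0  u
          0  0  v
          0  1  w
          1  0   0  1])
      (use 2 f g in simp_all)
  next
    case 3
    obtain \<alpha> \<beta> \<gamma> \<delta> \<epsilon> \<eta> where g: "\<And>x y z. ?g (0 * x + 0 * y + u * z) (1 * x + 0 * y + v * z) (0 * x + 1 * y + w * z)
        = q3 \<alpha> \<beta> \<gamma> \<delta> \<epsilon> \<eta> x y z"
      using q3_linear_substitution[of a' b' c' p' q' r' 0 0 u 1 0 v 0 1 w] by blast
    have f: "q3 b c 0 r 0 0 x y z = ?f (u * z) (x + v * z) (y + w * z)" for x y z
      using translate[of 0 z x y] by (simp add: q3_def mult.commute)
    show ?thesis
      by (rule classified3_pullback[OF classified3_binary[of b c r \<alpha> \<beta> \<gamma> \<delta> \<epsilon> \<eta>], of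
          0  0  u
          1  0  v
          0  1  w
          1  0   0  1])
      (use 3 f g in simp_all)
  qed
qed

text \<open>The discriminant is of odd degree, so it takes opposite values at \<open>\<theta> = 0\<close> and \<open>\<theta> = pi\<close>, and the
  intermediate value theorem applies.\<close>

lemma pencil_has_singular_member:
  obtains \<theta> where "disc3 (cos \<theta> * a + sin \<theta> * a') (cos \<theta> * b + sin \<theta> * b') (cos \<theta> * c + sin \<theta> * c')
    (cos \<theta> * p + sin \<theta> * p') (cos \<theta> * q + sin \<theta> * q') (cos \<theta> * r + sin \<theta> * r') = 0"
proof -
  define h where "h \<theta> = disc3 (cos \<theta> * a + sin \<theta> * a') (cos \<theta> * b + sin \<theta> * b') (cos \<theta> * c + sin \<theta> * c')
    (cos \<theta> * p + sin \<theta> * p') (cos \<theta> * q + sin \<theta> * q') (cos \<theta> * r + sin \<theta> * r')" for \<theta>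
  have cont: "continuous_on {0..pi} h" unfolding h_def disc3_def by (intro continuous_intros)
  have odd: "h pi = - h 0" by (simp add: h_def disc3_def algebra_simps)
  have "\<exists>\<theta>\<ge>0. \<theta> \<le> pi \<and> h \<theta> = 0"
  proof (cases "h 0 \<le> 0")
    case True
    then show ?thesis using IVT'[OF _ _ _ cont, of 0] odd by auto
  next
    case False
    then show ?thesis using IVT2'[OF _ _ _ cont, of 0] odd by auto
  qed
  then show thesis using that unfolding h_def by blast
qed

lemma classified3_all: "classified3 (q3 a b c p q r) (q3 a' b' c' p' q' r')"
proof -
  obtain \<theta> where \<theta>: "disc3 (cos \<theta> * a + sin \<theta> * a') (cos \<theta> * b + sin \<theta> * b') (cos \<theta> * c + sin \<theta> * c')
    (cos \<theta> * p + sin \<theta> * p') (cos \<theta> * q + sin \<theta> * q') (cos \<theta> * r + sin \<theta> * r') = 0"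
    by (rule pencil_has_singular_member)
  \<comment> \<open>The pencil is rotated by \<open>\<theta>\<close>, which keeps the two members independent.\<close>
  let ?g = "q3 (cos \<theta> * a' - sin \<theta> * a) (cos \<theta> * b' - sin \<theta> * b) (cos \<theta> * c' - sin \<theta> * c)
    (cos \<theta> * p' - sin \<theta> * p) (cos \<theta> * q' - sin \<theta> * q) (cos \<theta> * r' - sin \<theta> * r)"
  have "det2 (cos \<theta>) (sin \<theta>) (- sin \<theta>) (cos \<theta>) = 1"
    using sin_cos_squared_add[of \<theta>] by (simp add: power2_eq_square)
  then have unit: "det2 (cos \<theta>) (sin \<theta>) (- sin \<theta>) (cos \<theta>) \<noteq> 0" by simp
  show ?thesis
    by (rule classified3_pullback[OF classified3_singular_member[OF \<theta>, of "cos \<theta> * a' - sin \<theta> * a" "cos \<theta> * b' - sin \<theta> * b" "cos \<theta> * c' - sin \<theta> * c" "cos \<theta> * p' - sin \<theta> * p" "cos \<theta> * q' - sin \<theta> * q" "cos \<theta> * r' - sin \<theta> * r"], of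
          1  0  0
          0  1  0
          0  0  1
          "cos \<theta>"  "sin \<theta>"   "- sin \<theta>"  "cos \<theta>"])
      (use unit in \<open>simp_all add: q3_def algebra_simps\<close>)
qed

section \<open>Pencils and nets of binary quadratic forms\<close>

definition tuple2 :: "(real \<Rightarrow> real \<Rightarrow> real) \<Rightarrow> (real \<Rightarrow> real \<Rightarrow> real) \<Rightarrow> real vec \<Rightarrow> real vec" where
  "tuple2 f g = (\<lambda>\<xi>. vec_of_list [f (\<xi> $ 0) (\<xi> $ 1), g (\<xi> $ 0) (\<xi> $ 1)])"

definition q2 :: "real \<Rightarrow> real \<Rightarrow> real \<Rightarrow> real \<Rightarrow> real \<Rightarrow> real" where
  "q2 a b c x y = a * x\<^sup>2 + b * y\<^sup>2 + c * (x * y)"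

definition forms2 :: "(real vec \<Rightarrow> real vec) list" where
  "forms2 = [form_a1, form_a2, form_a3]"

lemma tuple2_carrier: "tuple2 f g \<in> carrier_vec 2 \<rightarrow> carrier_vec 2"
  by (simp add: tuple2_def vec_of_list_2)

lemma equivalent_tuple2:
  fixes f g f' g' :: "real \<Rightarrow> real \<Rightarrow> real"
  assumes "det2 m_xx m_xy m_yx m_yy \<noteq> 0" and "det2 n_ff n_fg n_gf n_gg \<noteq> 0"
    and f': "\<And>x y. f' x y = n_ff * f (m_xx * x + m_xy * y) (m_yx * x + m_yy * y) + n_fg * g (m_xx * x + m_xy * y) (m_yx * x + m_yy * y)"
    and g': "\<And>x y. g' x y = n_gf * f (m_xx * x + m_xy * y) (m_yx * x + m_yy * y) + n_gg * g (m_xx * x + m_xy * y) (m_yx * x + m_yy * y)"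
  shows "equivalent 2 2 (tuple2 f g) (tuple2 f' g')"
proof -
  let ?M = "mat_of_rows_list 2 [[m_xx, m_xy], [m_yx, m_yy]]"
  let ?N = "mat_of_rows_list 2 [[n_ff, n_gf], [n_fg, n_gg]]"
  have "det2 n_ff n_gf n_fg n_gg \<noteq> 0" using assms(2) by (simp add: det2_def mult.commute)
  note inv = mat_2_invertible[OF assms(1)] mat_2_invertible[OF this]
  have "tuple2 f' g' \<xi> = R ?N ?M (tuple2 f g) \<xi>" if "\<xi> \<in> carrier_vec 2" for \<xi>
  proof -
    obtain x y where \<xi>: "\<xi> = vec_of_list [x, y]" by (rule carrier_vec_2E[OF \<open>\<xi> \<in> carrier_vec 2\<close>])
    show ?thesis unfolding R_def \<xi> mat_2_mult transpose_mat_2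
      unfolding tuple2_def mat_2_mult vec_of_list_2 f' g' ..
  qed
  then show ?thesis unfolding equivalent_def using inv by blast
qed

abbreviation classified2 where "classified2 f g \<equiv> classified_by 2 2 forms2 (tuple2 f g)"

lemma classified2_pullback:
  fixes f g f' g' :: "real \<Rightarrow> real \<Rightarrow> real"
  assumes "classified2 f' g'"
    and "det2 m_xx m_xy m_yx m_yy \<noteq> 0" and "det2 n_ff n_fg n_gf n_gg \<noteq> 0"
    and "\<And>x y. f' x y = n_ff * f (m_xx * x + m_xy * y) (m_yx * x + m_yy * y) + n_fg * g (m_xx * x + m_xy * y) (m_yx * x + m_yy * y)"
    and "\<And>x y. g' x y = n_gf * f (m_xx * x + m_xy * y) (m_yx * x + m_yy * y) + n_gg * g (m_xx * x + m_xy * y) (m_yx * x + m_yy * y)"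
  shows "classified2 f g"
proof -
  have "equivalent 2 2 (tuple2 f g) (tuple2 f' g')" by (rule equivalent_tuple2) (fact assms)+
  then show ?thesis by (rule classified_by_equivalent[OF _ tuple2_carrier _ assms(1)]) simp
qed

lemma quadratic_form_2:
  "quadratic_form 2 F \<longleftrightarrow> (\<exists>a b c. \<forall>\<xi> \<in> carrier_vec 2. F \<xi> = q2 a b c (\<xi> $ 0) (\<xi> $ 1))"
proof
  assume "quadratic_form 2 F"
  then obtain a :: "nat \<Rightarrow> nat \<Rightarrow> real"
    where a: "\<And>\<xi>. \<xi> \<in> carrier_vec 2 \<Longrightarrow> F \<xi> = (\<Sum>i<2. \<Sum>j<2. a i j * (\<xi> $ i * \<xi> $ j))"
    unfolding quadratic_form_def by blast
  have "F \<xi> = q2 (a 0 0) (a 1 1) (a 0 1 + a 1 0) (\<xi> $ 0) (\<xi> $ 1)" if "\<xi> \<in> carrier_vec 2" for \<xi>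
    unfolding a[OF that]
    by (simp add: q2_def numeral_2_eq_2 lessThan_Suc algebra_simps power2_eq_square)
  then show "\<exists>a b c. \<forall>\<xi> \<in> carrier_vec 2. F \<xi> = q2 a b c (\<xi> $ 0) (\<xi> $ 1)" by blast
next
  assume "\<exists>a b c. \<forall>\<xi> \<in> carrier_vec 2. F \<xi> = q2 a b c (\<xi> $ 0) (\<xi> $ 1)"
  then obtain a b c where F: "\<And>\<xi>. \<xi> \<in> carrier_vec 2 \<Longrightarrow> F \<xi> = q2 a b c (\<xi> $ 0) (\<xi> $ 1)"
    by blast
  have *: "F \<xi> = (\<Sum>i<2. \<Sum>j<2. [[a, c], [0, b]] ! i ! j * (\<xi> $ i * \<xi> $ j))"
    if "\<xi> \<in> carrier_vec 2" for \<xi>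
    unfolding F[OF that]
    by (simp add: q2_def numeral_2_eq_2 lessThan_Suc algebra_simps power2_eq_square)
  show "quadratic_form 2 F" unfolding quadratic_form_def
    by (rule exI[of _ "\<lambda>i j. [[a, c], [0, b]] ! i ! j"], rule ballI, rule *)
qed

lemma quadratic_tuple_tuple2: "quadratic_tuple 2 2 (tuple2 (q2 a b c) (q2 a' b' c'))"
proof -
  have q: "quadratic_form 2 (\<lambda>\<xi>. q2 a b c (\<xi> $ 0) (\<xi> $ 1))" for a b c
    unfolding quadratic_form_2 by blast
  show ?thesis
    using q[unfolded One_nat_def] unfolding quadratic_tuple_def
    by (auto simp: tuple2_carrier less_2_cases_iff tuple2_def vec_of_list_2)
qed

lemma quadratic_tuple_2_2E:
  assumes "quadratic_tuple 2 2 Q"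
  obtains a b c a' b' c' where "\<And>\<xi>. \<xi> \<in> carrier_vec 2 \<Longrightarrow> Q \<xi> = tuple2 (q2 a b c) (q2 a' b' c') \<xi>"
proof -
  have "quadratic_form 2 (\<lambda>\<xi>. Q \<xi> $ 0)" "quadratic_form 2 (\<lambda>\<xi>. Q \<xi> $ 1)"
    using assms by (auto simp: quadratic_tuple_def)
  then obtain a b c a' b' c' where
    0: "\<And>\<xi>. \<xi> \<in> carrier_vec 2 \<Longrightarrow> Q \<xi> $ 0 = q2 a b c (\<xi> $ 0) (\<xi> $ 1)" and
    1: "\<And>\<xi>. \<xi> \<in> carrier_vec 2 \<Longrightarrow> Q \<xi> $ 1 = q2 a' b' c' (\<xi> $ 0) (\<xi> $ 1)"
    unfolding quadratic_form_2 by metis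
  have "Q \<xi> = tuple2 (q2 a b c) (q2 a' b' c') \<xi>" if "\<xi> \<in> carrier_vec 2" for \<xi>
  proof -
    have "Q \<xi> \<in> carrier_vec 2" using assms that by (auto simp: quadratic_tuple_def)
    then obtain u v where uv: "Q \<xi> = vec_of_list [u, v]" by (rule carrier_vec_2E)
    then show ?thesis using 0[OF that] 1[OF that] by (simp add: vec_of_list_2 tuple2_def)
  qed
  then show ?thesis by (rule that)
qed

lemma classified2_dependent:
  assumes st: "s \<noteq> 0 \<or> t \<noteq> 0" and z: "\<And>x y. s * q2 a b c x y + t * q2 a' b' c' x y = 0"
  shows "classified2 (q2 a b c) (q2 a' b' c')"
proof -
  let ?Q = "tuple2 (q2 a b c) (q2 a' b' c')"
  let ?c = "vec_of_list [s, t]"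
  have c: "?c \<in> carrier_vec 2" "?c \<noteq> 0\<^sub>v 2" using st by (simp_all add: vec_of_list_2 vec_of_list_2_eq_0_iff)
  have "combination 2 ?c ?Q \<xi> = 0" for \<xi>
    using z[of "\<xi> $ 0" "\<xi> $ 1"] by (simp add: combination_2 tuple2_def vec_of_list_2)
  then have "\<not> dd 2 2 ?Q 2 1 > 0"
    using combination_nonzero_of_dd[OF quadratic_tuple_tuple2 _ c] by blast
  then show ?thesis by (simp add: classified_by_def nondegenerate_def)
qed

lemma forms2_tuple2:
  "form_a1 = tuple2 (q2 1 0 0) (q2 0 0 1)"
  "form_a2 = tuple2 (q2 1 0 0) (q2 0 1 0)"
  "form_a3 = tuple2 (q2 0 0 1) (q2 1 (-1) 0)"
  by (simp_all add: fun_eq_iff tuple2_def q2_def form_a1_def form_a2_def form_a3_def)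

lemma classified2_forms:
  "classified2 (q2 1 0 0) (q2 0 0 1)"
  "classified2 (q2 1 0 0) (q2 0 1 0)"
  "classified2 (q2 0 0 1) (q2 1 (-1) 0)"
  by (rule classified_by_member[OF _ tuple2_carrier]; simp add: forms2_def forms2_tuple2)+

text \<open>Modulo \<open>x\<^sup>2\<close> either the square of \<open>y\<close> can be completed or only the product \<open>x * y\<close> is left.\<close>

lemma classified2_square: "classified2 (q2 1 0 0) (q2 a b c)"
proof -
  consider "b \<noteq> 0" | "b = 0" "c \<noteq> 0" | "b = 0" "c = 0" by blast
  then show ?thesis
  proof cases
    case 1
    show ?thesis
      by (rule classified2_pullback[OF classified2_forms(2), of
          1  0   "- c / (2 * b)"  1   1  0   "(c\<^sup>2 / (4 * b) - a) / b"  "1 / b"])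
      (use 1 in \<open>simp_all add: q2_def field_simps power2_eq_square\<close>)
  next
    case 2
    show ?thesis unfolding 2(1)
      by (rule classified2_pullback[OF classified2_forms(1), of
          1  0   0  1   1  0   "- a / c"  "1 / c"])
      (use 2 in \<open>simp_all add: q2_def field_simps power2_eq_square\<close>)
  next
    case 3
    show ?thesis unfolding 3 by (rule classified2_dependent[of "- a" 1]) (simp_all add: q2_def)
  qed
qed

text \<open>Modulo \<open>x * y\<close> the second form is diagonal. Equal signs give the squares of \<open>x + y\<close> and \<open>x - y\<close> as
  members of the pencil, opposite signs give \<open>form_a3\<close>, and a vanishing coefficient gives a square.\<close>

lemma classified2_hyperbolic: "classified2 (q2 0 0 1) (q2 a b c)"
proof -
  have one: "classified2 (q2 0 0 1) (q2 a 0 c)" for a c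
  proof (cases "a = 0")
    case True
    show ?thesis unfolding True by (rule classified2_dependent[of "- c" 1]) (simp_all add: q2_def)
  next
    case False
    show ?thesis
      by (rule classified2_pullback[OF classified2_forms(1), of
          1  0   0  1   "- c / a"  "1 / a"   1  0])
      (use False in \<open>simp_all add: q2_def field_simps power2_eq_square\<close>)
  qed
  have signs: "classified2 (q2 0 0 1) (q2 \<epsilon> \<delta> 0)" if "\<epsilon> \<in> {1, -1}" "\<delta> \<in> {1, -1}" for \<epsilon> \<delta>
  proof -
    consider "\<epsilon> = 1" "\<delta> = 1" | "\<epsilon> = -1" "\<delta> = -1" | "\<epsilon> = 1" "\<delta> = -1" | "\<epsilon> = -1" "\<delta> = 1"
      using \<open>\<epsilon> \<in> {1, -1}\<close> \<open>\<delta> \<in> {1, -1}\<close> by auto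
    then show ?thesis
    proof cases
      case 1
      show ?thesis unfolding 1
        by (rule classified2_pullback[OF classified2_forms(2), of
          "1 / 2"  "1 / 2"   "1 / 2"  "- (1 / 2)"   2  1   "- 2"  1])
      (simp_all add: q2_def field_simps power2_eq_square)
    next
      case 2
      show ?thesis unfolding 2
        by (rule classified2_pullback[OF classified2_forms(2), of
          "1 / 2"  "1 / 2"   "1 / 2"  "- (1 / 2)"   2  "- 1"   "- 2"  "- 1"])
      (simp_all add: q2_def field_simps power2_eq_square)
    next
      case 3
      show ?thesis unfolding 3 by (rule classified2_forms)
    next
      case 4
      show ?thesis unfolding 4
        by (rule classified2_pullback[OF classified2_forms(3), of
          1  0   0  1   1  0   0  "- 1"])
      (simp_all add: q2_def field_simps power2_eq_square)
    qed
  qed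
  consider "b = 0" | "a = 0" | "a \<noteq> 0" "b \<noteq> 0" by blast
  then show ?thesis
  proof cases
    case 1
    then show ?thesis using one by simp
  next
    case 2
    show ?thesis unfolding 2
      by (rule classified2_pullback[OF one[of b c], of
          0  1   1  0   1  0   0  1])
      (simp_all add: q2_def)
  next
    case 3
    obtain s \<epsilon> where s: "s \<noteq> 0" "\<epsilon> \<in> {1, -1}" "a * s\<^sup>2 = \<epsilon>" using rescale_to_sign[OF 3(1)] .
    obtain t \<delta> where t: "t \<noteq> 0" "\<delta> \<in> {1, -1}" "b * t\<^sup>2 = \<delta>" using rescale_to_sign[OF 3(2)] .
    show ?thesis
      by (rule classified2_pullback[OF signs[OF s(2) t(2)], of
          s  0   0  t   "1 / (s * t)"  0   "- c"  1])
      (use s t in \<open>simp_all add: q2_def power_mult_distrib mult.assoc[symmetric]\<close>)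
  qed
qed

text \<open>After a rotation both forms are diagonal, so that the pencil contains \<open>x\<^sup>2\<close> and \<open>y\<^sup>2\<close> or consists of
  multiples of a single form.\<close>

lemma classified2_elliptic: "classified2 (q2 1 1 0) (q2 a b c)"
proof -
  have diagonal: "classified2 (q2 1 1 0) (q2 a b 0)" for a b
  proof (cases "a = b")
    case True
    show ?thesis unfolding True
      by (rule classified2_dependent[of "- b" 1]) (simp_all add: q2_def algebra_simps)
  next
    case False
    define e where "e = a - b"
    have e: "e \<noteq> 0" "a = b + e" using False by (simp_all add: e_def)
    show ?thesis unfolding e(2)
      by (rule classified2_pullback[OF classified2_forms(2), of
          1  0   0  1   "- b / e"  "1 / e"   "(b + e) / e"  "- 1 / e"])
      (use e(1) in \<open>simp_all add: q2_def field_simps power2_eq_square\<close>)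
  qed
  obtain t where t: "c * (1 - t\<^sup>2) + 2 * (b - a) * t = 0" by (rule rotation_diagonalizes)
  have pos: "1 + t\<^sup>2 \<noteq> 0" by (metis add_pos_nonneg less_numeral_extra(1,3) zero_le_power2)
  have f: "q2 1 1 0 (x - t * y) (t * x + y) = (1 + t\<^sup>2) * q2 1 1 0 x y" for x y
    by (simp add: q2_def power2_eq_square algebra_simps)
  have "q2 a b c (x - t * y) (t * x + y) = q2 (a + b * t\<^sup>2 + c * t) (a * t\<^sup>2 + b - c * t) 0 x y
      + (c * (1 - t\<^sup>2) + 2 * (b - a) * t) * (x * y)" for x y
    by (simp add: q2_def power2_eq_square algebra_simps)
  then have g: "q2 a b c (x - t * y) (t * x + y) = q2 (a + b * t\<^sup>2 + c * t) (a * t\<^sup>2 + b - c * t) 0 x y" for x y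
    using t by simp
  show ?thesis
    by (rule classified2_pullback[OF diagonal[of "a + b * t\<^sup>2 + c * t" "a * t\<^sup>2 + b - c * t"], of
          1  "- t"   t  1   "1 / (1 + t\<^sup>2)"  0   0  1])
      (use pos f g in \<open>simp_all add: power2_eq_square[symmetric]\<close>)
qed

lemma classified2_all: "classified2 (q2 a b c) (q2 a' b' c')"
proof -
  obtain k l m n \<sigma> A B C where *: "k * n - l * m \<noteq> 0" "\<sigma> \<noteq> 0"
    "(A, B, C) \<in> {(0, 0, 0), (1, 0, 0), (0, 0, 1), (1, 1, 0)}"
    and eq: "\<And>x y. a * (k * x + l * y)\<^sup>2 + b * (m * x + n * y)\<^sup>2 + c * ((k * x + l * y) * (m * x + n * y))
      = \<sigma> * (A * x\<^sup>2 + B * y\<^sup>2 + C * (x * y))"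
    using binary_form_normal[of a b c] by metis
  let ?g = "q2 a' b' c'"
  have g: "?g (k * x + l * y) (m * x + n * y)
      = q2 (?g k m) (?g l n) (?g (k + l) (m + n) - ?g k m - ?g l n) x y" for x y
    by (simp add: q2_def power2_eq_square algebra_simps)
  have f: "q2 A B C x y = 1 / \<sigma> * q2 a b c (k * x + l * y) (m * x + n * y)" for x y
    using eq[of x y] *(2) by (simp add: q2_def)
  have "classified2 (q2 A B C) (q2 (?g k m) (?g l n) (?g (k + l) (m + n) - ?g k m - ?g l n))"
    using *(3) classified2_square classified2_hyperbolic classified2_elliptic
      classified2_dependent[of 1 0 0 0 0 "?g k m" "?g l n" "?g (k + l) (m + n) - ?g k m - ?g l n"]
    by (auto simp: q2_def)
  then show ?thesis
    by (rule classified2_pullback[OF _, of _ _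
          k  l   m  n   "1 / \<sigma>"  0   0  1])
      (use *(1,2) f g in simp_all)
qed

lemma form_b_carrier: "form_b \<in> carrier_vec 2 \<rightarrow> carrier_vec 3"
  by (simp add: form_b_def vec_of_list_3)

lemma transpose_mat_3:
  "transpose_mat (mat_of_rows_list 3 [[a, b, c], [d, e, f], [g, h, i]]) = mat_of_rows_list 3 [[a, d, g], [b, e, h], [c, f, i]]"
  by (intro eq_matI) (auto simp: mat_of_rows_list_def less_Suc_eq numeral_3_eq_3)

lemma combination_3: "combination 3 c Q \<xi> = c $ 0 * Q \<xi> $ 0 + c $ 1 * Q \<xi> $ 1 + c $ 2 * Q \<xi> $ 2"
  by (simp add: combination_def numeral_3_eq_3 numeral_2_eq_2 lessThan_Suc)

text \<open>The coefficient matrix of three independent binary forms is invertible, so the forms span the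
  same space as the three monomials.\<close>

lemma equivalent_form_b:
  assumes Q: "quadratic_tuple 2 3 Q" and pos: "dd 2 3 Q 2 1 > 0"
  shows "equivalent 2 3 Q form_b"
proof -
  have "quadratic_form 2 (\<lambda>\<xi>. Q \<xi> $ j)" if "j < 3" for j
    using Q that by (auto simp: quadratic_tuple_def)
  then have "\<forall>j. \<exists>a b c. j < 3 \<longrightarrow> (\<forall>\<xi> \<in> carrier_vec 2. Q \<xi> $ j = q2 a b c (\<xi> $ 0) (\<xi> $ 1))"
    unfolding quadratic_form_2 by blast
  then obtain a b c where q: "\<And>j \<xi>. j < 3 \<Longrightarrow> \<xi> \<in> carrier_vec 2 \<Longrightarrow> Q \<xi> $ j = q2 (a j) (b j) (c j) (\<xi> $ 0) (\<xi> $ 1)"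
    by metis
  let ?N = "mat_of_rows_list 3 [[a 0, a 1, a 2], [c 0, c 1, c 2], [b 0, b 1, b 2 :: real]]"
  have N: "?N \<in> carrier_mat 3 3" by (intro carrier_matI) (simp_all add: mat_of_rows_list_def)
  have inv: "invertible_mat ?N"
  proof (rule invertible_mat_if_inj[OF N], rule ccontr)
    fix v :: "real vec" assume v: "v \<in> carrier_vec 3" "?N *\<^sub>v v = 0\<^sub>v 3" "v \<noteq> 0\<^sub>v 3"
    obtain s t u where stu: "v = vec_of_list [s, t, u]" by (rule carrier_vec_3E[OF \<open>v \<in> carrier_vec 3\<close>])
    have eq: "vec_of_list [a 0 * s + a 1 * t + a 2 * u, c 0 * s + c 1 * t + c 2 * u, b 0 * s + b 1 * t + b 2 * u] = 0\<^sub>v 3"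
      using v(2) unfolding stu mat_3_mult .
    have rows: "a 0 * s + a 1 * t + a 2 * u = 0" "c 0 * s + c 1 * t + c 2 * u = 0" "b 0 * s + b 1 * t + b 2 * u = 0"
      using arg_cong[OF eq, of "\<lambda>w. w $ 0"] arg_cong[OF eq, of "\<lambda>w. w $ 1"] arg_cong[OF eq, of "\<lambda>w. w $ 2"]
      by (simp_all add: vec_of_list_3)
    have "combination 3 v Q \<xi> = 0" if "\<xi> \<in> carrier_vec 2" for \<xi>
    proof -
      have "combination 3 v Q \<xi> = (a 0 * s + a 1 * t + a 2 * u) * (\<xi> $ 0)\<^sup>2
          + (b 0 * s + b 1 * t + b 2 * u) * (\<xi> $ 1)\<^sup>2 + (c 0 * s + c 1 * t + c 2 * u) * (\<xi> $ 0 * \<xi> $ 1)"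
        using that by (simp add: combination_3 q stu vec_of_list_3 q2_def algebra_simps)
      then show ?thesis unfolding rows by simp
    qed
    then show False using combination_nonzero_of_dd[OF Q pos v(1,3)] by blast
  qed
  have "Q \<xi> = R ?N (1\<^sub>m 2) form_b \<xi>" if "\<xi> \<in> carrier_vec 2" for \<xi>
  proof -
    have "Q \<xi> \<in> carrier_vec 3" using Q that by (auto simp: quadratic_tuple_def)
    then obtain u v w where uvw: "Q \<xi> = vec_of_list [u, v, w]" by (rule carrier_vec_3E)
    have "u = q2 (a 0) (b 0) (c 0) (\<xi> $ 0) (\<xi> $ 1)" "v = q2 (a 1) (b 1) (c 1) (\<xi> $ 0) (\<xi> $ 1)"
      "w = q2 (a 2) (b 2) (c 2) (\<xi> $ 0) (\<xi> $ 1)"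
      using q[of 0, OF _ that] q[of 1, OF _ that] q[of 2, OF _ that] by (simp_all add: uvw vec_of_list_3)
    then show ?thesis
      using that unfolding uvw R_def form_b_def transpose_mat_3 mat_3_mult
      by (simp add: q2_def mat_3_mult algebra_simps)
  qed
  moreover have "invertible_mat (1\<^sub>m 2 :: real mat)" using invertible_matI[of "1\<^sub>m 2" 2 "1\<^sub>m 2"] by simp
  ultimately have "equivalent 2 3 form_b Q" unfolding equivalent_def using N inv one_carrier_mat by blast
  then show ?thesis by (rule equivalent_sym[OF _ form_b_carrier])
qed

text \<open>The forms in one variable are the multiples of a single square, so two of them are dependent.\<close>

lemma dd_one_variable:
  assumes Q: "quadratic_tuple 1 n Q" and n: "2 \<le> n"
  shows "dd 1 n Q 1 1 = 0"
proof (rule ccontr)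
  assume "dd 1 n Q 1 1 \<noteq> 0"
  then have pos: "dd 1 n Q 1 1 > 0" by simp
  have "\<exists>a. \<forall>\<xi> \<in> carrier_vec 1. Q \<xi> $ j = a * (\<xi> $ 0 * \<xi> $ 0)" if "j < n" for j
    using Q that unfolding quadratic_tuple_def quadratic_form_def by auto
  then obtain a where a: "\<And>j \<xi>. j < n \<Longrightarrow> \<xi> \<in> carrier_vec 1 \<Longrightarrow> Q \<xi> $ j = a j * (\<xi> $ 0 * \<xi> $ 0)"
    by metis
  have "\<exists>s t. (s \<noteq> 0 \<or> t \<noteq> 0) \<and> s * a 0 + t * a 1 = 0"
  proof (cases "a 0 = 0")
    case True then show ?thesis by (intro exI[of _ 1] exI[of _ 0]) simp
  next
    case False then show ?thesis by (intro exI[of _ "- a 1"] exI[of _ "a 0"]) simp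
  qed
  then obtain s t where st: "s \<noteq> 0 \<or> t \<noteq> 0" "s * a 0 + t * a 1 = 0" by blast
  let ?c = "vec n (\<lambda>k. if k = 0 then s else if k = 1 then t else 0)"
  have "?c $ 0 = s" "?c $ 1 = t" using n by simp_all
  then have "?c \<noteq> 0\<^sub>v n" using st(1) n by (metis index_zero_vec(1) less_le_trans one_less_numeral_iff pos2 semiring_norm(76))
  moreover have "combination n ?c Q \<xi> = 0" if "\<xi> \<in> carrier_vec 1" for \<xi>
  proof -
    have "combination n ?c Q \<xi> = (\<Sum>k\<in>{0, 1}. ?c $ k * Q \<xi> $ k)"
      unfolding combination_def using n by (intro sum.mono_neutral_right) auto
    also have "\<dots> = (s * a 0 + t * a 1) * (\<xi> $ 0 * \<xi> $ 0)"
      using n that a[of 0 \<xi>] a[of 1 \<xi>] by (simp add: algebra_simps)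
    finally show ?thesis using st(2) by simp
  qed
  ultimately show False using combination_nonzero_of_dd[OF Q pos, of ?c] by auto
qed

section \<open>The invariants of the normal forms\<close>

lemma equivalent_cong:
  assumes "Q \<in> carrier_vec d \<rightarrow> carrier_vec n" "\<And>\<xi>. \<xi> \<in> carrier_vec d \<Longrightarrow> Q \<xi> = Q' \<xi>"
  shows "equivalent d n Q Q'"
  using equivalent_refl[OF assms(1)] assms(2) unfolding equivalent_def by metis

text \<open>The differences of the two sides are the entries of the vector product.\<close>

lemma independent_pair_3_iff:
  "independent_pair 3 (vec_of_list [u1, u2, u3]) (vec_of_list [w1, w2, w3]) \<longleftrightarrow>
    u2 * w3 \<noteq> u3 * w2 \<or> u3 * w1 \<noteq> u1 * w3 \<or> u1 * w2 \<noteq> u2 * w1"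
proof -
  have lin: "a \<cdot>\<^sub>v vec_of_list [u1, u2, u3] + b \<cdot>\<^sub>v vec_of_list [w1, w2, w3] = 0\<^sub>v 3 \<longleftrightarrow>
      a * u1 + b * w1 = 0 \<and> a * u2 + b * w2 = 0 \<and> a * u3 + b * w3 = 0" (is "?v = _ \<longleftrightarrow> _") for a b
  proof
    assume "?v = 0\<^sub>v 3"
    then have "?v $ 0 = 0" "?v $ 1 = 0" "?v $ 2 = 0" by simp_all
    then show "a * u1 + b * w1 = 0 \<and> a * u2 + b * w2 = 0 \<and> a * u3 + b * w3 = 0"
      by (simp add: vec_of_list_3)
  next
    assume "a * u1 + b * w1 = 0 \<and> a * u2 + b * w2 = 0 \<and> a * u3 + b * w3 = 0"
    then show "?v = 0\<^sub>v 3"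
      by (intro eq_vecI) (auto simp: vec_of_list_index less_Suc_eq numeral_3_eq_3)
  qed
  show ?thesis (is "_ \<longleftrightarrow> ?minor")
  proof
    assume "independent_pair 3 (vec_of_list [u1, u2, u3]) (vec_of_list [w1, w2, w3])"
    then have *: "a = 0 \<and> b = 0" if "a * u1 + b * w1 = 0" "a * u2 + b * w2 = 0" "a * u3 + b * w3 = 0" for a b
      using that unfolding independent_pair_def lin by blast
    show ?minor
    proof (rule ccontr)
      assume "\<not> ?minor"
      then have "w1 = 0 \<and> - u1 = 0" "w2 = 0 \<and> - u2 = 0" "w3 = 0 \<and> - u3 = 0"
        using *[of w1 "- u1"] *[of w2 "- u2"] *[of w3 "- u3"] by (simp_all add: mult.commute)
      then show False using *[of 1 0] by simp
    qed
  next
    assume minor: ?minor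
    have indep: "a = 0 \<and> b = 0" if z: "a * u1 + b * w1 = 0" "a * u2 + b * w2 = 0" "a * u3 + b * w3 = 0" for a b
    proof -
      let ?E1 = "a * u1 + b * w1" and ?E2 = "a * u2 + b * w2" and ?E3 = "a * u3 + b * w3"
      have "a * (u2 * w3 - u3 * w2) = w3 * ?E2 - w2 * ?E3" "a * (u3 * w1 - u1 * w3) = w1 * ?E3 - w3 * ?E1"
        "a * (u1 * w2 - u2 * w1) = w2 * ?E1 - w1 * ?E2"
        "b * (u2 * w3 - u3 * w2) = u2 * ?E3 - u3 * ?E2" "b * (u3 * w1 - u1 * w3) = u3 * ?E1 - u1 * ?E3"
        "b * (u1 * w2 - u2 * w1) = u1 * ?E2 - u2 * ?E1"
        by (simp_all add: algebra_simps)
      then show ?thesis using minor unfolding z by auto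
    qed
    show "independent_pair 3 (vec_of_list [u1, u2, u3]) (vec_of_list [w1, w2, w3])"
      unfolding independent_pair_def lin
    proof (intro conjI allI impI)
      fix a b assume "a * u1 + b * w1 = 0 \<and> a * u2 + b * w2 = 0 \<and> a * u3 + b * w3 = 0"
      then show "a = 0" "b = 0" using indep by blast+
    qed (rule vec_of_list_3(1))+
  qed
qed

lemma lincomb_3:
  "a \<cdot>\<^sub>v vec_of_list [u1, u2, u3] + b \<cdot>\<^sub>v vec_of_list [w1, w2, w3]
   = vec_of_list [a * u1 + b * w1, a * u2 + b * w2, a * u3 + b * w3 :: real]"
  by (intro eq_vecI) (auto simp: vec_of_list_index less_Suc_eq numeral_3_eq_3)

lemma ex_independent_pair_3:
  "(\<exists>u w. independent_pair 3 u w \<and> P u w) \<longleftrightarrow>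
   (\<exists>u1 u2 u3 w1 w2 w3. (u2 * w3 \<noteq> u3 * w2 \<or> u3 * w1 \<noteq> u1 * w3 \<or> u1 * w2 \<noteq> u2 * w1) \<and>
      P (vec_of_list [u1, u2, u3]) (vec_of_list [w1, w2, w3]))"
proof
  assume "\<exists>u w. independent_pair 3 u w \<and> P u w"
  then obtain u w where uw: "independent_pair 3 u w" "P u w" by blast
  obtain u1 u2 u3 where u: "u = vec_of_list [u1, u2, u3]"
    using uw(1) carrier_vec_3E unfolding independent_pair_def by blast
  obtain w1 w2 w3 where w: "w = vec_of_list [w1, w2, w3]"
    using uw(1) carrier_vec_3E unfolding independent_pair_def by blast
  show "\<exists>u1 u2 u3 w1 w2 w3. (u2 * w3 \<noteq> u3 * w2 \<or> u3 * w1 \<noteq> u1 * w3 \<or> u1 * w2 \<noteq> u2 * w1) \<and>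
      P (vec_of_list [u1, u2, u3]) (vec_of_list [w1, w2, w3])"
    using uw unfolding u w independent_pair_3_iff by blast
next
  assume "\<exists>u1 u2 u3 w1 w2 w3. (u2 * w3 \<noteq> u3 * w2 \<or> u3 * w1 \<noteq> u1 * w3 \<or> u1 * w2 \<noteq> u2 * w1) \<and>
      P (vec_of_list [u1, u2, u3]) (vec_of_list [w1, w2, w3])"
  then show "\<exists>u w. independent_pair 3 u w \<and> P u w" using independent_pair_3_iff by blast
qed

lemma tuple3_at: "tuple3 f g (vec_of_list [x, y, z]) = vec_of_list [f x y z, g x y z]"
  by (simp add: tuple3_def vec_of_list_3)

lemma vec_of_list_2_eq_iff: "vec_of_list [s, t] = vec_of_list [s', t'] \<longleftrightarrow> s = s' \<and> t = t'"
  by (metis vec_of_list_2(2,3))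

lemma smult_vec_of_list_2: "a \<cdot>\<^sub>v vec_of_list [s, t] = vec_of_list [a * s, a * t :: real]"
  by (intro eq_vecI) (auto simp: vec_of_list_index less_Suc_eq numeral_2_eq_2)

lemma dd_two_zero_tuple3_iff:
  fixes a b c p q r a' b' c' p' q' r' :: real
  defines "f \<equiv> q3 a b c p q r" and "g \<equiv> q3 a' b' c' p' q' r'"
  shows "dd 3 2 (tuple3 f g) 2 2 = 0 \<longleftrightarrow>
    (\<exists>u1 u2 u3 w1 w2 w3. (u2 * w3 \<noteq> u3 * w2 \<or> u3 * w1 \<noteq> u1 * w3 \<or> u1 * w2 \<noteq> u2 * w1) \<and>
      (\<forall>s t. f (s * u1 + t * w1) (s * u2 + t * w2) (s * u3 + t * w3) = 0 \<and>
             g (s * u1 + t * w1) (s * u2 + t * w2) (s * u3 + t * w3) = 0))"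
proof -
  have "dd 3 2 (tuple3 f g) 2 2 = 0 \<longleftrightarrow>
      (\<exists>u w. independent_pair 3 u w \<and> (\<forall>s t. tuple3 f g (s \<cdot>\<^sub>v u + t \<cdot>\<^sub>v w) = 0\<^sub>v 2))"
    unfolding f_def g_def by (rule dd_two_zero_iff[OF quadratic_tuple_tuple3]) simp
  then show ?thesis unfolding ex_independent_pair_3 lincomb_3 tuple3_at vec_of_list_2_eq_0_iff .
qed

lemma dd_two_le_one_tuple3_iff:
  fixes a b c p q r a' b' c' p' q' r' :: real
  defines "f \<equiv> q3 a b c p q r" and "g \<equiv> q3 a' b' c' p' q' r'"
  shows "dd 3 2 (tuple3 f g) 2 2 \<le> 1 \<longleftrightarrow>
    (\<exists>u1 u2 u3 w1 w2 w3. (u2 * w3 \<noteq> u3 * w2 \<or> u3 * w1 \<noteq> u1 * w3 \<or> u1 * w2 \<noteq> u2 * w1) \<and>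
      (\<forall>s t. f (s * u1 + t * w1) (s * u2 + t * w2) (s * u3 + t * w3) = s\<^sup>2 * f u1 u2 u3 \<and>
             g (s * u1 + t * w1) (s * u2 + t * w2) (s * u3 + t * w3) = s\<^sup>2 * g u1 u2 u3))"
proof -
  have "dd 3 2 (tuple3 f g) 2 2 \<le> 1 \<longleftrightarrow>
      (\<exists>u w. independent_pair 3 u w \<and> (\<forall>s t. tuple3 f g (s \<cdot>\<^sub>v u + t \<cdot>\<^sub>v w) = s\<^sup>2 \<cdot>\<^sub>v tuple3 f g u))"
    unfolding f_def g_def by (rule dd_two_le_one_iff[OF quadratic_tuple_tuple3]) simp
  then show ?thesis
    unfolding ex_independent_pair_3 lincomb_3 tuple3_at smult_vec_of_list_2 vec_of_list_2_eq_iff .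
qed

text \<open>The premise says that no nontrivial combination of the two forms has a Hessian matrix with
  vanishing principal minors of size two; but these minors do vanish for \<open>\<kappa> * (l1 * x + l2 * y + l3 * z)\<^sup>2\<close>.\<close>

lemma dd_full_one_tuple3_ge_two:
  assumes imp: "\<And>s t. 4 * (s * a + t * a') * (s * b + t * b') = (s * p + t * p')\<^sup>2 \<Longrightarrow>
      4 * (s * a + t * a') * (s * c + t * c') = (s * q + t * q')\<^sup>2 \<Longrightarrow>
      4 * (s * b + t * b') * (s * c + t * c') = (s * r + t * r')\<^sup>2 \<Longrightarrow> s = 0 \<and> t = 0"
  shows "dd 3 2 (tuple3 (q3 a b c p q r) (q3 a' b' c' p' q' r')) 3 1 \<ge> 2"
proof (rule ccontr)
  let ?Q = "tuple3 (q3 a b c p q r) (q3 a' b' c' p' q' r')"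
  assume "\<not> dd 3 2 ?Q 3 1 \<ge> 2"
  then have "dd 3 2 ?Q 3 1 \<le> 1" by simp
  then obtain v l \<kappa> where v: "v \<in> carrier_vec 2" "v \<noteq> 0\<^sub>v 2" and l: "l \<in> carrier_vec 3"
    and sq: "\<And>\<xi>. \<xi> \<in> carrier_vec 3 \<Longrightarrow> combination 2 v ?Q \<xi> = \<kappa> * (l \<bullet> \<xi>)\<^sup>2"
    using dd_full_one_imp_square[OF quadratic_tuple_tuple3, of a b c p q r a' b' c' p' q' r'] by auto
  obtain s t where st: "v = vec_of_list [s, t]" by (rule carrier_vec_2E[OF v(1)])
  obtain l1 l2 l3 where ls: "l = vec_of_list [l1, l2, l3]" by (rule carrier_vec_3E[OF l])
  have "l \<bullet> vec_of_list [x, y, z] = l1 * x + l2 * y + l3 * z" for x y z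
    by (simp add: ls scalar_prod_def vec_of_list_index numeral_3_eq_3 numeral_2_eq_2 atLeast0_lessThan_Suc)
  then have eq: "s * q3 a b c p q r x y z + t * q3 a' b' c' p' q' r' x y z = \<kappa> * (l1 * x + l2 * y + l3 * z)\<^sup>2" for x y z
    using sq[of "vec_of_list [x, y, z]"] by (simp add: st combination_2 tuple3_at vec_of_list_2 vec_of_list_3)
  have diag: "s * a + t * a' = \<kappa> * l1\<^sup>2" "s * b + t * b' = \<kappa> * l2\<^sup>2" "s * c + t * c' = \<kappa> * l3\<^sup>2"
    using eq[of 1 0 0] eq[of 0 1 0] eq[of 0 0 1] by (simp_all add: q3_def)
  have cross: "s * p + t * p' = 2 * \<kappa> * l1 * l2" "s * q + t * q' = 2 * \<kappa> * l1 * l3" "s * r + t * r' = 2 * \<kappa> * l2 * l3"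
    using eq[of 1 1 0] eq[of 1 0 1] eq[of 0 1 1] diag
    by (simp_all add: q3_def power2_eq_square algebra_simps)
  have "s = 0 \<and> t = 0" by (rule imp) (simp_all add: diag cross power2_eq_square)
  then show False using v(2) by (simp add: st vec_of_list_2_eq_0_iff)
qed

lemma dd_full_one_tuple3_pos:
  assumes imp: "\<And>s t. s * a + t * a' = 0 \<Longrightarrow> s * b + t * b' = 0 \<Longrightarrow> s * c + t * c' = 0 \<Longrightarrow>
      s * r + t * r' = 0 \<Longrightarrow> s = 0 \<and> t = 0"
  shows "dd 3 2 (tuple3 (q3 a b c p q r) (q3 a' b' c' p' q' r')) 3 1 > 0"
  unfolding dd_pos_iff[OF quadratic_tuple_tuple3 one_le_numeral]
proof (intro ballI impI, rule ccontr)
  let ?Q = "tuple3 (q3 a b c p q r) (q3 a' b' c' p' q' r')"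
  fix v :: "real vec" assume v: "v \<in> carrier_vec 2" "v \<noteq> 0\<^sub>v 2"
  assume zero: "\<not> (\<exists>\<xi> \<in> carrier_vec 3. combination 2 v ?Q \<xi> \<noteq> 0)"
  obtain s t where st: "v = vec_of_list [s, t]" by (rule carrier_vec_2E[OF v(1)])
  have "s * q3 a b c p q r x y z + t * q3 a' b' c' p' q' r' x y z = 0" for x y z
  proof -
    have "combination 2 v ?Q (vec_of_list [x, y, z]) = 0" using zero vec_of_list_3(1)[of x y z] by blast
    then show ?thesis by (simp add: st combination_2 tuple3_at vec_of_list_2)
  qed
  from this[of 1 0 0] this[of 0 1 0] this[of 0 0 1] this[of 0 1 1] have "s = 0 \<and> t = 0"
    by (intro imp) (simp_all add: q3_def algebra_simps)
  then show False using v(2) by (simp add: st vec_of_list_2_eq_0_iff)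
qed

lemma dd_full_one_tuple3_le_two:
  "dd 3 2 (tuple3 (q3 a b 0 p 0 0) (q3 a' b' c' p' q' r')) 3 1 \<le> 2"
  using dd_full_one_le[OF quadratic_tuple_tuple3, of 0 "{0, 1}" a b 0 p 0 0 a' b' c' p' q' r']
  by (auto simp: tuple3_def q3_def vec_of_list_2 less_Suc_eq numeral_3_eq_3)

lemma dd_full_one_tuple3_le_one:
  "dd 3 2 (tuple3 (q3 a 0 0 0 0 0) (q3 a' b' c' p' q' r')) 3 1 \<le> 1"
  using dd_full_one_le[OF quadratic_tuple_tuple3, of 0 "{0}" a 0 0 0 0 0 a' b' c' p' q' r']
  by (auto simp: tuple3_def q3_def vec_of_list_2 less_Suc_eq numeral_3_eq_3)

lemma dd_full_one_square_forms:
  "dd 3 2 form_c1_1 3 1 = 1" "dd 3 2 form_c1_2 3 1 = 1" "dd 3 2 form_c2 3 1 = 1"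
proof -
  have "dd 3 2 form_c1_1 3 1 > 0" "dd 3 2 form_c1_2 3 1 > 0" "dd 3 2 form_c2 3 1 > 0"
    unfolding forms3_tuple3 by (rule dd_full_one_tuple3_pos; simp)+
  moreover have "dd 3 2 form_c1_1 3 1 \<le> 1" "dd 3 2 form_c1_2 3 1 \<le> 1" "dd 3 2 form_c2 3 1 \<le> 1"
    unfolding forms3_tuple3 by (rule dd_full_one_tuple3_le_one)+
  ultimately show "dd 3 2 form_c1_1 3 1 = 1" "dd 3 2 form_c1_2 3 1 = 1" "dd 3 2 form_c2 3 1 = 1" by linarith+
qed

lemma dd_full_one_other_forms:
  "dd 3 2 form_c3 3 1 = 2" "dd 3 2 form_c4_1 3 1 = 2" "dd 3 2 form_c4_2 3 1 = 2" "dd 3 2 form_c4_3 3 1 = 2"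
  "dd 3 2 form_c5_1 3 1 = 2" "dd 3 2 form_c5_2 3 1 = 2" "dd 3 2 form_c5_3 3 1 = 2"
proof -
  have eq_two: "dd 3 2 (tuple3 (q3 a b 0 p 0 0) (q3 a' b' c' p' q' r')) 3 1 = 2"
    if "\<And>s t. 4 * (s * a + t * a') * (s * b + t * b') = (s * p + t * p')\<^sup>2 \<Longrightarrow>
      4 * (s * a + t * a') * (s * 0 + t * c') = (s * 0 + t * q')\<^sup>2 \<Longrightarrow>
      4 * (s * b + t * b') * (s * 0 + t * c') = (s * 0 + t * r')\<^sup>2 \<Longrightarrow> s = 0 \<and> t = 0"
    for a b p a' b' c' p' q' r'
    by (rule antisym[OF dd_full_one_tuple3_le_two dd_full_one_tuple3_ge_two[OF that]])
  show "dd 3 2 form_c3 3 1 = 2" "dd 3 2 form_c4_1 3 1 = 2" "dd 3 2 form_c4_2 3 1 = 2"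
    "dd 3 2 form_c4_3 3 1 = 2" "dd 3 2 form_c5_1 3 1 = 2" "dd 3 2 form_c5_2 3 1 = 2"
    unfolding forms3_tuple3 by (rule eq_two; auto)+
  show "dd 3 2 form_c5_3 3 1 = 2" unfolding forms3_tuple3
  proof (rule eq_two)
    fix s t :: real assume "4 * (s * 1 + t * 0) * (s * - 1 + t * 0) = (s * 0 + t * 1)\<^sup>2"
    then have "(2 * s)\<^sup>2 + t\<^sup>2 = 0" by (simp add: power2_eq_square algebra_simps)
    then show "s = 0 \<and> t = 0" unfolding sum_power2_eq_zero_iff by simp
  qed
qed

lemma dd_two_forms_0: "dd 3 2 form_c3 2 2 = 0"
  unfolding forms3_tuple3 dd_two_zero_tuple3_iff
  by (rule exI[of _ 0], rule exI[of _ 1], rule exI[of _ 0], rule exI[of _ 0], rule exI[of _ 0], rule exI[of _ 1])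
    (simp add: q3_def)

lemma dd_two_forms_le_1:
  "dd 3 2 form_c1_1 2 2 \<le> 1" "dd 3 2 form_c1_2 2 2 \<le> 1" "dd 3 2 form_c4_1 2 2 \<le> 1"
  "dd 3 2 form_c4_2 2 2 \<le> 1" "dd 3 2 form_c4_3 2 2 \<le> 1"
proof -
  show "dd 3 2 form_c1_1 2 2 \<le> 1"
    unfolding forms3_tuple3 dd_two_le_one_tuple3_iff
    by (rule exI[of _ 0], rule exI[of _ 1], rule exI[of _ 0], rule exI[of _ 0], rule exI[of _ 0], rule exI[of _ 1])
      (simp add: q3_def)
  show "dd 3 2 form_c1_2 2 2 \<le> 1"
    unfolding forms3_tuple3 dd_two_le_one_tuple3_iff
    by (rule exI[of _ 1], rule exI[of _ 0], rule exI[of _ 0], rule exI[of _ 0], rule exI[of _ 0], rule exI[of _ 1])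
      (simp add: q3_def)
  show "dd 3 2 form_c4_1 2 2 \<le> 1"
    unfolding forms3_tuple3 dd_two_le_one_tuple3_iff
    by (rule exI[of _ 0], rule exI[of _ 1], rule exI[of _ 0], rule exI[of _ 0], rule exI[of _ 0], rule exI[of _ 1])
      (simp add: q3_def)
  show "dd 3 2 form_c4_2 2 2 \<le> 1"
    unfolding forms3_tuple3 dd_two_le_one_tuple3_iff
    by (rule exI[of _ 0], rule exI[of _ 0], rule exI[of _ 1], rule exI[of _ 0], rule exI[of _ 1], rule exI[of _ 0])
      (simp add: q3_def)
  show "dd 3 2 form_c4_3 2 2 \<le> 1"
    unfolding forms3_tuple3 dd_two_le_one_tuple3_iff
    by (rule exI[of _ 0], rule exI[of _ 0], rule exI[of _ 1], rule exI[of _ 0], rule exI[of _ 1], rule exI[of _ 0])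
      (simp add: q3_def)
qed

lemma dd_two_tuple3_pos:
  fixes a b c p q r a' b' c' p' q' r' :: real
  defines "f \<equiv> q3 a b c p q r" and "g \<equiv> q3 a' b' c' p' q' r'"
  assumes par: "\<And>u1 u2 u3 w1 w2 w3. f u1 u2 u3 = 0 \<Longrightarrow> g u1 u2 u3 = 0 \<Longrightarrow> f w1 w2 w3 = 0 \<Longrightarrow> g w1 w2 w3 = 0 \<Longrightarrow>
      f (u1 + w1) (u2 + w2) (u3 + w3) = 0 \<Longrightarrow> g (u1 + w1) (u2 + w2) (u3 + w3) = 0 \<Longrightarrow>
      u2 * w3 = u3 * w2 \<and> u3 * w1 = u1 * w3 \<and> u1 * w2 = u2 * w1"
  shows "dd 3 2 (tuple3 f g) 2 2 \<noteq> 0"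
proof
  assume "dd 3 2 (tuple3 f g) 2 2 = 0"
  then obtain u1 u2 u3 w1 w2 w3 where ind: "u2 * w3 \<noteq> u3 * w2 \<or> u3 * w1 \<noteq> u1 * w3 \<or> u1 * w2 \<noteq> u2 * w1"
    and z: "\<And>s t. f (s * u1 + t * w1) (s * u2 + t * w2) (s * u3 + t * w3) = 0 \<and>
      g (s * u1 + t * w1) (s * u2 + t * w2) (s * u3 + t * w3) = 0"
    unfolding f_def g_def dd_two_zero_tuple3_iff by blast
  show False using par[of u1 u2 u3 w1 w2 w3] z[of 1 0] z[of 0 1] z[of 1 1] ind by simp
qed

text \<open>In each case the zeros \<open>u\<close>, \<open>w\<close> and \<open>u + w\<close> of both forms force \<open>u\<close> and \<open>w\<close> to be parallel: the
  base locus of the pencil contains no line.\<close>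

lemma dd_two_forms_pos:
  "dd 3 2 form_c1_1 2 2 \<noteq> 0" "dd 3 2 form_c1_2 2 2 \<noteq> 0" "dd 3 2 form_c4_1 2 2 \<noteq> 0"
  "dd 3 2 form_c4_2 2 2 \<noteq> 0" "dd 3 2 form_c4_3 2 2 \<noteq> 0"
  unfolding forms3_tuple3
  by (rule dd_two_tuple3_pos; auto simp: q3_def sum_power2_eq_zero_iff power2_eq_iff)+

text \<open>The common zeros of \<open>form_c5_3\<close>: the line \<open>x = y\<close> of the projective plane contains only complex ones.\<close>

lemma form_c5_3_zero:
  fixes x y z :: real
  assumes "x\<^sup>2 = y\<^sup>2" "z\<^sup>2 + x * y = 0"
  shows "y = - x \<and> (z = x \<or> z = - x)"
proof -
  have "y = - x"
  proof (rule ccontr)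
    assume "y \<noteq> - x"
    then have "y = x" using assms(1) by (auto simp: power2_eq_iff)
    then have "z\<^sup>2 + x\<^sup>2 = 0" using assms(2) by (simp add: power2_eq_square)
    then show False using \<open>y = x\<close> \<open>y \<noteq> - x\<close> by (simp add: sum_power2_eq_zero_iff)
  qed
  then show ?thesis using assms(2) by (simp add: power2_eq_square square_eq_iff)
qed

lemma dd_two_tuple3_eq_two:
  fixes a b c p q r a' b' c' p' q' r' :: real
  defines "f \<equiv> q3 a b c p q r" and "g \<equiv> q3 a' b' c' p' q' r'"
  assumes par: "\<And>u1 u2 u3 w1 w2 w3. f w1 w2 w3 = 0 \<Longrightarrow> g w1 w2 w3 = 0 \<Longrightarrow>
      f (u1 + w1) (u2 + w2) (u3 + w3) = f u1 u2 u3 \<Longrightarrow> g (u1 + w1) (u2 + w2) (u3 + w3) = g u1 u2 u3 \<Longrightarrow>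
      u2 * w3 = u3 * w2 \<and> u3 * w1 = u1 * w3 \<and> u1 * w2 = u2 * w1"
  shows "dd 3 2 (tuple3 f g) 2 2 = 2"
proof -
  have "\<not> dd 3 2 (tuple3 f g) 2 2 \<le> 1"
  proof
    assume "dd 3 2 (tuple3 f g) 2 2 \<le> 1"
    then obtain u1 u2 u3 w1 w2 w3 where ind: "u2 * w3 \<noteq> u3 * w2 \<or> u3 * w1 \<noteq> u1 * w3 \<or> u1 * w2 \<noteq> u2 * w1"
      and z: "\<And>s t. f (s * u1 + t * w1) (s * u2 + t * w2) (s * u3 + t * w3) = s\<^sup>2 * f u1 u2 u3 \<and>
        g (s * u1 + t * w1) (s * u2 + t * w2) (s * u3 + t * w3) = s\<^sup>2 * g u1 u2 u3"
      unfolding f_def g_def dd_two_le_one_tuple3_iff by blast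
    show False using par[of w1 w2 w3 u1 u2 u3] z[of 0 1] z[of 1 1] ind by simp
  qed
  moreover have "dd 3 2 (tuple3 f g) 2 2 \<le> 2"
    unfolding f_def g_def by (rule dd_two_le_two[OF quadratic_tuple_tuple3]) simp
  ultimately show ?thesis by linarith
qed

text \<open>On a plane where both forms are multiples of the square of a linear form, a vector \<open>w\<close> in the kernel of
  that linear form is a common zero, and it is orthogonal to the plane for both polar forms. For the first
  two pencils there is no nonzero common zero. For the other two the gradients of the two forms are
  linearly independent at each nonzero common zero, which forces every such \<open>u\<close> to be a multiple of \<open>w\<close>.\<close>

lemma dd_two_forms_2:
  "dd 3 2 form_c2 2 2 = 2" "dd 3 2 form_c5_1 2 2 = 2" "dd 3 2 form_c5_2 2 2 = 2" "dd 3 2 form_c5_3 2 2 = 2"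
proof -
  show "dd 3 2 form_c2 2 2 = 2" "dd 3 2 form_c5_1 2 2 = 2"
    unfolding forms3_tuple3 by (rule dd_two_tuple3_eq_two; auto simp: q3_def sum_power2_eq_zero_iff)+
  show "dd 3 2 form_c5_2 2 2 = 2" unfolding forms3_tuple3
  proof (rule dd_two_tuple3_eq_two)
    fix u1 u2 u3 w1 w2 w3 :: real
    assume "q3 1 (-1) 0 0 0 0 w1 w2 w3 = 0" "q3 0 1 (-1) 0 0 0 w1 w2 w3 = 0"
    then have w: "w1\<^sup>2 = w2\<^sup>2" "w2\<^sup>2 = w3\<^sup>2" by (simp_all add: q3_def)
    assume "q3 1 (-1) 0 0 0 0 (u1 + w1) (u2 + w2) (u3 + w3) = q3 1 (-1) 0 0 0 0 u1 u2 u3"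
      "q3 0 1 (-1) 0 0 0 (u1 + w1) (u2 + w2) (u3 + w3) = q3 0 1 (-1) 0 0 0 u1 u2 u3"
    with w have u: "u1 * w1 = u2 * w2" "u2 * w2 = u3 * w3"
      by (simp_all add: q3_def power2_eq_square algebra_simps)
    have "w2 = w1 \<or> w2 = - w1" "w3 = w1 \<or> w3 = - w1" using w by (auto simp: power2_eq_iff)
    then show "u2 * w3 = u3 * w2 \<and> u3 * w1 = u1 * w3 \<and> u1 * w2 = u2 * w1" using u by auto
  qed
  show "dd 3 2 form_c5_3 2 2 = 2" unfolding forms3_tuple3
  proof (rule dd_two_tuple3_eq_two)
    fix u1 u2 u3 w1 w2 w3 :: real
    assume "q3 1 (-1) 0 0 0 0 w1 w2 w3 = 0" "q3 0 0 1 1 0 0 w1 w2 w3 = 0"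
    then have w: "w1\<^sup>2 = w2\<^sup>2" "w3\<^sup>2 + w1 * w2 = 0" by (simp_all add: q3_def)
    assume "q3 1 (-1) 0 0 0 0 (u1 + w1) (u2 + w2) (u3 + w3) = q3 1 (-1) 0 0 0 0 u1 u2 u3"
      "q3 0 0 1 1 0 0 (u1 + w1) (u2 + w2) (u3 + w3) = q3 0 0 1 1 0 0 u1 u2 u3"
    with w have u: "u1 * w1 = u2 * w2" "2 * u3 * w3 + u1 * w2 + u2 * w1 = 0"
      by (simp_all add: q3_def power2_eq_square algebra_simps)
    have "w2 = - w1 \<and> (w3 = w1 \<or> w3 = - w1)" using form_c5_3_zero[OF w] .
    then show "u2 * w3 = u3 * w2 \<and> u3 * w1 = u1 * w3 \<and> u1 * w2 = u2 * w1"
      using u by (auto simp: algebra_simps)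
  qed
qed

lemma dd_two_forms_1:
  "dd 3 2 form_c1_1 2 2 = 1" "dd 3 2 form_c1_2 2 2 = 1" "dd 3 2 form_c4_1 2 2 = 1"
  "dd 3 2 form_c4_2 2 2 = 1" "dd 3 2 form_c4_3 2 2 = 1"
  using dd_two_forms_le_1 dd_two_forms_pos by linarith+

lemma tuple2_at: "tuple2 f g (vec_of_list [x, y]) = vec_of_list [f x y, g x y]"
  by (simp add: tuple2_def vec_of_list_2)

lemma dd_full_one_tuple2_pos:
  assumes imp: "\<And>s t. (\<And>x y. s * q2 a b c x y + t * q2 a' b' c' x y = 0) \<Longrightarrow> s = 0 \<and> t = 0"
  shows "dd 2 2 (tuple2 (q2 a b c) (q2 a' b' c')) 2 1 > 0"
  unfolding dd_pos_iff[OF quadratic_tuple_tuple2 one_le_numeral]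
proof (intro ballI impI, rule ccontr)
  let ?Q = "tuple2 (q2 a b c) (q2 a' b' c')"
  fix v :: "real vec" assume v: "v \<in> carrier_vec 2" "v \<noteq> 0\<^sub>v 2"
  assume zero: "\<not> (\<exists>\<xi> \<in> carrier_vec 2. combination 2 v ?Q \<xi> \<noteq> 0)"
  obtain s t where st: "v = vec_of_list [s, t]" by (rule carrier_vec_2E[OF v(1)])
  have "s * q2 a b c x y + t * q2 a' b' c' x y = 0" for x y
  proof -
    have "combination 2 v ?Q (vec_of_list [x, y]) = 0" using zero vec_of_list_2(1)[of x y] by blast
    then show ?thesis by (simp add: st combination_2 tuple2_at vec_of_list_2)
  qed
  then have "s = 0 \<and> t = 0" by (rule imp)
  then show False using v(2) by (simp add: st vec_of_list_2_eq_0_iff)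
qed

lemma dd_full_one_tuple2_ge_two:
  assumes imp: "\<And>s t. 4 * (s * a + t * a') * (s * b + t * b') = (s * c + t * c')\<^sup>2 \<Longrightarrow> s = 0 \<and> t = 0"
  shows "dd 2 2 (tuple2 (q2 a b c) (q2 a' b' c')) 2 1 \<ge> 2"
proof (rule ccontr)
  let ?Q = "tuple2 (q2 a b c) (q2 a' b' c')"
  assume "\<not> dd 2 2 ?Q 2 1 \<ge> 2"
  then have "dd 2 2 ?Q 2 1 \<le> 1" by simp
  then obtain v l \<kappa> where v: "v \<in> carrier_vec 2" "v \<noteq> 0\<^sub>v 2" and l: "l \<in> carrier_vec 2"
    and sq: "\<And>\<xi>. \<xi> \<in> carrier_vec 2 \<Longrightarrow> combination 2 v ?Q \<xi> = \<kappa> * (l \<bullet> \<xi>)\<^sup>2"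
    using dd_full_one_imp_square[OF quadratic_tuple_tuple2, of a b c a' b' c'] by auto
  obtain s t where st: "v = vec_of_list [s, t]" by (rule carrier_vec_2E[OF v(1)])
  obtain l1 l2 where ls: "l = vec_of_list [l1, l2]" by (rule carrier_vec_2E[OF l])
  have "l \<bullet> vec_of_list [x, y] = l1 * x + l2 * y" for x y
    by (simp add: ls scalar_prod_def vec_of_list_index numeral_2_eq_2 atLeast0_lessThan_Suc)
  then have eq: "s * q2 a b c x y + t * q2 a' b' c' x y = \<kappa> * (l1 * x + l2 * y)\<^sup>2" for x y
    using sq[of "vec_of_list [x, y]"] by (simp add: st combination_2 tuple2_at vec_of_list_2)
  have diag: "s * a + t * a' = \<kappa> * l1\<^sup>2" "s * b + t * b' = \<kappa> * l2\<^sup>2"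
    using eq[of 1 0] eq[of 0 1] by (simp_all add: q2_def)
  have cross: "s * c + t * c' = 2 * \<kappa> * l1 * l2"
    using eq[of 1 1] diag by (simp add: q2_def power2_eq_square algebra_simps)
  have "s = 0 \<and> t = 0" by (rule imp) (simp add: diag cross power2_eq_square)
  then show False using v(2) by (simp add: st vec_of_list_2_eq_0_iff)
qed

lemma dd_forms2:
  "dd 2 2 form_a1 2 1 = 1" "dd 2 2 form_a2 2 1 = 1" "dd 2 2 form_a3 2 1 = 2"
  "dd 2 2 form_a1 1 2 = 0" "dd 2 2 form_a2 1 2 = 1"
proof -
  have le1: "dd 2 2 (tuple2 (q2 1 0 0) (q2 a b c)) 2 1 \<le> 1" for a b c
    using dd_full_one_le[OF quadratic_tuple_tuple2, of 0 "{0}" 1 0 0 a b c]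
    by (auto simp: tuple2_def q2_def vec_of_list_2)
  have "dd 2 2 form_a1 2 1 > 0" unfolding forms2_tuple2
  proof (rule dd_full_one_tuple2_pos)
    fix s t assume "\<And>x y. s * q2 1 0 0 x y + t * q2 0 0 1 x y = 0"
    from this[of 1 0] this[of 1 1] show "s = 0 \<and> t = 0" by (simp add: q2_def)
  qed
  then show "dd 2 2 form_a1 2 1 = 1" using le1[of 0 0 1] unfolding forms2_tuple2 by linarith
  have "dd 2 2 form_a2 2 1 > 0" unfolding forms2_tuple2
  proof (rule dd_full_one_tuple2_pos)
    fix s t assume "\<And>x y. s * q2 1 0 0 x y + t * q2 0 1 0 x y = 0"
    from this[of 1 0] this[of 0 1] show "s = 0 \<and> t = 0" by (simp add: q2_def)
  qed
  then show "dd 2 2 form_a2 2 1 = 1" using le1[of 0 1 0] unfolding forms2_tuple2 by linarith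
  have "dd 2 2 form_a3 2 1 \<ge> 2" unfolding forms2_tuple2
  proof (rule dd_full_one_tuple2_ge_two)
    fix s t :: real assume "4 * (s * 0 + t * 1) * (s * 0 + t * - 1) = (s * 1 + t * 0)\<^sup>2"
    then have "s\<^sup>2 + (2 * t)\<^sup>2 = 0" by (simp add: power2_eq_square algebra_simps)
    then show "s = 0 \<and> t = 0" unfolding sum_power2_eq_zero_iff by simp
  qed
  moreover have "dd 2 2 form_a3 2 1 \<le> 2" unfolding forms2_tuple2
    using dd_full_one_le[OF quadratic_tuple_tuple2, of 0 "{0, 1}" 0 0 1 1 "-1" 0]
    by (auto simp: less_2_cases_iff)
  ultimately show "dd 2 2 form_a3 2 1 = 2" by linarith
  have zero: "tuple2 (q2 1 0 0) (q2 0 0 1) (vec_of_list [0, 1]) = 0\<^sub>v 2" "vec_of_list [0, 1 :: real] \<noteq> 0\<^sub>v 2"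
    by (simp_all add: tuple2_at q2_def vec_of_list_2_eq_0_iff)
  show "dd 2 2 form_a1 1 2 = 0"
    unfolding forms2_tuple2 dd_one_zero_iff[OF quadratic_tuple_tuple2 one_le_numeral]
    by (rule bexI[of _ "vec_of_list [0, 1]"], rule conjI[OF zero(2,1)], rule vec_of_list_2(1))
  have "dd 2 2 form_a2 1 2 \<noteq> 0"
  proof
    assume "dd 2 2 form_a2 1 2 = 0"
    then obtain u where u: "u \<in> carrier_vec 2" "u \<noteq> 0\<^sub>v 2" "form_a2 u = 0\<^sub>v 2"
      unfolding forms2_tuple2 dd_one_zero_iff[OF quadratic_tuple_tuple2 one_le_numeral] by blast
    obtain x y where "u = vec_of_list [x, y]" by (rule carrier_vec_2E[OF u(1)])
    then show False using u(2,3)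
      by (simp add: forms2_tuple2 tuple2_at q2_def vec_of_list_2_eq_0_iff)
  qed
  moreover have "dd 2 2 form_a2 1 2 \<le> 1"
    unfolding forms2_tuple2 by (rule dd_one_le_one[OF quadratic_tuple_tuple2]) simp
  ultimately show "dd 2 2 form_a2 1 2 = 1" by linarith
qed

text \<open>At least \<open>k\<close> points of the projective space are common real zeros. Each point is given by a
  representative, and representatives of different points are independent.\<close>

definition has_zero_lines :: "nat \<Rightarrow> nat \<Rightarrow> (real vec \<Rightarrow> real vec) \<Rightarrow> nat \<Rightarrow> bool" where
  "has_zero_lines d n Q k \<longleftrightarrow> (\<exists>v. \<forall>i<k. v i \<in> carrier_vec d \<and> Q (v i) = 0\<^sub>v n \<and>
     (\<forall>j<i. independent_pair d (v i) (v j)))"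

lemma independent_pair_mult:
  fixes M :: "real mat"
  assumes "independent_pair d u w" and M: "M \<in> carrier_mat d d" "invertible_mat M"
  shows "independent_pair d (M *\<^sub>v u) (M *\<^sub>v w)"
proof -
  have car: "u \<in> carrier_vec d" "w \<in> carrier_vec d" using assms by (auto simp: independent_pair_def)
  show ?thesis unfolding independent_pair_def
  proof (intro conjI allI impI)
    fix a b :: real assume "a \<cdot>\<^sub>v (M *\<^sub>v u) + b \<cdot>\<^sub>v (M *\<^sub>v w) = 0\<^sub>v d"
    then have "M *\<^sub>v (a \<cdot>\<^sub>v u + b \<cdot>\<^sub>v w) = 0\<^sub>v d"
      using M(1) car by (simp add: mult_add_distrib_mat_vec mult_mat_vec)
    moreover have "a \<cdot>\<^sub>v u + b \<cdot>\<^sub>v w \<in> carrier_vec d" using car by simp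
    ultimately have "a \<cdot>\<^sub>v u + b \<cdot>\<^sub>v w = 0\<^sub>v d"
      using det_0_iff_vec_prod_zero[OF M(1)] M invertible_mat_iff_det[OF M(1)] by blast
    then show "a = 0" "b = 0" using assms(1) by (auto simp: independent_pair_def)
  qed (use M car in auto)
qed

lemma has_zero_lines_if_equivalent:
  assumes eq: "equivalent d n P Q" and P: "P \<in> carrier_vec d \<rightarrow> carrier_vec n" and Q: "has_zero_lines d n Q k"
  shows "has_zero_lines d n P k"
proof -
  obtain N M where 1: "N \<in> carrier_mat n n" "M \<in> carrier_mat d d" "invertible_mat N" "invertible_mat M"
    "\<And>\<xi>. \<xi> \<in> carrier_vec d \<Longrightarrow> Q \<xi> = R N M P \<xi>"
    using eq unfolding equivalent_def by blast
  have zero: "P (M *\<^sub>v \<xi>) = 0\<^sub>v n" if "\<xi> \<in> carrier_vec d" "Q \<xi> = 0\<^sub>v n" for \<xi>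
  proof (rule transpose_mult_inj[OF 1(1)])
    show "vec_space.rank n N = n" using 1 rank_full_iff_invertible by blast
    show "P (M *\<^sub>v \<xi>) \<in> carrier_vec n" using that 1(2) by (intro funcset_mem[OF P]) simp
    have "transpose_mat N *\<^sub>v P (M *\<^sub>v \<xi>) = 0\<^sub>v n" using that 1(5)[OF that(1)] by (simp add: R_def)
    then show "transpose_mat N *\<^sub>v P (M *\<^sub>v \<xi>) = transpose_mat N *\<^sub>v 0\<^sub>v n" using 1(1) by auto
  qed simp
  obtain v where v: "\<And>i. i < k \<Longrightarrow> v i \<in> carrier_vec d \<and> Q (v i) = 0\<^sub>v n \<and> (\<forall>j<i. independent_pair d (v i) (v j))"
    using Q unfolding has_zero_lines_def by blast
  have "M *\<^sub>v v i \<in> carrier_vec d \<and> P (M *\<^sub>v v i) = 0\<^sub>v n \<and>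
      (\<forall>j<i. independent_pair d (M *\<^sub>v v i) (M *\<^sub>v v j))" if "i < k" for i
    using v[OF that] zero[of "v i"] 1(2) independent_pair_mult[OF _ 1(2,4)] by auto
  then show ?thesis unfolding has_zero_lines_def by (intro exI[of _ "\<lambda>i. M *\<^sub>v v i"]) blast
qed

lemma has_zero_lines_equivalent:
  assumes "equivalent d n P Q" "P \<in> carrier_vec d \<rightarrow> carrier_vec n"
  shows "has_zero_lines d n P k = has_zero_lines d n Q k"
  using has_zero_lines_if_equivalent[OF assms]
    has_zero_lines_if_equivalent[OF equivalent_sym[OF assms] equivalent_carrier[OF assms]] by blast

lemma has_two_zero_lines_tuple3_iff:
  "has_zero_lines 3 2 (tuple3 f g) 2 \<longleftrightarrow>
    (\<exists>u1 u2 u3 w1 w2 w3. (u2 * w3 \<noteq> u3 * w2 \<or> u3 * w1 \<noteq> u1 * w3 \<or> u1 * w2 \<noteq> u2 * w1) \<and>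
      f u1 u2 u3 = 0 \<and> g u1 u2 u3 = 0 \<and> f w1 w2 w3 = 0 \<and> g w1 w2 w3 = 0)"
proof -
  have "has_zero_lines 3 2 (tuple3 f g) 2 \<longleftrightarrow>
    (\<exists>u w. independent_pair 3 u w \<and> tuple3 f g u = 0\<^sub>v 2 \<and> tuple3 f g w = 0\<^sub>v 2)"
  proof
    assume "has_zero_lines 3 2 (tuple3 f g) 2"
    then obtain v where "\<And>i :: nat. i < 2 \<Longrightarrow> v i \<in> carrier_vec 3 \<and> tuple3 f g (v i) = 0\<^sub>v 2 \<and>
      (\<forall>j<i. independent_pair 3 (v i) (v j))" unfolding has_zero_lines_def by blast
    from this[of 0] this[of 1]
    show "\<exists>u w. independent_pair 3 u w \<and> tuple3 f g u = 0\<^sub>v 2 \<and> tuple3 f g w = 0\<^sub>v 2" by auto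
  next
    assume "\<exists>u w. independent_pair 3 u w \<and> tuple3 f g u = 0\<^sub>v 2 \<and> tuple3 f g w = 0\<^sub>v 2"
    then obtain u w where "independent_pair 3 u w" "tuple3 f g u = 0\<^sub>v 2" "tuple3 f g w = 0\<^sub>v 2" by blast
    then show "has_zero_lines 3 2 (tuple3 f g) 2" unfolding has_zero_lines_def
      by (intro exI[of _ "\<lambda>i. if i = 0 then w else u"]) (auto simp: less_2_cases_iff independent_pair_def)
  qed
  then show ?thesis unfolding ex_independent_pair_3 tuple3_at vec_of_list_2_eq_0_iff by blast
qed

lemma has_three_zero_linesE:
  assumes "has_zero_lines 3 2 (tuple3 f g) 3"
  obtains u1 u2 u3 v1 v2 v3 w1 w2 w3 where
    "f u1 u2 u3 = 0" "g u1 u2 u3 = 0" "f v1 v2 v3 = 0" "g v1 v2 v3 = 0" "f w1 w2 w3 = 0" "g w1 w2 w3 = 0"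
    "u2 * w3 \<noteq> u3 * w2 \<or> u3 * w1 \<noteq> u1 * w3 \<or> u1 * w2 \<noteq> u2 * w1"
    "u2 * v3 \<noteq> u3 * v2 \<or> u3 * v1 \<noteq> u1 * v3 \<or> u1 * v2 \<noteq> u2 * v1"
    "v2 * w3 \<noteq> v3 * w2 \<or> v3 * w1 \<noteq> v1 * w3 \<or> v1 * w2 \<noteq> v2 * w1"
proof -
  obtain z where z: "\<And>i :: nat. i < 3 \<Longrightarrow> z i \<in> carrier_vec 3 \<and> tuple3 f g (z i) = 0\<^sub>v 2 \<and>
      (\<forall>j<i. independent_pair 3 (z i) (z j))" using assms unfolding has_zero_lines_def by blast
  have "z 0 \<in> carrier_vec 3" "z 1 \<in> carrier_vec 3" "z 2 \<in> carrier_vec 3" using z by simp_all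
  then obtain u1 u2 u3 v1 v2 v3 w1 w2 w3 where
    vs: "z 2 = vec_of_list [u1, u2, u3]" "z 1 = vec_of_list [v1, v2, v3]" "z 0 = vec_of_list [w1, w2, w3]"
    by (metis carrier_vec_3E)
  have "tuple3 f g (z 2) = 0\<^sub>v 2" "tuple3 f g (z 1) = 0\<^sub>v 2" "tuple3 f g (z 0) = 0\<^sub>v 2"
    "independent_pair 3 (z 2) (z 0)" "independent_pair 3 (z 2) (z 1)" "independent_pair 3 (z 1) (z 0)"
    using z[of 0] z[of 1] z[of 2] by simp_all
  then show thesis unfolding vs independent_pair_3_iff tuple3_at vec_of_list_2_eq_0_iff using that by blast
qed

lemma has_three_zero_linesI:
  assumes "f u1 u2 u3 = 0" "g u1 u2 u3 = 0" "f v1 v2 v3 = 0" "g v1 v2 v3 = 0" "f w1 w2 w3 = 0" "g w1 w2 w3 = 0"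
    "u2 * w3 \<noteq> u3 * w2 \<or> u3 * w1 \<noteq> u1 * w3 \<or> u1 * w2 \<noteq> u2 * w1"
    "u2 * v3 \<noteq> u3 * v2 \<or> u3 * v1 \<noteq> u1 * v3 \<or> u1 * v2 \<noteq> u2 * v1"
    "v2 * w3 \<noteq> v3 * w2 \<or> v3 * w1 \<noteq> v1 * w3 \<or> v1 * w2 \<noteq> v2 * w1"
  shows "has_zero_lines 3 2 (tuple3 f g) 3"
proof -
  let ?z = "\<lambda>i :: nat. if i = 0 then vec_of_list [w1, w2, w3]
    else if i = 1 then vec_of_list [v1, v2, v3] else vec_of_list [u1, u2, u3]"
  have zero: "tuple3 f g (vec_of_list [u1, u2, u3]) = 0\<^sub>v 2" "tuple3 f g (vec_of_list [v1, v2, v3]) = 0\<^sub>v 2"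
    "tuple3 f g (vec_of_list [w1, w2, w3]) = 0\<^sub>v 2"
    using assms(1-6) by (simp_all add: tuple3_at vec_of_list_2_eq_0_iff)
  note ind = assms(7-9)[folded independent_pair_3_iff]
  have "?z i \<in> carrier_vec 3 \<and> tuple3 f g (?z i) = 0\<^sub>v 2 \<and> (\<forall>j<i. independent_pair 3 (?z i) (?z j))"
    if "i < 3" for i
  proof -
    consider "i = 0" | "i = 1" | "i = 2" using \<open>i < 3\<close> by linarith
    then show ?thesis
    proof cases
      case 1
      then show ?thesis using zero by (simp add: vec_of_list_3(1))
    next
      case 2
      then show ?thesis using zero ind by (simp add: vec_of_list_3(1))
    next
      case 3
      then show ?thesis using zero ind by (simp add: vec_of_list_3(1) less_2_cases_iff)
    qed
  qed
  then show ?thesis unfolding has_zero_lines_def by (intro exI[of _ ?z]) blast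
qed

lemma three_zero_lines_forms:
  "\<not> has_zero_lines 3 2 form_c4_1 3" "has_zero_lines 3 2 form_c4_3 3"
  "has_zero_lines 3 2 form_c5_2 3" "\<not> has_zero_lines 3 2 form_c5_3 3"
proof -
  show "has_zero_lines 3 2 form_c4_3 3" unfolding forms3_tuple3
    by (rule has_three_zero_linesI[of _ 1 0 1 _ 1 0 "-1" 0 1 0]) (simp_all add: q3_def)
  show "has_zero_lines 3 2 form_c5_2 3" unfolding forms3_tuple3
    by (rule has_three_zero_linesI[of _ 1 1 1 _ 1 1 "-1" 1 "-1" 1]) (simp_all add: q3_def)
  show "\<not> has_zero_lines 3 2 form_c4_1 3"
  proof
    assume "has_zero_lines 3 2 form_c4_1 3"
    then show False unfolding forms3_tuple3 by (rule has_three_zero_linesE) (auto simp: q3_def)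
  qed
  show "\<not> has_zero_lines 3 2 form_c5_3 3"
  proof
    assume "has_zero_lines 3 2 form_c5_3 3"
    then obtain u1 u2 u3 v1 v2 v3 w1 w2 w3 :: real where
      "u1\<^sup>2 = u2\<^sup>2" "u3\<^sup>2 + u1 * u2 = 0" "v1\<^sup>2 = v2\<^sup>2" "v3\<^sup>2 + v1 * v2 = 0" "w1\<^sup>2 = w2\<^sup>2" "w3\<^sup>2 + w1 * w2 = 0"
      and ind: "u2 * w3 \<noteq> u3 * w2 \<or> u3 * w1 \<noteq> u1 * w3 \<or> u1 * w2 \<noteq> u2 * w1"
      "u2 * v3 \<noteq> u3 * v2 \<or> u3 * v1 \<noteq> u1 * v3 \<or> u1 * v2 \<noteq> u2 * v1"
      "v2 * w3 \<noteq> v3 * w2 \<or> v3 * w1 \<noteq> v1 * w3 \<or> v1 * w2 \<noteq> v2 * w1"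
      unfolding forms3_tuple3 by (rule has_three_zero_linesE) (simp add: q3_def)
    then have "u2 = - u1 \<and> (u3 = u1 \<or> u3 = - u1)" "v2 = - v1 \<and> (v3 = v1 \<or> v3 = - v1)"
      "w2 = - w1 \<and> (w3 = w1 \<or> w3 = - w1)" using form_c5_3_zero by blast+
    then show False using ind by auto
  qed
qed

lemma has_zero_lines_mono: "has_zero_lines d n Q k \<Longrightarrow> m \<le> k \<Longrightarrow> has_zero_lines d n Q m"
  unfolding has_zero_lines_def using less_le_trans by blast

lemma two_zero_lines_forms:
  "\<not> has_zero_lines 3 2 form_c1_1 2" "has_zero_lines 3 2 form_c1_2 2"
  "has_zero_lines 3 2 form_c4_1 2" "\<not> has_zero_lines 3 2 form_c4_2 2" "has_zero_lines 3 2 form_c4_3 2"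
  "\<not> has_zero_lines 3 2 form_c5_1 2" "has_zero_lines 3 2 form_c5_2 2" "has_zero_lines 3 2 form_c5_3 2"
proof -
  show "\<not> has_zero_lines 3 2 form_c1_1 2" "\<not> has_zero_lines 3 2 form_c4_2 2" "\<not> has_zero_lines 3 2 form_c5_1 2"
    unfolding forms3_tuple3 has_two_zero_lines_tuple3_iff
    by (auto simp: q3_def sum_power2_eq_zero_iff)
  show "has_zero_lines 3 2 form_c4_3 2" "has_zero_lines 3 2 form_c5_2 2"
    using three_zero_lines_forms(2,3) by (auto intro: has_zero_lines_mono)
  show "has_zero_lines 3 2 form_c1_2 2"
    unfolding forms3_tuple3 has_two_zero_lines_tuple3_iff
    by (rule exI[of _ 0], rule exI[of _ 1], rule exI[of _ 0], rule exI[of _ 0], rule exI[of _ 0], rule exI[of _ 1])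
      (simp add: q3_def)
  show "has_zero_lines 3 2 form_c4_1 2"
    unfolding forms3_tuple3 has_two_zero_lines_tuple3_iff
    by (rule exI[of _ 1], rule exI[of _ 0], rule exI[of _ 0], rule exI[of _ 0], rule exI[of _ 0], rule exI[of _ 1])
      (simp add: q3_def)
  show "has_zero_lines 3 2 form_c5_3 2"
    unfolding forms3_tuple3 has_two_zero_lines_tuple3_iff
    by (rule exI[of _ 1], rule exI[of _ "-1"], rule exI[of _ 1], rule exI[of _ 1], rule exI[of _ "-1"], rule exI[of _ "-1"])
      (simp add: q3_def)
qed

lemma forms3_carrier: "F \<in> set forms3 \<Longrightarrow> F \<in> carrier_vec 3 \<rightarrow> carrier_vec 2"
  by (auto simp: forms3_def forms3_tuple3 intro: funcset_mem[OF tuple3_carrier])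

lemma pairwise_inequivalent_if_distinct_invariant:
  assumes "\<And>P Q. P \<in> set Fs \<Longrightarrow> equivalent d n P Q \<Longrightarrow> J P = J Q" and "distinct (map J Fs)"
  shows "pairwise_inequivalent d n Fs"
  unfolding pairwise_inequivalent_def
proof (intro allI impI notI)
  fix i j assume ij: "i < length Fs" "j < length Fs" "i \<noteq> j" and eq: "equivalent d n (Fs ! i) (Fs ! j)"
  have "J (Fs ! i) = J (Fs ! j)" using assms(1)[OF nth_mem[OF ij(1)] eq] .
  then show False using assms(2) ij by (auto simp: distinct_conv_nth)
qed

text \<open>The values of \<open>dd\<close> separate the cases, and the number of common zeros the forms within a case.\<close>

lemma pairwise_inequivalent_forms3: "pairwise_inequivalent 3 2 forms3"
proof (rule pairwise_inequivalent_if_distinct_invariant[where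
      J = "\<lambda>Q. (dd 3 2 Q 3 1, dd 3 2 Q 2 2, has_zero_lines 3 2 Q 2, has_zero_lines 3 2 Q 3)"])
  show "distinct (map (\<lambda>Q. (dd 3 2 Q 3 1, dd 3 2 Q 2 2, has_zero_lines 3 2 Q 2, has_zero_lines 3 2 Q 3)) forms3)"
    unfolding forms3_def list.map dd_full_one_square_forms dd_full_one_other_forms
      dd_two_forms_0 dd_two_forms_1 dd_two_forms_2
    by (simp add: two_zero_lines_forms three_zero_lines_forms)
next
  fix P Q assume P: "P \<in> set forms3" and eq: "equivalent 3 2 P Q"
  note * = eq forms3_carrier[OF P]
  have "dd 3 2 P 2 2 = dd 3 2 Q 2 2" by (rule dd_two_equivalent[OF *]) simp
  then show "(dd 3 2 P 3 1, dd 3 2 P 2 2, has_zero_lines 3 2 P 2, has_zero_lines 3 2 P 3)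
      = (dd 3 2 Q 3 1, dd 3 2 Q 2 2, has_zero_lines 3 2 Q 2, has_zero_lines 3 2 Q 3)"
    unfolding dd_full_equivalent(2)[OF * one_le_numeral] has_zero_lines_equivalent[OF *] by simp
qed

lemma forms2_carrier: "F \<in> set forms2 \<Longrightarrow> F \<in> carrier_vec 2 \<rightarrow> carrier_vec 2"
  by (auto simp: forms2_def forms2_tuple2 intro: funcset_mem[OF tuple2_carrier])

lemma pairwise_inequivalent_forms2: "pairwise_inequivalent 2 2 forms2"
proof (rule pairwise_inequivalent_if_distinct_invariant[where J = "\<lambda>Q. (dd 2 2 Q 2 1, dd 2 2 Q 1 2)"])
  show "distinct (map (\<lambda>Q. (dd 2 2 Q 2 1, dd 2 2 Q 1 2)) forms2)"
    unfolding forms2_def list.map dd_forms2 by simp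
next
  fix P Q assume P: "P \<in> set forms2" and eq: "equivalent 2 2 P Q"
  note * = eq forms2_carrier[OF P] one_le_numeral
  show "(dd 2 2 P 2 1, dd 2 2 P 1 2) = (dd 2 2 Q 2 1, dd 2 2 Q 1 2)"
    unfolding dd_full_equivalent(2)[OF *] dd_one_equivalent[OF *] ..
qed

section \<open>The classification\<close>

lemma classification_3_2:
  assumes Q: "quadratic_tuple 3 2 Q" and "dd 3 2 Q 3 2 = 3" "dd 3 2 Q 3 1 > 0"
  obtains F where "F \<in> set forms3" "equivalent 3 2 Q F"
    "dd 3 2 Q 3 1 = dd 3 2 F 3 1" "dd 3 2 Q 2 2 = dd 3 2 F 2 2"
proof -
  note car = quadratic_tuple_carrier[OF Q]
  obtain a b c p q r a' b' c' p' q' r'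
    where "\<And>\<xi>. \<xi> \<in> carrier_vec 3 \<Longrightarrow> Q \<xi> = tuple3 (q3 a b c p q r) (q3 a' b' c' p' q' r') \<xi>"
    by (rule quadratic_tuple_3_2E[OF Q]) blast
  then have "equivalent 3 2 Q (tuple3 (q3 a b c p q r) (q3 a' b' c' p' q' r'))"
    by (rule equivalent_cong[OF car])
  from classified_by_equivalent[OF this car _ classified3_all]
  have "classified_by 3 2 forms3 Q" by simp
  then obtain F where F: "F \<in> set forms3" "equivalent 3 2 Q F"
    using assms unfolding classified_by_def nondegenerate_def by blast
  show thesis
    by (rule that[OF F]) (use dd_full_equivalent(2)[OF F(2) car one_le_numeral] dd_two_equivalent[OF F(2) car] in simp_all)
qed

lemma classification_2_2:
  assumes Q: "quadratic_tuple 2 2 Q" and "dd 2 2 Q 2 2 = 2" "dd 2 2 Q 2 1 > 0"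
  obtains F where "F \<in> set forms2" "equivalent 2 2 Q F"
    "dd 2 2 Q 2 1 = dd 2 2 F 2 1" "dd 2 2 Q 1 2 = dd 2 2 F 1 2"
proof -
  note car = quadratic_tuple_carrier[OF Q]
  obtain a b c a' b' c'
    where "\<And>\<xi>. \<xi> \<in> carrier_vec 2 \<Longrightarrow> Q \<xi> = tuple2 (q2 a b c) (q2 a' b' c') \<xi>"
    by (rule quadratic_tuple_2_2E[OF Q]) blast
  then have "equivalent 2 2 Q (tuple2 (q2 a b c) (q2 a' b' c'))"
    by (rule equivalent_cong[OF car])
  from classified_by_equivalent[OF this car _ classified2_all]
  have "classified_by 2 2 forms2 Q" by simp
  then obtain F where F: "F \<in> set forms2" "equivalent 2 2 Q F"
    using assms unfolding classified_by_def nondegenerate_def by blast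
  show thesis
    by (rule that[OF F]) (use dd_full_equivalent(2)[OF F(2) car one_le_numeral] dd_one_equivalent[OF F(2) car one_le_numeral] in simp_all)
qed

lemma normal_forms_3_2:
  assumes "quadratic_tuple 3 2 Q" "dd 3 2 Q 3 2 = 3" "dd 3 2 Q 3 1 > 0"
  shows "(dd 3 2 Q 3 1 = 1 \<and> dd 3 2 Q 2 2 = 1 \<and> (equivalent 3 2 Q form_c1_1 \<or> equivalent 3 2 Q form_c1_2)) \<or>
    (dd 3 2 Q 3 1 = 1 \<and> dd 3 2 Q 2 2 = 2 \<and> equivalent 3 2 Q form_c2) \<or>
    (dd 3 2 Q 3 1 = 2 \<and> dd 3 2 Q 2 2 = 0 \<and> equivalent 3 2 Q form_c3) \<or>
    (dd 3 2 Q 3 1 = 2 \<and> dd 3 2 Q 2 2 = 1 \<and>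
      (equivalent 3 2 Q form_c4_1 \<or> equivalent 3 2 Q form_c4_2 \<or> equivalent 3 2 Q form_c4_3)) \<or>
    (dd 3 2 Q 3 1 = 2 \<and> dd 3 2 Q 2 2 = 2 \<and>
      (equivalent 3 2 Q form_c5_1 \<or> equivalent 3 2 Q form_c5_2 \<or> equivalent 3 2 Q form_c5_3))"
proof -
  obtain F where F: "F \<in> set forms3" "equivalent 3 2 Q F"
    "dd 3 2 Q 3 1 = dd 3 2 F 3 1" "dd 3 2 Q 2 2 = dd 3 2 F 2 2"
    by (rule classification_3_2[OF assms])
  have "F = form_c1_1 \<or> F = form_c1_2 \<or> F = form_c2 \<or> F = form_c3 \<or> F = form_c4_1 \<or>
      F = form_c4_2 \<or> F = form_c4_3 \<or> F = form_c5_1 \<or> F = form_c5_2 \<or> F = form_c5_3"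
    using F(1) by (simp add: forms3_def)
  then show ?thesis using F(2) unfolding F(3,4)
    by (elim disjE) (simp_all del: One_nat_def add: dd_full_one_square_forms dd_full_one_other_forms
        dd_two_forms_0 dd_two_forms_1 dd_two_forms_2)
qed

lemma normal_forms_2_2:
  assumes "quadratic_tuple 2 2 Q" "dd 2 2 Q 2 2 = 2" "dd 2 2 Q 2 1 > 0"
  shows "(dd 2 2 Q 2 1 = 1 \<and> dd 2 2 Q 1 2 = 0 \<and> equivalent 2 2 Q form_a1) \<or>
    (dd 2 2 Q 2 1 = 1 \<and> dd 2 2 Q 1 2 = 1 \<and> equivalent 2 2 Q form_a2) \<or>
    (dd 2 2 Q 2 1 = 2 \<and> equivalent 2 2 Q form_a3)"
proof -
  obtain F where F: "F \<in> set forms2" "equivalent 2 2 Q F"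
    "dd 2 2 Q 2 1 = dd 2 2 F 2 1" "dd 2 2 Q 1 2 = dd 2 2 F 1 2"
    by (rule classification_2_2[OF assms])
  have "F = form_a1 \<or> F = form_a2 \<or> F = form_a3" using F(1) by (simp add: forms2_def)
  then show ?thesis using F(2) unfolding F(3,4)
    by (elim disjE) (simp_all del: One_nat_def add: dd_forms2)
qed

theorem lemma6p5:
  shows "(\<forall>d n Q. 1 \<le> d \<and> 2 \<le> n \<and> d + n \<le> 5 \<and> quadratic_tuple d n Q \<and>
            dd d n Q d n = d \<and> dd d n Q d 1 > 0 \<longrightarrow>
          (d = 2 \<and> n = 2 \<longrightarrow>
             (dd d n Q 2 1 = 1 \<and> dd d n Q 1 2 = 0 \<longrightarrow> equivalent d n Q form_a1) \<and>
             (dd d n Q 2 1 = 1 \<and> dd d n Q 1 2 = 1 \<longrightarrow> equivalent d n Q form_a2) \<and>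
             (dd d n Q 2 1 = 2 \<longrightarrow> equivalent d n Q form_a3)) \<and>
          (d = 2 \<and> n = 3 \<longrightarrow> equivalent d n Q form_b) \<and>
          (d = 3 \<and> n = 2 \<longrightarrow>
             (dd d n Q 3 1 = 1 \<and> dd d n Q 2 2 = 1 \<longrightarrow>
                equivalent d n Q form_c1_1 \<or> equivalent d n Q form_c1_2) \<and>
             (dd d n Q 3 1 = 1 \<and> dd d n Q 2 2 = 2 \<longrightarrow> equivalent d n Q form_c2) \<and>
             (dd d n Q 3 1 = 2 \<and> dd d n Q 2 2 = 0 \<longrightarrow> equivalent d n Q form_c3) \<and>
             (dd d n Q 3 1 = 2 \<and> dd d n Q 2 2 = 1 \<longrightarrow>
                equivalent d n Q form_c4_1 \<or> equivalent d n Q form_c4_2 \<or>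
                equivalent d n Q form_c4_3) \<and>
             (dd d n Q 3 1 = 2 \<and> dd d n Q 2 2 = 2 \<longrightarrow>
                equivalent d n Q form_c5_1 \<or> equivalent d n Q form_c5_2 \<or>
                equivalent d n Q form_c5_3)) \<and>
          ((d = 2 \<and> n = 2 \<and>
              (dd d n Q 2 1 = 1 \<and> dd d n Q 1 2 = 0 \<or>
               dd d n Q 2 1 = 1 \<and> dd d n Q 1 2 = 1 \<or>
               dd d n Q 2 1 = 2)) \<or>
           (d = 2 \<and> n = 3) \<or>
           (d = 3 \<and> n = 2 \<and>
              (dd d n Q 3 1 = 1 \<and> dd d n Q 2 2 = 1 \<or>
               dd d n Q 3 1 = 1 \<and> dd d n Q 2 2 = 2 \<or>
               dd d n Q 3 1 = 2 \<and> dd d n Q 2 2 = 0 \<or>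
               dd d n Q 3 1 = 2 \<and> dd d n Q 2 2 = 1 \<or>
               dd d n Q 3 1 = 2 \<and> dd d n Q 2 2 = 2)))) \<and>
         pairwise_inequivalent 2 2 [form_a1, form_a2, form_a3] \<and>
         pairwise_inequivalent 2 3 [form_b] \<and>
         pairwise_inequivalent 3 2
           [form_c1_1, form_c1_2, form_c2, form_c3, form_c4_1, form_c4_2, form_c4_3,
            form_c5_1, form_c5_2, form_c5_3]"
proof (intro conjI, goal_cases)
  case 1
  show ?case
  proof (intro allI impI, goal_cases)
    case (1 d n Q)
    then have Q: "quadratic_tuple d n Q" "dd d n Q d n = d" "dd d n Q d 1 > 0" by simp_all
    have "d = 1 \<and> n \<ge> 2 \<or> d = 2 \<and> n = 2 \<or> d = 2 \<and> n = 3 \<or> d = 3 \<and> n = 2" using 1 by arith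
    then consider "d = 1" "n \<ge> 2" | "d = 2" "n = 2" | "d = 2" "n = 3" | "d = 3" "n = 2" by blast
    then show ?case
    proof cases
      case 1
      then show ?thesis using dd_one_variable[of n Q] Q by simp
    next
      case 2
      show ?thesis unfolding 2 using normal_forms_2_2[OF Q[unfolded 2]] by (elim disjE conjE) simp_all
    next
      case 3
      show ?thesis unfolding 3 using equivalent_form_b Q(1,3)[unfolded 3] by simp
    next
      case 4
      show ?thesis unfolding 4 using normal_forms_3_2[OF Q[unfolded 4]] by (elim disjE conjE) simp_all
    qed
  qed
next
  case 2
  show ?case using pairwise_inequivalent_forms2 unfolding forms2_def .
next
  case 3
  show ?case by (simp add: pairwise_inequivalent_def)
next
  case 4
  show ?case using pairwise_inequivalent_forms3 unfolding forms3_def .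
qed

end
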